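(* Assume $\sigma^2<\infty$ and $1<\mu^{-1}<\beta$. For $t>0$ and $k\ge1$ let $n_k(t)=\lfloor t\mu^{-k}\rfloor$. Then for every $t>0$, as $k\to\infty$, \[\frac{\Delta_{n_k(t)}}{n_k(t)^{1/\gamma}}\to R_t\] in distribution under $\mathbb{P}$, where $R_t$ is a random variable with an infinitely divisible law.
   Context: Let $\xi$ be a random variable on $\{0,1,2,\dots\}$ with $\mathbf{P}(\xi=k)=p_k$, mean $\mu=\mathbf{E}[\xi]\in(0,1)$ and variance $\sigma^2$. Let $\xi^*$ have the size-biased law $\mathbf{P}(\xi^*=k)=kp_k/\mu$, $k\ge1$. The subcritical Galton–Watson tree conditioned to survive, $\mathcal{T}$, is constructed as follows: start with a special vertex $\rho=\rho_0$; each special vertex $\rho_i$ has an independent number $\xi^*_{\rho_i}$ of children, one of which, chosen uniformly at random, is special and is called $\rho_{i+1}$; the remaining children are normal; every normal vertex has an independent number of normal children distributed as $\xi$. Write $d_x$ for the number of children of $x$. For $\beta>1$, the $\beta$-biased random walk $(X_m)_{m\ge0}$ on $\mathcal{T}$ starts at $X_0=\rho$ and, from $x\neq\rho$, moves to the parent of $x$ with probability $1/(1+\beta d_x)$ and to each child with probability $\beta/(1+\beta d_x)$; from $\rho$ it moves to each child with probability $1/d_\rho$. $\mathbb{P}$ is the annealed law (quenched law of the walk averaged over the law of $\mathcal{T}$). $\Delta_m=\inf\{k\ge0:X_k=\rho_m\}$ and $\gamma=\log(\mu^{-1})/\log(\beta)$. *)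

theory Defs
  imports "HOL-Probability.Probability"
begin

definition mean_off :: "nat pmf \<Rightarrow> real" where
  "mean_off \<xi> = measure_pmf.expectation \<xi> real"

definition var_off :: "nat pmf \<Rightarrow> real" where
  "var_off \<xi> = measure_pmf.variance \<xi> real"

definition size_biased :: "nat pmf \<Rightarrow> nat pmf" where
  "size_biased \<xi> = embed_pmf (\<lambda>k. real k * pmf \<xi> k / mean_off \<xi>)"

text \<open>Data of a special vertex: its number of children xi* and the index
  (uniform among its children) of the special child.\<close>
definition spine_pmf :: "nat pmf \<Rightarrow> (nat \<times> nat) pmf" where
  "spine_pmf \<xi> = bind_pmf (size_biased \<xi>)
     (\<lambda>k. map_pmf (\<lambda>u. (k, u)) (pmf_of_set {..<k}))"

text \<open>Vertices are Ulam-Harris words stored reversed: the root is [],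
  child j of v is j # v, the parent of v is tl v.
  An environment consists of the data of the special vertices (indexed by
  generation) and an i.i.d. family of offspring numbers for all words,
  used for the normal vertices.\<close>

type_synonym env = "(nat \<Rightarrow> nat \<times> nat) \<times> (nat list \<Rightarrow> nat)"

definition tree_measure :: "nat pmf \<Rightarrow> env measure" where
  "tree_measure \<xi> =
     (PiM UNIV (\<lambda>_::nat. measure_pmf (spine_pmf \<xi>))) \<Otimes>\<^sub>M
     (PiM UNIV (\<lambda>_::nat list. measure_pmf \<xi>))"

primrec spine :: "env \<Rightarrow> nat \<Rightarrow> nat list" where
  "spine \<omega> 0 = []"
| "spine \<omega> (Suc i) = snd (fst \<omega> i) # spine \<omega> i"

definition deg :: "env \<Rightarrow> nat list \<Rightarrow> nat" where
  "deg \<omega> v = (if v = spine \<omega> (length v) then fst (fst \<omega> (length v)) else snd \<omega> v)"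

definition children :: "env \<Rightarrow> nat list \<Rightarrow> nat list set" where
  "children \<omega> v = (\<lambda>j. j # v) ` {..<deg \<omega> v}"

definition step :: "real \<Rightarrow> env \<Rightarrow> nat list \<Rightarrow> nat list pmf" where
  "step \<beta> \<omega> v =
    (if v = [] then pmf_of_set (children \<omega> v)
     else if deg \<omega> v = 0 then return_pmf (tl v)
     else bind_pmf (bernoulli_pmf (1 / (1 + \<beta> * real (deg \<omega> v))))
            (\<lambda>b. if b then return_pmf (tl v) else pmf_of_set (children \<omega> v)))"

primrec path_pmf :: "real \<Rightarrow> env \<Rightarrow> nat \<Rightarrow> nat list list pmf" where
  "path_pmf \<beta> \<omega> 0 = return_pmf [[]]"
| "path_pmf \<beta> \<omega> (Suc n) =
     bind_pmf (path_pmf \<beta> \<omega> n) (\<lambda>p. map_pmf (\<lambda>w. w # p) (step \<beta> \<omega> (hd p)))"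

text \<open>Quenched probability that Delta_m \<le> n, i.e. rho_m is among X_0..X_n.\<close>
definition quenched_hit :: "real \<Rightarrow> env \<Rightarrow> nat \<Rightarrow> nat \<Rightarrow> real" where
  "quenched_hit \<beta> \<omega> m n = measure_pmf.prob (path_pmf \<beta> \<omega> n) {p. spine \<omega> m \<in> set p}"

definition annealed_cdf :: "nat pmf \<Rightarrow> real \<Rightarrow> nat \<Rightarrow> real \<Rightarrow> real" where
  "annealed_cdf \<xi> \<beta> m x =
     (if x < 0 then 0
      else \<integral>\<omega>. quenched_hit \<beta> \<omega> m (nat \<lfloor>x\<rfloor>) \<partial>tree_measure \<xi>)"

fun conv_pow :: "real measure \<Rightarrow> nat \<Rightarrow> real measure" where
  "conv_pow \<eta> 0 = return borel 0"
| "conv_pow \<eta> (Suc 0) = \<eta>"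
| "conv_pow \<eta> (Suc n) = convolution \<eta> (conv_pow \<eta> n)"

definition inf_divisible :: "real measure \<Rightarrow> bool" where
  "inf_divisible \<nu> \<longleftrightarrow>
     real_distribution \<nu> \<and>
     (\<forall>n\<ge>1. \<exists>\<eta>. real_distribution \<eta> \<and> \<nu> = conv_pow \<eta> n)"

end

theory Submission
  imports Defs
begin

text \<open>
  Everything is expressed through Laplace transforms at \<open>q = 1 / (1 + \<epsilon>)\<close>. Under the quenched law,
  \<open>1 / E[q ^ \<Delta>\<^sub>m]\<close> solves a second-order linear recursion along the spine, driven by weights \<open>A\<^sub>i\<close> that
  collect the killing probabilities in the traps hanging off the \<open>i\<close>-th spine vertex. With
  \<open>\<kappa> = \<beta> / (\<beta> - 1)\<close> the solution is at most the product of the factors \<open>1 + \<kappa> A\<^sub>i\<close>, and it is close to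
  that product because large weights are rare; the weights are i.i.d. under the annealed law, so the
  annealed transform is asymptotically \<open>(1 - a) ^ m\<close> with \<open>a = E[\<kappa> A / (1 + \<kappa> A)]\<close>.

  The killing probability \<open>p\<close> of a Galton--Watson trap satisfies \<open>p = w / (1 + w)\<close>,
  \<open>w = \<epsilon> (1 + \<beta> d) + \<beta> (p\<^sub>1 + \<dots> + p\<^sub>d)\<close>. Fractional-linear test functions are closed under
  \<open>p \<mapsto> \<beta> p / (1 + \<beta> p)\<close> and are almost additive, since two children are rarely both relevant, so
  their expectations form an almost geometric sequence of ratio \<open>\<mu>\<close>. At \<open>\<epsilon> \<sim> \<sigma> \<beta> ^ -k\<close> this pushes
  the computation down \<open>k - L\<close> generations, where \<open>p / \<epsilon>\<close> converges monotonically; hence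
  \<open>\<mu> ^ -k a\<close> converges to some \<open>r(\<sigma>)\<close> with \<open>r(\<sigma> / \<beta>) = \<mu> r(\<sigma>)\<close>. The limit transform
  \<open>exp (- t r(\<sigma>))\<close> tends to 1 as \<open>\<sigma> \<rightarrow> 0\<close>, which gives tightness, and it is a semigroup in \<open>t\<close>, which
  gives infinite divisibility.
\<close>

subsection \<open>Laplace transforms of distributions on the half-line\<close>

text \<open>Two scales compete. One generation deeper in a trap, the useful test function is steeper
  by a factor \<beta>, which is why \<open>\<epsilon> * \<beta> ^ k\<close> must stay of order one,
  while its expectation loses a factor \<mu>. Because \<mu>\<beta> > 1, the direct effect of killing
  on the spine and in the upper generations of a trap is negligible against
  \<open>\<mu> ^ k\<close>. The relation for \<open>r\<close> is a scaling by the single factor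
  \<beta>; this is the reason for the geometric sequence of indices. The second moment shapes the
  error terms. At a normal vertex, the loss from two relevant children is quadratic and is paid for
  by E[\<xi>^2]. At a special vertex the degree is size-biased and only its mean is under control,
  so there the quadratic bound is kept together with a trivial linear one and disappears by
  dominated convergence. The constant \<kappa> is the sum 1 + 1/\<beta> + 1/\<beta>^2 + ...: a
  weight acts on the spine recursion once directly and then through an echo that fades by 1/\<beta>
  at each step.\<close>

lemma integrable_exp_neg:
  fixes M :: "real measure"
  assumes "real_distribution M" "AE x in M. 0 \<le> x" "0 \<le> \<theta>"
  shows "integrable M (\<lambda>x. exp (- \<theta> * x))"
proof -
  interpret real_distribution M by fact
  show ?thesis
    by (rule integrable_const_bound[where B=1]) (use assms in \<open>auto simp: mult_nonneg_nonneg\<close>)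
qed

text \<open>Under x -> exp (-x) the half-line goes into the unit interval and the transform at a
  positive integer becomes a moment. Weierstrass approximation extends equality of moments to all
  continuous functions, and cosine and sine then give equal characteristic functions.\<close>

lemma laplace_unique:
  fixes M N :: "real measure"
  assumes rd: "real_distribution M" "real_distribution N"
    and nn: "AE x in M. 0 \<le> x" "AE x in N. 0 \<le> x"
    and eq: "\<And>\<theta>. 0 < \<theta> \<Longrightarrow> (\<integral>x. exp (- \<theta> * x) \<partial>M) = (\<integral>x. exp (- \<theta> * x) \<partial>N)"
  shows "M = N"
proof -
  define e :: "real \<Rightarrow> real" where "e x = exp (- x)" for x
  have e_m[measurable]: "e \<in> borel_measurable borel" unfolding e_def by measurable
  interpret M: real_distribution M by fact
  interpret N: real_distribution N by fact
  define M' where "M' = distr M borel e"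
  define N' where "N' = distr N borel e"
  have rd': "real_distribution M'" "real_distribution N'"
    unfolding M'_def N'_def by (auto intro!: M.real_distribution_distr N.real_distribution_distr)
  interpret M': real_distribution M' by fact
  interpret N': real_distribution N' by fact
  have in01: "AE y in M'. y \<in> {0..1}" "AE y in N'. y \<in> {0..1}"
    unfolding M'_def N'_def using nn by (auto simp: AE_distr_iff e_def)
  have int: "integrable M' f" "integrable N' f" if f: "continuous_on UNIV f" for f :: "real \<Rightarrow> real"
  proof -
    have [measurable]: "f \<in> borel_measurable borel" using f by (rule borel_measurable_continuous_onI)
    have "compact (f ` {0..1})"
      by (intro compact_continuous_image continuous_on_subset[OF f]) auto
    then obtain B where B: "\<And>y. y \<in> {0..1} \<Longrightarrow> norm (f y) \<le> B"
      by (meson bounded_iff compact_imp_bounded imageI)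
    show "integrable M' f"
      by (rule M'.integrable_const_bound[where B=B]) (use in01(1) B in auto)
    show "integrable N' f"
      by (rule N'.integrable_const_bound[where B=B]) (use in01(2) B in auto)
  qed
  have pow: "(\<integral>y. y ^ j \<partial>M') = (\<integral>y. y ^ j \<partial>N')" for j :: nat
  proof (cases "j = 0")
    case True
    then show ?thesis using M'.prob_space N'.prob_space by simp
  next
    case False
    have "e x ^ j = exp (- real j * x)" for x
      unfolding e_def by (simp add: exp_of_nat_mult[symmetric])
    then show ?thesis unfolding M'_def N'_def using eq[of "real j"] False
      by (simp add: integral_distr)
  qed
  have poly: "(\<integral>y. p y \<partial>M') = (\<integral>y. p y \<partial>N')" if p: "real_polynomial_function p" for p
  proof -
    obtain a n where pe: "p = (\<lambda>x. \<Sum>i\<le>n. a i * x ^ i)"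
      using p unfolding real_polynomial_function_iff_sum by auto
    have i: "integrable M' (\<lambda>y. y ^ i)" "integrable N' (\<lambda>y. y ^ i)" for i :: nat
      by (intro int continuous_intros)+
    show ?thesis unfolding pe using i by (simp add: pow)
  qed
  have cont: "(\<integral>y. f y \<partial>M') = (\<integral>y. f y \<partial>N')" if f: "continuous_on UNIV f" for f :: "real \<Rightarrow> real"
  proof -
    have "\<bar>(\<integral>y. f y \<partial>M') - (\<integral>y. f y \<partial>N')\<bar> \<le> 0 + \<delta>" if d: "0 < \<delta>" for \<delta> :: real
    proof -
      obtain p where p: "real_polynomial_function p"
        and ap: "\<And>y. y \<in> {0..1} \<Longrightarrow> \<bar>f y - p y\<bar> < \<delta> / 2"
        using Stone_Weierstrass_real_polynomial_function[of "{0..1::real}" f "\<delta>/2"]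
          continuous_on_subset[OF f] d by (metis compact_Icc half_gt_zero subset_UNIV)
      have pc: "continuous_on UNIV p"
        using p by (intro continuous_on_polymonial_function) (simp add: real_polynomial_function_eq)
      have 1: "\<bar>(\<integral>y. f y \<partial>Q) - (\<integral>y. p y \<partial>Q)\<bar> \<le> \<delta> / 2"
        if Q: "real_distribution Q" "integrable Q f" "integrable Q p" "AE y in Q. y \<in> {0..1}" for Q
      proof -
        interpret Q: real_distribution Q by fact
        have "\<bar>(\<integral>y. f y \<partial>Q) - (\<integral>y. p y \<partial>Q)\<bar> = \<bar>\<integral>y. f y - p y \<partial>Q\<bar>"
          using Q by simp
        also have "\<dots> \<le> (\<integral>y. \<bar>f y - p y\<bar> \<partial>Q)"
          by (rule integral_abs_bound)
        also have "\<dots> \<le> (\<integral>y. \<delta> / 2 \<partial>Q)"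
          by (rule integral_mono_AE) (use Q ap in \<open>auto intro: less_imp_le\<close>)
        finally show ?thesis using Q.prob_space by simp
      qed
      show ?thesis
        using 1[OF rd'(1) int(1)[OF f] int(1)[OF pc] in01(1)] 1[OF rd'(2) int(2)[OF f] int(2)[OF pc] in01(2)] poly[OF p]
        by linarith
    qed
    then have "\<bar>(\<integral>y. f y \<partial>M') - (\<integral>y. f y \<partial>N')\<bar> \<le> 0"
      by (rule field_le_epsilon)
    then show ?thesis by simp
  qed
  have "char M' = char N'"
  proof
    fix t :: real
    have i: "integrable M' (\<lambda>x. iexp (t * x))" "integrable N' (\<lambda>x. iexp (t * x))"
      by (auto intro!: M'.integrable_const_bound[where B=1] N'.integrable_const_bound[where B=1])
    have c: "(\<integral>y. cos (t * y) \<partial>M') = (\<integral>y. cos (t * y) \<partial>N')"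
      "(\<integral>y. sin (t * y) \<partial>M') = (\<integral>y. sin (t * y) \<partial>N')"
      by (intro cont continuous_intros)+
    show "char M' t = char N' t"
      unfolding char_def
    proof (rule complex_eqI)
      show "Re (CLINT x|M'. iexp (t * x)) = Re (CLINT x|N'. iexp (t * x))"
        unfolding integral_Re[OF i(1), symmetric] integral_Re[OF i(2), symmetric]
        using c(1) by (simp add: Re_exp)
      show "Im (CLINT x|M'. iexp (t * x)) = Im (CLINT x|N'. iexp (t * x))"
        unfolding integral_Im[OF i(1), symmetric] integral_Im[OF i(2), symmetric]
        using c(2) by (simp add: Im_exp)
    qed
  qed
  then have MN': "M' = N'" using Levy_uniqueness rd' by blast
  have undo: "distr (distr Q borel e) borel (\<lambda>y. - ln y) = Q" if "real_distribution Q" for Q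
  proof -
    interpret Q: real_distribution Q by fact
    have "distr (distr Q borel e) borel (\<lambda>y. - ln y) = distr Q borel (\<lambda>x. x)"
      by (subst distr_distr) (auto simp: o_def e_def)
    also have "\<dots> = Q" by (rule distr_id2) simp
    finally show ?thesis .
  qed
  have "distr M' borel (\<lambda>y. - ln y) = M" "distr N' borel (\<lambda>y. - ln y) = N"
    unfolding M'_def N'_def by (fact undo[OF rd(1)] undo[OF rd(2)])+
  then show ?thesis unfolding MN' by (rule box_equals[OF refl])
qed

lemma weak_limit_laplace:
  fixes M :: "nat \<Rightarrow> real measure"
  assumes rd: "\<And>n. real_distribution (M n)" "real_distribution \<nu>" and wc: "weak_conv_m M \<nu>"
    and nn: "\<And>n. AE x in M n. 0 \<le> x"
  shows "AE x in \<nu>. 0 \<le> x"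
    and "0 < \<theta> \<Longrightarrow> (\<lambda>n. \<integral>x. exp (- \<theta> * x) \<partial>M n) \<longlonglongrightarrow> (\<integral>x. exp (- \<theta> * x) \<partial>\<nu>)"
proof -
  interpret \<nu>: real_distribution \<nu> by fact
  have test: "(\<lambda>n. integral\<^sup>L (M n) f) \<longlonglongrightarrow> integral\<^sup>L \<nu> f"
    if "\<And>x. isCont f x" "\<And>x. norm (f x) \<le> 1" for f :: "real \<Rightarrow> real"
    using rd wc that by (intro weak_conv_imp_integral_bdd_continuous_conv[where B=1])
  \<comment> \<open>A bounded continuous function that vanishes exactly on the half-line: a zero
    integral in the limit forces the limit law to live there.\<close>
  define g :: "real \<Rightarrow> real" where "g x = min 1 (max 0 (- x))" for x
  have gm[measurable]: "g \<in> borel_measurable borel" unfolding g_def by measurable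
  have g1: "(\<lambda>n. integral\<^sup>L (M n) g) \<longlonglongrightarrow> integral\<^sup>L \<nu> g"
    by (rule test) (auto simp: g_def[abs_def] intro!: continuous_intros)
  have "integral\<^sup>L (M n) g = 0" for n
  proof -
    interpret Mn: real_distribution "M n" by (rule rd)
    have "AE x in M n. g x = 0" using nn[of n] by eventually_elim (simp add: g_def)
    then show ?thesis by (rule integral_eq_zero_AE)
  qed
  then have "integral\<^sup>L \<nu> g = 0" using g1 by (simp add: LIMSEQ_const_iff)
  moreover have "integrable \<nu> g"
    by (rule \<nu>.integrable_const_bound[where B=1]) (auto simp: g_def)
  moreover have "AE x in \<nu>. 0 \<le> g x" by (simp add: g_def)
  ultimately have "AE x in \<nu>. g x = 0"
    using integral_nonneg_eq_0_iff_AE by blast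
  then show pos: "AE x in \<nu>. 0 \<le> x" by eventually_elim (auto simp: g_def min_def max_def split: if_splits)
  assume "0 < \<theta>"
  \<comment> \<open>\<open>max 0 x\<close> makes the exponential bounded on the whole line, as weak
    convergence requires, and changes it only on a null set.\<close>
  have "(\<lambda>n. \<integral>x. exp (- \<theta> * max 0 x) \<partial>M n) \<longlonglongrightarrow> (\<integral>x. exp (- \<theta> * max 0 x) \<partial>\<nu>)"
    by (rule test) (use \<open>0 < \<theta>\<close> in \<open>auto intro!: continuous_intros\<close>)
  moreover have "(\<integral>x. exp (- \<theta> * max 0 x) \<partial>Q) = (\<integral>x. exp (- \<theta> * x) \<partial>Q)"
    if "real_distribution Q" "AE x in Q. 0 \<le> x" for Q
  proof -
    interpret Q: real_distribution Q by fact
    have "AE x in Q. exp (- \<theta> * max 0 x) = exp (- \<theta> * x)"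
      using that(2) by eventually_elim simp
    then show ?thesis by (intro integral_cong_AE) auto
  qed
  ultimately show "(\<lambda>n. \<integral>x. exp (- \<theta> * x) \<partial>M n) \<longlonglongrightarrow> (\<integral>x. exp (- \<theta> * x) \<partial>\<nu>)"
    using rd nn pos by simp
qed

text \<open>Beyond \<open>1/\<theta>\<close> the exponential is at most exp (-1) \<le> 1/2, so
  \<open>1/2 + 1/2 * indicator\<close> dominates it. The left end -1 serves tightness, which speaks
  of half-open intervals: an atom at 0 must lie inside.\<close>

lemma laplace_tail_bound:
  fixes M :: "real measure"
  assumes rd: "real_distribution M" and nn: "AE x in M. 0 \<le> x" and th: "0 < \<theta>"
  shows "measure M {-1<..1/\<theta>} \<ge> 1 - 2 * (1 - (\<integral>x. exp (- \<theta> * x) \<partial>M))"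
proof -
  interpret real_distribution M by fact
  have i: "integrable M (\<lambda>x. exp (- \<theta> * x))"
    by (rule integrable_exp_neg) (use assms in auto)
  have e1: "exp (-1) \<le> (1/2::real)"
    using exp_ge_add_one_self[of 1] by (simp add: exp_minus field_simps)
  have "(\<integral>x. exp (- \<theta> * x) \<partial>M) \<le> (\<integral>x. 1/2 + 1/2 * indicator {-1<..1/\<theta>} x \<partial>M)"
  proof (rule integral_mono_AE[OF i])
    show "integrable M (\<lambda>x. 1/2 + 1/2 * indicator {-1<..1/\<theta>} x :: real)"
      by (rule integrable_const_bound[where B=1]) (auto simp: indicator_def)
    show "AE x in M. exp (- \<theta> * x) \<le> 1/2 + 1/2 * indicator {-1<..1/\<theta>} x"
      using nn
    proof eventually_elim
      case (elim x)
      show ?case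
      proof (cases "x \<le> 1/\<theta>")
        case True
        then show ?thesis using elim th by (simp add: mult_nonneg_nonneg)
      next
        case False
        then have "1 \<le> \<theta> * x" using th by (simp add: field_simps)
        then have "exp (- \<theta> * x) \<le> exp (-1)" by simp
        then have "exp (- \<theta> * x) \<le> 1/2" using e1 by (rule order_trans)
        then show ?thesis using False by simp
      qed
    qed
  qed
  also have "\<dots> = 1/2 + 1/2 * measure M {-1<..1/\<theta>}"
  proof -
    have "integrable M (\<lambda>x. 1/2 * indicator {-1<..1/\<theta>} x :: real)"
      by (rule integrable_const_bound[where B=1]) (auto simp: indicator_def)
    then show ?thesis using prob_space by (subst Bochner_Integration.integral_add) auto
  qed
  finally show ?thesis by simp
qed

text \<open>A limit transform close to 1 at a single \<open>\<theta>\<close> controls the tails of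
  all late members at once; the finitely many early ones are covered individually. Assumption
  \<open>zero\<close> is what keeps mass from escaping to infinity.\<close>

lemma tight_laplace:
  fixes M :: "nat \<Rightarrow> real measure"
  assumes rd: "\<And>n. real_distribution (M n)" and nn: "\<And>n. AE x in M n. 0 \<le> x"
    and conv: "\<And>\<theta>. 0 < \<theta> \<Longrightarrow> (\<lambda>n. \<integral>x. exp (- \<theta> * x) \<partial>M n) \<longlonglongrightarrow> \<phi> \<theta>"
    and zero: "\<And>\<delta>. 0 < \<delta> \<Longrightarrow> \<exists>\<theta>>0. \<phi> \<theta> > 1 - \<delta>"
  shows "tight M"
  unfolding tight_def
proof (intro conjI allI impI)
  show "real_distribution (M n)" for n by (rule rd)
  fix \<epsilon> :: real assume e: "0 < \<epsilon>"
  obtain \<theta> where th: "0 < \<theta>" "\<phi> \<theta> > 1 - \<epsilon> / 2" using zero[of "\<epsilon>/2"] e by auto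
  have "\<forall>\<^sub>F n in sequentially. (\<integral>x. exp (- \<theta> * x) \<partial>M n) > 1 - \<epsilon> / 2"
    using conv[OF th(1)] th(2) by (rule order_tendstoD)
  then obtain N where N: "\<And>n. n \<ge> N \<Longrightarrow> (\<integral>x. exp (- \<theta> * x) \<partial>M n) > 1 - \<epsilon> / 2"
    by (auto simp: eventually_sequentially)
  have "\<exists>R. measure (M n) {-1<..R} > 1 - \<epsilon>" for n
  proof -
    interpret real_distribution "M n" by (rule rd)
    obtain R where R: "cdf (M n) (real R) > 1 - \<epsilon>"
      using order_tendstoD(1)[OF cdf_lim_infty_prob, of "1 - \<epsilon>"] e
      by (auto simp: eventually_sequentially)
    have "measure (M n) {-1<..real R} = measure (M n) {..real R}"
      by (rule finite_measure_eq_AE) (use nn[of n] in \<open>auto\<close>)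
    then have "measure (M n) {-1<..real R} > 1 - \<epsilon>" using R by (simp add: cdf_def)
    then show ?thesis by blast
  qed
  then obtain R where R: "\<And>n. measure (M n) {-1<..R n} > 1 - \<epsilon>" by metis
  define b where "b = Max (insert (1/\<theta>) (R ` {..<N}))"
  have b0: "1/\<theta> \<le> b" unfolding b_def by simp
  have b1: "n < N \<Longrightarrow> R n \<le> b" for n unfolding b_def by simp
  have "measure (M n) {-1<..b} > 1 - \<epsilon>" for n
  proof -
    interpret real_distribution "M n" by (rule rd)
    have mon: "measure (M n) {-1<..r} \<le> measure (M n) {-1<..b}" if "r \<le> b" for r
      by (rule finite_measure_mono) (use that in auto)
    show ?thesis
    proof (cases "n < N")
      case True
      then show ?thesis using mon[OF b1[OF True]] R[of n] by simp
    next
      case False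
      then show ?thesis using mon[OF b0] laplace_tail_bound[OF rd nn th(1), of n] N[of n]
        by (simp add: not_less)
    qed
  qed
  moreover have "-1 < b" using b0 th(1) by (smt (verit) zero_less_divide_iff)
  ultimately show "\<exists>a b. a < b \<and> (\<forall>n. 1 - \<epsilon> < measure (M n) {a<..b})" by blast
qed

text \<open>Tightness produces a limit along a subsequence. Every other subsequential limit has the
  transform \<open>\<phi>\<close> as well, hence is the same law, so the whole sequence converges.
  That \<open>\<phi>\<close> is a transform at all is part of the conclusion.\<close>

lemma laplace_continuity:
  fixes M :: "nat \<Rightarrow> real measure"
  assumes rd: "\<And>n. real_distribution (M n)" and nn: "\<And>n. AE x in M n. 0 \<le> x"
    and conv: "\<And>\<theta>. 0 < \<theta> \<Longrightarrow> (\<lambda>n. \<integral>x. exp (- \<theta> * x) \<partial>M n) \<longlonglongrightarrow> \<phi> \<theta>"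
    and zero: "\<And>\<delta>. 0 < \<delta> \<Longrightarrow> \<exists>\<theta>>0. \<phi> \<theta> > 1 - \<delta>"
  obtains \<nu> where "real_distribution \<nu>" "AE x in \<nu>. 0 \<le> x"
    "\<And>\<theta>. 0 < \<theta> \<Longrightarrow> (\<integral>x. exp (- \<theta> * x) \<partial>\<nu>) = \<phi> \<theta>" "weak_conv_m M \<nu>"
proof -
  have t: "tight M" using assms by (rule tight_laplace)
  have sub: "AE x in \<nu>. 0 \<le> x" "\<And>\<theta>. 0 < \<theta> \<Longrightarrow> (\<integral>x. exp (- \<theta> * x) \<partial>\<nu>) = \<phi> \<theta>"
    if s: "strict_mono s" and \<nu>: "real_distribution \<nu>" "weak_conv_m (M \<circ> s) \<nu>" for s \<nu>
  proof -
    show "AE x in \<nu>. 0 \<le> x"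
      by (rule weak_limit_laplace(1)[OF _ \<nu>]) (unfold comp_apply, rule rd, rule nn)
    fix \<theta> :: real assume th: "0 < \<theta>"
    have "(\<lambda>n. \<integral>x. exp (- \<theta> * x) \<partial>(M \<circ> s) n) \<longlonglongrightarrow> (\<integral>x. exp (- \<theta> * x) \<partial>\<nu>)"
      by (rule weak_limit_laplace(2)[OF _ \<nu>]) (unfold comp_apply, rule rd, rule nn, rule th)
    moreover have "(\<lambda>n. \<integral>x. exp (- \<theta> * x) \<partial>(M \<circ> s) n) \<longlonglongrightarrow> \<phi> \<theta>"
      using LIMSEQ_subseq_LIMSEQ[OF conv[OF th] s] by (simp add: o_def)
    ultimately show "(\<integral>x. exp (- \<theta> * x) \<partial>\<nu>) = \<phi> \<theta>" using LIMSEQ_unique by blast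
  qed
  obtain r \<nu> where r: "strict_mono r" "real_distribution \<nu>" "weak_conv_m (M \<circ> id \<circ> r) \<nu>"
    using tight_imp_convergent_subsubsequence[OF t strict_mono_id] by blast
  have r3: "weak_conv_m (M \<circ> r) \<nu>" using r(3) by simp
  note 1 = sub[OF r(1,2) r3]
  have "weak_conv_m M \<nu>"
  proof (rule tight_subseq_weak_converge[OF rd r(2) t])
    fix s \<nu>' assume s: "strict_mono s" "real_distribution \<nu>'" "weak_conv_m (M \<circ> s) \<nu>'"
    have "\<nu>' = \<nu>" using sub[OF s] 1 r(2) s(2) by (intro laplace_unique) auto
    then show "weak_conv_m (M \<circ> s) \<nu>" using s(3) by simp
  qed
  then show ?thesis using that r(2) 1 by blast
qed

section \<open>Convolution powers on the half-line\<close>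

lemma convolution_nonneg_laplace:
  fixes M N :: "real measure"
  assumes rd: "real_distribution M" "real_distribution N"
    and nn: "AE x in M. 0 \<le> x" "AE x in N. 0 \<le> x"
  shows "real_distribution (convolution M N)" "AE x in convolution M N. 0 \<le> x"
    and "0 \<le> \<theta> \<Longrightarrow> (\<integral>x. exp (- \<theta> * x) \<partial>convolution M N)
      = (\<integral>x. exp (- \<theta> * x) \<partial>M) * (\<integral>x. exp (- \<theta> * x) \<partial>N)"
proof -
  interpret M: real_distribution M by fact
  interpret N: real_distribution N by fact
  interpret MN: pair_prob_space M N ..
  have [measurable]: "(\<lambda>(x,y). x + y) \<in> borel_measurable (M \<Otimes>\<^sub>M N)"
    by measurable
  show rdc: "real_distribution (convolution M N)"
    unfolding convolution_def by (rule MN.real_distribution_distr) measurable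
  have "AE z in M \<Otimes>\<^sub>M N. 0 \<le> fst z" "AE z in M \<Otimes>\<^sub>M N. 0 \<le> snd z"
  proof -
    have [measurable]: "{z \<in> space (M \<Otimes>\<^sub>M N). 0 \<le> fst z} \<in> sets (M \<Otimes>\<^sub>M N)"
      "{z \<in> space (M \<Otimes>\<^sub>M N). 0 \<le> snd z} \<in> sets (M \<Otimes>\<^sub>M N)" by measurable
    show "AE z in M \<Otimes>\<^sub>M N. 0 \<le> fst z" "AE z in M \<Otimes>\<^sub>M N. 0 \<le> snd z"
      by (rule MN.AE_pair_measure, measurable, use nn in simp)+
  qed
  then have nnp: "AE z in M \<Otimes>\<^sub>M N. 0 \<le> fst z \<and> 0 \<le> snd z" by eventually_elim simp
  then show nnc: "AE x in convolution M N. 0 \<le> x"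
    unfolding convolution_def by (subst AE_distr_iff) auto
  assume th: "0 \<le> \<theta>"
  have ip: "integrable (M \<Otimes>\<^sub>M N) (\<lambda>(x,y). exp (- \<theta> * x) * exp (- \<theta> * y))"
  proof (rule MN.integrable_const_bound[where B=1])
    show "AE z in M \<Otimes>\<^sub>M N. norm (case z of (x, y) \<Rightarrow> exp (- \<theta> * x) * exp (- \<theta> * y)) \<le> 1"
      using nnp by eventually_elim (use th in \<open>auto simp: split_beta mult_nonneg_nonneg intro!: mult_le_one\<close>)
  qed measurable
  have "(\<integral>x. exp (- \<theta> * x) \<partial>convolution M N) = (\<integral>z. exp (- \<theta> * (fst z + snd z)) \<partial>(M \<Otimes>\<^sub>M N))"
    unfolding convolution_def by (subst integral_distr) (auto simp: split_beta)
  also have "\<dots> = (\<integral>z. (case z of (x,y) \<Rightarrow> exp (- \<theta> * x) * exp (- \<theta> * y)) \<partial>(M \<Otimes>\<^sub>M N))"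
    by (intro Bochner_Integration.integral_cong refl) (auto simp: split_beta exp_add[symmetric] algebra_simps)
  also have "\<dots> = (\<integral>x. \<integral>y. exp (- \<theta> * x) * exp (- \<theta> * y) \<partial>N \<partial>M)"
    using MN.integral_fst'[OF ip] by simp
  also have "\<dots> = (\<integral>x. exp (- \<theta> * x) \<partial>M) * (\<integral>x. exp (- \<theta> * x) \<partial>N)"
    by simp
  finally show "(\<integral>x. exp (- \<theta> * x) \<partial>convolution M N)
      = (\<integral>x. exp (- \<theta> * x) \<partial>M) * (\<integral>x. exp (- \<theta> * x) \<partial>N)" .
qed

lemma conv_pow_nonneg_laplace:
  fixes M :: "real measure"
  assumes rd: "real_distribution M" and nn: "AE x in M. 0 \<le> x"
  shows "real_distribution (conv_pow M n) \<and> (AE x in conv_pow M n. 0 \<le> x) \<and>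
    (\<forall>\<theta>\<ge>0. (\<integral>x. exp (- \<theta> * x) \<partial>conv_pow M n) = (\<integral>x. exp (- \<theta> * x) \<partial>M) ^ n)"
\<comment> \<open>Three cases, since \<open>conv_pow\<close> takes the first power to be the measure
  itself and not its convolution with a point mass.\<close>
proof (induction n rule: induct_nat_012)
  case 0
  have "real_distribution (return borel (0::real))"
    unfolding real_distribution_def real_distribution_axioms_def by (auto intro: prob_space_return)
  moreover have "AE x in return borel (0::real). 0 \<le> x" by (subst AE_return) auto
  ultimately show ?case unfolding conv_pow.simps by (auto simp: integral_return)
next
  case 1
  then show ?case unfolding conv_pow.simps using assms by simp
next
  case (ge2 n)
  note IH = ge2(2)
  note C = convolution_nonneg_laplace[OF rd conjunct1[OF IH] nn conjunct1[OF conjunct2[OF IH]]]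
  show ?case unfolding conv_pow.simps using C(1,2) C(3) IH by simp
qed

section \<open>Rescaled integer-valued laws given by their distribution functions\<close>

lemma sums_by_parts_geometric:
  fixes H :: "nat \<Rightarrow> real"
  assumes H: "\<And>j. 0 \<le> H j" "\<And>j. H j \<le> 1" and q: "0 < q" "q < 1"
  shows "summable (\<lambda>j. H j * q ^ j)"
    and "(\<lambda>j. q ^ j * (if j = 0 then H 0 else H j - H (j - 1))) sums ((1 - q) * (\<Sum>j. H j * q ^ j))"
proof -
  show s: "summable (\<lambda>j. H j * q ^ j)"
  proof (rule summable_comparison_test')
    show "summable (\<lambda>j. q ^ j)" using q by (auto intro: summable_geometric)
    show "norm (H j * q ^ j) \<le> q ^ j" for j
      using H[of j] q by (simp add: abs_mult mult_left_le_one_le)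
  qed
  let ?S = "\<Sum>j. H j * q ^ j"
  have 1: "(\<lambda>j. H j * q ^ j) sums ?S" using s by (rule summable_sums)
  have "(\<lambda>j. q * (H j * q ^ j)) sums (q * ?S)" using 1 by (rule sums_mult)
  then have "(\<lambda>j. H j * q ^ Suc j) sums (q * ?S)" by (simp add: mult_ac)
  then have 2: "(\<lambda>j. if j = 0 then 0 else H (j - 1) * q ^ j) sums (q * ?S)"
    using sums_Suc_iff[of "\<lambda>j. if j = 0 then 0 else H (j - 1) * q ^ j"] by simp
  have "(\<lambda>j. H j * q ^ j - (if j = 0 then 0 else H (j - 1) * q ^ j)) sums (?S - q * ?S)"
    using 1 2 by (rule sums_diff)
  moreover have "(\<lambda>j. H j * q ^ j - (if j = 0 then 0 else H (j - 1) * q ^ j))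
      = (\<lambda>j. q ^ j * (if j = 0 then H 0 else H j - H (j - 1)))"
    by (auto simp: algebra_simps)
  ultimately show "(\<lambda>j. q ^ j * (if j = 0 then H 0 else H j - H (j - 1))) sums ((1 - q) * ?S)"
    by (simp add: algebra_simps)
qed

text \<open>Hitting times are accessible only through the probabilities \<open>H j\<close> of having
  hit by time j. The increments of \<open>H\<close> are the point masses, \<open>lim\<close> makes
  their total mass one, and Abel summation expresses the transform through \<open>H\<close> itself;
  this is the origin of the factor \<open>1 - exp (- \<theta> / c)\<close>.\<close>

lemma lattice_distribution:
  fixes H :: "nat \<Rightarrow> real"
  assumes mono: "mono H" and H0: "\<And>j. 0 \<le> H j" and lim: "H \<longlonglongrightarrow> 1" and c: "0 < c"
  obtains M where "real_distribution M" "AE x in M. 0 \<le> x"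
    "\<And>x. cdf M x = (if x < 0 then 0 else H (nat \<lfloor>x * c\<rfloor>))"
    "\<And>\<theta>. 0 < \<theta> \<Longrightarrow> (\<integral>x. exp (- \<theta> * x) \<partial>M)
      = (1 - exp (- \<theta> / c)) * (\<Sum>j. H j * exp (- \<theta> / c) ^ j)"
proof -
  define w where "w j = (if j = 0 then H 0 else H j - H (j - 1))" for j
  have w0: "0 \<le> w j" for j
    using H0 monoD[OF mono, of "j - 1" j] by (auto simp: w_def)
  have H1: "H j \<le> 1" for j
    using mono lim by (metis incseq_def monoD incseq_le)
  have part: "(\<Sum>j\<le>n. w j) = H n" for n
    by (induction n) (auto simp: w_def)
  have "(\<lambda>n. \<Sum>j\<le>n. w j) \<longlonglongrightarrow> 1" using lim by (simp add: part)
  then have ws: "w sums 1" by (simp add: sums_def_le)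
  then have wsum: "summable w" "suminf w = 1" by (auto simp: sums_iff)
  have wp: "(\<integral>\<^sup>+ j. ennreal (w j) \<partial>count_space UNIV) = 1"
    using wsum w0 by (simp add: nn_integral_count_space_nat suminf_ennreal2)
  define D where "D = embed_pmf w"
  have D: "pmf D j = w j" for j unfolding D_def by (rule pmf_embed_pmf[OF w0 wp])
  define M where "M = distr (measure_pmf D) borel (\<lambda>j. real j / c)"
  have rd: "real_distribution M"
    unfolding M_def by (rule prob_space.real_distribution_distr[OF prob_space_measure_pmf]) simp
  have nn: "AE x in M. 0 \<le> x"
    unfolding M_def by (subst AE_distr_iff) (use c in auto)
  have cdf: "cdf M x = (if x < 0 then 0 else H (nat \<lfloor>x * c\<rfloor>))" for x
  proof -
    have "cdf M x = measure_pmf.prob D {j. real j \<le> x * c}"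
      unfolding cdf_def M_def by (subst measure_distr) (use c in \<open>auto simp: field_simps vimage_def\<close>)
    also have "\<dots> = (if x < 0 then 0 else H (nat \<lfloor>x * c\<rfloor>))"
    proof (cases "x < 0")
      case True
      then have "x * c < 0" using c by (simp add: mult_neg_pos)
      then have "{j. real j \<le> x * c} = {}" by (auto simp: not_le intro: less_le_trans)
      then show ?thesis using True by simp
    next
      case False
      have "real j \<le> x * c \<longleftrightarrow> j \<le> nat \<lfloor>x * c\<rfloor>" for j
        using False c by (simp add: le_nat_iff le_floor_iff)
      then have "{j. real j \<le> x * c} = {..nat \<lfloor>x * c\<rfloor>}" by auto
      then show ?thesis using False by (simp add: measure_measure_pmf_finite D part)
    qed
    finally show ?thesis .
  qed
  have lap: "(\<integral>x. exp (- \<theta> * x) \<partial>M) = (1 - exp (- \<theta> / c)) * (\<Sum>j. H j * exp (- \<theta> / c) ^ j)"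
    if th: "0 < \<theta>" for \<theta>
  proof -
    let ?q = "exp (- \<theta> / c)"
    have q: "0 < ?q" "?q < 1" using th c by auto
    have e: "exp (- \<theta> * (real j / c)) = ?q ^ j" for j
      by (simp add: exp_of_nat_mult[symmetric])
    note P = sums_by_parts_geometric(2)[of H, OF H0 H1 q, folded w_def]
    have s: "(\<lambda>j. pmf D j *\<^sub>R ?q ^ j) sums ((1 - ?q) * (\<Sum>j. H j * ?q ^ j))"
      using P by (simp add: D mult.commute)
    have int: "integrable (count_space UNIV) (\<lambda>j. pmf D j *\<^sub>R ?q ^ j)"
      unfolding integrable_count_space_nat_iff
      using sums_summable[OF s] w0 by (simp add: D abs_mult)
    have "(\<integral>x. exp (- \<theta> * x) \<partial>M) = (\<integral>j. ?q ^ j \<partial>measure_pmf D)"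
      unfolding M_def by (subst integral_distr) (simp_all only: e, simp_all)
    also have "\<dots> = (\<integral>j. pmf D j *\<^sub>R ?q ^ j \<partial>count_space UNIV)"
      by (simp add: measure_pmf_eq_density integral_density pmf_nonneg)
    also have "\<dots> = (\<Sum>j. pmf D j *\<^sub>R ?q ^ j)"
      using int by (rule integral_count_space_nat)
    also have "\<dots> = (1 - ?q) * (\<Sum>j. H j * ?q ^ j)"
      using s by (rule sums_unique[symmetric])
    finally show ?thesis .
  qed
  show ?thesis using that[OF rd nn cdf lap] by blast
qed

subsection \<open>A linear recursion for products of perturbed steps\<close>

text \<open>The reciprocal of the quenched transform of a hitting time, up to the choice of weights.
  The recursion is the first-step equation at a special vertex, divided by \<beta>, after the traps
  have been eliminated; with zero weights the solution stays at 1.\<close>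

fun perturbed :: "real \<Rightarrow> (nat \<Rightarrow> real) \<Rightarrow> nat \<Rightarrow> real" where
  "perturbed \<beta> A 0 = 1"
| "perturbed \<beta> A (Suc 0) = 1 + A 0"
| "perturbed \<beta> A (Suc (Suc n)) = perturbed \<beta> A (Suc n) * (1 + A (Suc n))
     + (perturbed \<beta> A (Suc n) - perturbed \<beta> A n) / \<beta>"

text \<open>Past weights, discounted by 1/\<beta> per step: the relative distance of the recursion
  from the value at which it would settle if no further weights came.\<close>

primrec memory :: "real \<Rightarrow> (nat \<Rightarrow> real) \<Rightarrow> nat \<Rightarrow> real" where
  "memory \<beta> A 0 = 0"
| "memory \<beta> A (Suc n) = memory \<beta> A n / \<beta> + A n / (\<beta> - 1)"

text \<open>For nonnegative arguments this is the loss \<open>1 - 1 / (1 + c * x)\<close>. With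
  \<open>c = 1\<close> it turns a weight into the corresponding killing probability.\<close>

definition satur :: "real \<Rightarrow> real \<Rightarrow> real" where
  "satur c x = c * x / (1 + c * x)"

lemma satur_bounds:
  assumes "0 \<le> c" "0 \<le> x"
  shows "0 \<le> satur c x" "satur c x \<le> 1" "satur c x < 1" "satur c x \<le> c * x"
proof -
  have "0 \<le> c * x" using assms by simp
  moreover have "y / (1 + y) \<le> y" "y / (1 + y) < 1" if "0 \<le> y" for y :: real
    using that by (simp_all add: field_simps)
  ultimately show "0 \<le> satur c x" "satur c x \<le> 1" "satur c x < 1" "satur c x \<le> c * x"
    unfolding satur_def by (auto intro: less_imp_le)
qed

lemma satur_mono:
  assumes "0 \<le> c" "0 \<le> x" "x \<le> y"
  shows "satur c x \<le> satur c y"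
proof -
  have "c * x \<le> c * y" "0 \<le> c * x" using assms by (auto intro: mult_left_mono)
  then show ?thesis unfolding satur_def by (simp add: field_simps)
qed

lemma one_minus_satur: "0 \<le> c \<Longrightarrow> 0 \<le> x \<Longrightarrow> 1 - satur c x = 1 / (1 + c * x)"
  unfolding satur_def by (simp add: field_simps add_nonneg_eq_0_iff)

context
  fixes \<beta> :: real and A :: "nat \<Rightarrow> real"
  assumes \<beta>: "1 < \<beta>" and A: "\<And>n. 0 \<le> A n"
begin

lemma perturbed_incr: "perturbed \<beta> A n \<le> perturbed \<beta> A (Suc n)" and perturbed_ge1: "1 \<le> perturbed \<beta> A n"
proof -
  have "1 \<le> perturbed \<beta> A n \<and> perturbed \<beta> A n \<le> perturbed \<beta> A (Suc n)"
  proof (induction n)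
    case 0
    then show ?case using A[of 0] by simp
  next
    case (Suc n)
    have "0 \<le> perturbed \<beta> A (Suc n) * A (Suc n)" using Suc A[of "Suc n"] by simp
    moreover have "0 \<le> (perturbed \<beta> A (Suc n) - perturbed \<beta> A n) / \<beta>" using Suc \<beta> by simp
    ultimately show ?case using Suc by (simp add: algebra_simps)
  qed
  then show "perturbed \<beta> A n \<le> perturbed \<beta> A (Suc n)" "1 \<le> perturbed \<beta> A n" by auto
qed

lemma memory_nonneg: "0 \<le> memory \<beta> A n"
  by (induction n) (use \<beta> A in \<open>auto\<close>)

text \<open>The recursion conserves \<open>potential\<close> up to the perturbation, which makes the product bounds exact.\<close>

definition potential :: "nat \<Rightarrow> real" where
  "potential n = (case n of 0 \<Rightarrow> 1
     | Suc m \<Rightarrow> perturbed \<beta> A (Suc m) + (perturbed \<beta> A (Suc m) - perturbed \<beta> A m) / (\<beta> - 1))"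

text \<open>Without later weights the increments would shrink by 1/\<beta> each time, and the
  remaining ones would add up to the last increment over \<beta> - 1. So \<open>potential n\<close>
  is the value at which the sequence would then settle. A weight moves this value by its direct
  effect plus the geometric echo, which together give the factor
  \<open>\<beta> / (\<beta> - 1)\<close>.\<close>

lemma potential_Suc:
  "potential (Suc n) = potential n + \<beta> / (\<beta> - 1) * A n * perturbed \<beta> A n"
proof (cases n)
  case 0
  then show ?thesis using \<beta> by (simp add: potential_def field_simps)
next
  case (Suc m)
  define x where "x = perturbed \<beta> A m"
  define y where "y = perturbed \<beta> A (Suc m)"
  define a where "a = A (Suc m)"
  have "\<beta> \<noteq> 0" "\<beta> - 1 \<noteq> 0" using \<beta> by auto
  then have "y * (1 + a) + (y - x) / \<beta> + (y * (1 + a) + (y - x) / \<beta> - y) / (\<beta> - 1)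
     = y + (y - x) / (\<beta> - 1) + \<beta> / (\<beta> - 1) * a * y"
    by (simp add: divide_simps) (simp add: algebra_simps)
  then show ?thesis using Suc by (simp add: potential_def x_def y_def a_def)
qed

lemma potential_ge: "perturbed \<beta> A n \<le> potential n"
proof (cases n)
  case 0
  then show ?thesis by (simp add: potential_def)
next
  case (Suc m)
  then show ?thesis using perturbed_incr[of m] \<beta> by (simp add: potential_def)
qed

lemma potential_le_prod: "potential n \<le> (\<Prod>i<n. 1 + \<beta> / (\<beta> - 1) * A i)"
proof (induction n)
  case 0
  then show ?case by (simp add: potential_def)
next
  case (Suc n)
  have k: "0 \<le> \<beta> / (\<beta> - 1) * A n" using \<beta> A[of n] by simp
  have "potential (Suc n) \<le> potential n * (1 + \<beta> / (\<beta> - 1) * A n)"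
    using mult_left_mono[OF potential_ge[of n] k] by (simp add: potential_Suc algebra_simps)
  also have "\<dots> \<le> (\<Prod>i<n. 1 + \<beta> / (\<beta> - 1) * A i) * (1 + \<beta> / (\<beta> - 1) * A n)"
    by (rule mult_right_mono[OF Suc]) (use k in simp)
  finally show ?case by simp
qed

text \<open>The gap contracts by 1/\<beta> and receives the echo of the new weight, which is the
  recursion of \<open>memory\<close>. As \<open>perturbed\<close> increases, the bound may always be
  taken relative to its current value.\<close>

lemma potential_gap: "potential n - perturbed \<beta> A n \<le> memory \<beta> A n * perturbed \<beta> A n"
proof (induction n)
  case 0
  then show ?case by (simp add: potential_def)
next
  case (Suc n)
  let ?P = "perturbed \<beta> A"
  have eq: "potential (Suc n) - ?P (Suc n) = (potential n - ?P n) / \<beta> + A n / (\<beta> - 1) * ?P n"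
  proof (cases n)
    case 0
    then show ?thesis by (simp add: potential_def)
  next
    case (Suc m)
    have "\<beta> \<noteq> 0" "\<beta> - 1 \<noteq> 0" using \<beta> by auto
    then show ?thesis unfolding Suc by (simp add: potential_def divide_simps) (simp add: algebra_simps)
  qed
  have "potential (Suc n) - ?P (Suc n) \<le> memory \<beta> A n * ?P n / \<beta> + A n / (\<beta> - 1) * ?P n"
    unfolding eq using divide_right_mono[OF Suc, of \<beta>] \<beta> by simp
  also have "\<dots> = memory \<beta> A (Suc n) * ?P n" by (simp add: algebra_simps)
  also have "\<dots> \<le> memory \<beta> A (Suc n) * ?P (Suc n)"
    by (rule mult_left_mono[OF perturbed_incr memory_nonneg])
  finally show ?case .
qed

lemma inverse_perturbed_ge: "(\<Prod>i<n. 1 / (1 + \<beta> / (\<beta> - 1) * A i)) \<le> 1 / perturbed \<beta> A n"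
proof -
  have "perturbed \<beta> A n \<le> (\<Prod>i<n. 1 + \<beta> / (\<beta> - 1) * A i)"
    using potential_ge potential_le_prod order_trans by blast
  then have "1 / (\<Prod>i<n. 1 + \<beta> / (\<beta> - 1) * A i) \<le> 1 / perturbed \<beta> A n"
    using perturbed_ge1[of n] by (intro divide_left_mono) auto
  then show ?thesis by (simp add: prod_dividef)
qed

text \<open>With \<open>r\<close> the ratio of \<open>perturbed\<close> to \<open>potential\<close>,
  the latter grows by exactly the factor \<open>1 + r * \<kappa> * A n\<close>, and
  \<open>1 - r\<close> is at most the memory. Replacing \<open>r\<close> by 1 thus costs memory
  times \<open>satur\<close> in each step. These costs merely add up, because all later factors are
  at most one; the last summand pays for the return from \<open>potential\<close> to
  \<open>perturbed\<close>.\<close>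

lemma inverse_perturbed_le:
  "1 / perturbed \<beta> A n \<le> (\<Prod>i<n. 1 / (1 + \<beta> / (\<beta> - 1) * A i))
     + (\<Sum>i<n. memory \<beta> A i * satur (\<beta> / (\<beta> - 1)) (A i)) + memory \<beta> A n"
proof -
  define \<kappa> where "\<kappa> = \<beta> / (\<beta> - 1)"
  have \<kappa>: "0 < \<kappa>" using \<beta> by (simp add: \<kappa>_def)
  let ?P = "perturbed \<beta> A" and ?S = potential
  have S1: "1 \<le> ?S n" for n using perturbed_ge1 potential_ge order_trans by blast
  have step: "1 / ?S (Suc n) \<le> 1 / ?S n * (1 / (1 + \<kappa> * A n)) + memory \<beta> A n * satur \<kappa> (A n)" for n
  proof -
    define r where "r = ?P n / ?S n"
    have r: "0 < r" "r \<le> 1" unfolding r_def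
      using perturbed_ge1[of n] S1[of n] potential_ge[of n] by (auto simp: divide_le_eq)
    have "1 - r = (?S n - ?P n) / ?S n" unfolding r_def using S1[of n] by (simp add: field_simps)
    also have "\<dots> \<le> memory \<beta> A n * ?P n / ?S n"
      by (intro divide_right_mono potential_gap) (use S1[of n] in simp)
    also have "\<dots> = memory \<beta> A n * r" by (simp add: r_def)
    also have "\<dots> \<le> memory \<beta> A n" using mult_left_mono[OF r(2) memory_nonneg[of n]] by simp
    finally have r3: "1 - r \<le> memory \<beta> A n" .
    define x where "x = \<kappa> * A n"
    have x: "0 \<le> x" using \<kappa> A[of n] by (simp add: x_def)
    have "?S (Suc n) = ?S n * (1 + r * x)"
    proof -
      have "?S n * r = ?P n" using S1[of n] by (simp add: r_def)
      then show ?thesis unfolding potential_Suc x_def \<kappa>_def by (simp add: algebra_simps)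
    qed
    then have e1: "1 / ?S (Suc n) = 1 / ?S n * (1 / (1 + r * x))" by simp
    \<comment> \<open>Since r \<le> 1, the loss of the damped factor is at least r times the loss of
      the undamped one.\<close>
    have e2: "1 / (1 + r * x) \<le> 1 - r * (x / (1 + x))"
    proof -
      have "r * x \<le> x" using mult_right_mono[OF r(2) x] by simp
      then have "r * x / (1 + x) \<le> r * x / (1 + r * x)"
        using r x by (intro divide_left_mono) (auto intro!: mult_pos_pos add_pos_nonneg)
      moreover have "1 / (1 + r * x) = 1 - r * x / (1 + r * x)"
      proof -
        have "0 < 1 + r * x" using r x by (simp add: add_pos_nonneg)
        then show ?thesis by (simp add: field_simps)
      qed
      ultimately show ?thesis by simp
    qed
    have e3: "1 / ?S n * (1 - r * (x / (1 + x))) = 1 / ?S n * (1 / (1 + x)) + 1 / ?S n * ((1 - r) * satur \<kappa> (A n))"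
    proof -
      have "0 < 1 + x" using x by simp
      then have "1 - r * (x / (1 + x)) = 1 / (1 + x) + (1 - r) * (x / (1 + x))"
        by (simp add: field_simps)
      then show ?thesis by (simp add: satur_def x_def ring_distribs)
    qed
    have e4: "1 / ?S n * ((1 - r) * satur \<kappa> (A n)) \<le> 1 * (memory \<beta> A n * satur \<kappa> (A n))"
      using S1[of n] r r3 satur_bounds[of \<kappa> "A n"] \<kappa> A[of n]
      by (intro mult_mono mult_right_mono) (auto simp: divide_le_eq intro!: mult_nonneg_nonneg)
    have "1 / ?S n * (1 / (1 + r * x)) \<le> 1 / ?S n * (1 - r * (x / (1 + x)))"
      using e2 S1[of n] by (intro mult_left_mono) auto
    then show ?thesis using e1 e3 e4 unfolding x_def by linarith
  qed
  have S: "1 / ?S n \<le> (\<Prod>i<n. 1 / (1 + \<kappa> * A i)) + (\<Sum>i<n. memory \<beta> A i * satur \<kappa> (A i))" for n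
  proof (induction n)
    case 0
    then show ?case by (simp add: potential_def)
  next
    case (Suc n)
    let ?Q = "\<Prod>i<n. 1 / (1 + \<kappa> * A i)" and ?R = "\<Sum>i<n. memory \<beta> A i * satur \<kappa> (A i)"
    have k: "0 \<le> \<kappa> * A n" using \<kappa> A[of n] by simp
    then have f: "0 \<le> 1 / (1 + \<kappa> * A n)" "1 / (1 + \<kappa> * A n) \<le> 1" by auto
    have R: "0 \<le> ?R"
      using \<kappa> A by (intro sum_nonneg mult_nonneg_nonneg memory_nonneg satur_bounds) auto
    have "1 / ?S (Suc n) \<le> (?Q + ?R) * (1 / (1 + \<kappa> * A n)) + memory \<beta> A n * satur \<kappa> (A n)"
      using step[of n] mult_right_mono[OF Suc f(1)] by linarith
    also have "\<dots> \<le> ?Q * (1 / (1 + \<kappa> * A n)) + ?R + memory \<beta> A n * satur \<kappa> (A n)"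
      using mult_left_mono[OF f(2) R] by (simp only: ring_distribs)
    finally show ?case by simp
  qed
  have "1 / ?P n \<le> 1 / ?S n + memory \<beta> A n"
  proof -
    have p: "0 < ?P n" "0 < ?S n" using perturbed_ge1[of n] S1[of n] by linarith+
    have "1 / ?P n - 1 / ?S n = (?S n - ?P n) / ?P n / ?S n" using p by (simp add: field_simps)
    also have "\<dots> \<le> memory \<beta> A n / ?S n"
      using potential_gap[of n] p by (intro divide_right_mono) (auto simp: divide_le_eq)
    also have "\<dots> \<le> memory \<beta> A n"
      using divide_left_mono[OF S1[of n] memory_nonneg[of n]] p by simp
    finally show ?thesis by simp
  qed
  then show ?thesis using S[of n] by (simp add: \<kappa>_def)
qed

end

lemma memory_mono:
  assumes "1 < \<beta>" "\<And>n. A n \<le> A' n"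
  shows "memory \<beta> A n \<le> memory \<beta> A' n"
  by (induction n) (use assms in \<open>auto intro!: add_mono divide_right_mono\<close>)

text \<open>This form is linear in each past weight, so that expectations can later be taken term by
  term.\<close>

lemma memory_eq_sum: "memory \<beta> A n = (\<Sum>j<n. A j * (1 / \<beta>) ^ (n - 1 - j)) / (\<beta> - 1)"
proof (induction n)
  case (Suc n)
  have "(\<Sum>j<n. A j * (1 / \<beta>) ^ (n - 1 - j)) / \<beta> = (\<Sum>j<n. A j * (1 / \<beta>) ^ (n - j))"
    unfolding sum_divide_distrib
  proof (rule sum.cong[OF refl])
    fix j assume "j \<in> {..<n}"
    then have "n - j = Suc (n - 1 - j)" by auto
    then show "A j * (1 / \<beta>) ^ (n - 1 - j) / \<beta> = A j * (1 / \<beta>) ^ (n - j)" by simp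
  qed
  then have "memory \<beta> A n / \<beta> = (\<Sum>j<n. A j * (1 / \<beta>) ^ (n - j)) / (\<beta> - 1)"
    unfolding Suc by (metis divide_divide_eq_left mult.commute)
  then show ?case by (simp add: add_divide_distrib)
qed simp

lemma prod_inverse_le_exp:
  fixes a :: real
  assumes "0 \<le> a" "a < 1"
  shows "exp (- (real n * a / (1 - a))) \<le> (1 - a) ^ n" "(1 - a) ^ n \<le> exp (- (real n * a))"
proof -
  have 1: "1 - a \<le> exp (- a)" using exp_ge_add_one_self[of "- a"] by simp
  then have "(1 - a) ^ n \<le> exp (- a) ^ n" using assms by (intro power_mono) auto
  then show "(1 - a) ^ n \<le> exp (- (real n * a))" by (simp add: exp_of_nat_mult[symmetric])
  have "1 / (1 - a) \<le> exp (a / (1 - a))"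
    using exp_ge_add_one_self[of "a / (1 - a)"] assms by (simp add: field_simps)
  then have "exp (- (a / (1 - a))) \<le> 1 - a" using assms
    by (simp add: exp_minus field_simps)
  then have "exp (- (a / (1 - a))) ^ n \<le> (1 - a) ^ n" by (intro power_mono) auto
  then show "exp (- (real n * a / (1 - a))) \<le> (1 - a) ^ n" by (simp add: exp_of_nat_mult[symmetric])
qed

lemma tendsto_power_exp:
  fixes a :: "nat \<Rightarrow> real" and n :: "nat \<Rightarrow> nat"
  assumes a: "\<And>k. 0 \<le> a k" "a \<longlonglongrightarrow> 0" and na: "(\<lambda>k. real (n k) * a k) \<longlonglongrightarrow> x"
  shows "(\<lambda>k. (1 - a k) ^ n k) \<longlonglongrightarrow> exp (- x)"
proof (rule tendsto_sandwich)
  have ev: "\<forall>\<^sub>F k in sequentially. a k < 1" using order_tendstoD(2)[OF a(2), of 1] by simp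
  show "\<forall>\<^sub>F k in sequentially. exp (- (real (n k) * a k / (1 - a k))) \<le> (1 - a k) ^ n k"
    using ev by eventually_elim (simp add: prod_inverse_le_exp a)
  show "\<forall>\<^sub>F k in sequentially. (1 - a k) ^ n k \<le> exp (- (real (n k) * a k))"
    using ev by eventually_elim (simp add: prod_inverse_le_exp a)
  show "(\<lambda>k. exp (- (real (n k) * a k))) \<longlonglongrightarrow> exp (- x)"
    by (intro tendsto_intros na)
  have "(\<lambda>k. exp (- (real (n k) * a k / (1 - a k)))) \<longlonglongrightarrow> exp (- (x / (1 - 0)))"
    by (intro tendsto_intros na a) simp
  then show "(\<lambda>k. exp (- (real (n k) * a k / (1 - a k)))) \<longlonglongrightarrow> exp (- x)" by simp
qed

subsection \<open>Independent families indexed by an arbitrary type\<close>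

abbreviation iid :: "'a pmf \<Rightarrow> ('i \<Rightarrow> 'a) measure" where
  "iid p \<equiv> PiM UNIV (\<lambda>_. measure_pmf p)"

text \<open>Independence of blocks is phrased through functions on the full product space that
  ignore the other coordinates. The block \<open>J\<close> may be infinite; the blocks of interest
  are whole subtrees.\<close>

definition depends_on :: "(('i \<Rightarrow> 'a) \<Rightarrow> 'b) \<Rightarrow> 'i set \<Rightarrow> bool" where
  "depends_on f J \<longleftrightarrow> (\<forall>s s'. (\<forall>i\<in>J. s i = s' i) \<longrightarrow> f s = f s')"

lemma depends_onD: "depends_on f J \<Longrightarrow> (\<And>i. i \<in> J \<Longrightarrow> s i = s' i) \<Longrightarrow> f s = f s'"
  unfolding depends_on_def by blast

lemma depends_on_mono: "depends_on f J \<Longrightarrow> J \<subseteq> K \<Longrightarrow> depends_on f K"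
  unfolding depends_on_def by blast

lemma space_iid[simp]: "space (iid p) = UNIV"
  by (simp add: space_PiM)

lemma prob_space_iid: "prob_space (iid p)"
  by (intro prob_space_PiM prob_space_measure_pmf)

lemma measurable_iid_coordinate[measurable]: "(\<lambda>s. s i) \<in> iid p \<rightarrow>\<^sub>M count_space UNIV"
  by (rule measurable_compose[OF measurable_component_singleton[of i UNIV "\<lambda>_. measure_pmf p"]]) auto

lemma measurable_iidI:
  assumes "\<And>i. (\<lambda>x. f x i) \<in> N \<rightarrow>\<^sub>M count_space UNIV"
  shows "f \<in> N \<rightarrow>\<^sub>M iid p"
  by (rule measurable_PiM_single') (use assms in auto)

lemma distr_iid_component: "distr (iid p) (count_space UNIV) (\<lambda>s. s i) = measure_pmf p"
proof -
  have "distr (iid p) (count_space UNIV) (\<lambda>s. s i) = distr (iid p) (measure_pmf p) (\<lambda>s. s i)"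
    by (rule distr_cong) auto
  also have "\<dots> = measure_pmf p"
    by (rule distr_PiM_component) (auto intro: prob_space_measure_pmf)
  finally show ?thesis .
qed

lemma distr_iid_reindex:
  assumes "inj r"
  shows "distr (iid p) (iid p) (\<lambda>s i. s (r i)) = iid p"
  using distr_PiM_reindex[of UNIV "\<lambda>_. measure_pmf p" r UNIV] assms
  by (simp add: prob_space_measure_pmf restrict_UNIV)

definition merge_on :: "'i set \<Rightarrow> ('i \<Rightarrow> 'a) \<times> ('i \<Rightarrow> 'a) \<Rightarrow> 'i \<Rightarrow> 'a" where
  "merge_on J z = (\<lambda>i. if i \<in> J then fst z i else snd z i)"

lemma measurable_merge_on[measurable]: "merge_on J \<in> iid p \<Otimes>\<^sub>M iid p \<rightarrow>\<^sub>M iid p"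
proof (rule measurable_iidI)
  show "(\<lambda>z. merge_on J z i) \<in> iid p \<Otimes>\<^sub>M iid p \<rightarrow>\<^sub>M count_space UNIV" for i
    by (cases "i \<in> J") (simp_all add: merge_on_def)
qed

lemma depends_on_merge_on:
  "depends_on f J \<Longrightarrow> f (merge_on J z) = f (fst z)"
  "depends_on f (- J) \<Longrightarrow> f (merge_on J z) = f (snd z)"
  by (erule depends_onD; simp add: merge_on_def)+

text \<open>A cylinder event splits into a part on \<open>J\<close> and a part off \<open>J\<close>,
  so taking the coordinates off \<open>J\<close> from an independent copy leaves the law unchanged.
  All factorisations rest on this: after merging, a function of \<open>J\<close> sees only the first
  sample and a function of the complement only the second.\<close>

lemma distr_iid_merge:
  fixes p :: "'a pmf" and J :: "'i set"
  shows "distr (iid p \<Otimes>\<^sub>M iid p) (iid p) (merge_on J) = iid p"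
proof -
  interpret product_prob_space "\<lambda>_::'i. measure_pmf p" UNIV
    by (simp add: product_prob_space_def product_prob_space_axioms_def product_sigma_finite_def
        prob_space_measure_pmf prob_space_imp_sigma_finite)
  show ?thesis
  proof (rule PiM_eq)
    show "sets (distr (iid p \<Otimes>\<^sub>M iid p) (iid p) (merge_on J)) = sets (iid p)" by simp
    fix K :: "'i set" and F :: "'i \<Rightarrow> 'a set" assume K: "finite K"
    define E where "E L = prod_emb UNIV (\<lambda>_::'i. measure_pmf p) L (Pi\<^sub>E L F)" for L
    have E: "E L = {s. \<forall>i\<in>L. s i \<in> F i}" for L
      unfolding E_def prod_emb_def by (auto simp: PiE_def Pi_def)
    have em: "emeasure (iid p) (E L) = (\<Prod>i\<in>L. emeasure (measure_pmf p) (F i))" if "finite L" for L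
      unfolding E_def by (rule emeasure_PiM_emb) (use that in auto)
    have Em: "E L \<in> sets (iid p)" if "finite L" for L
      unfolding E_def by (rule sets_PiM_I) (use that in auto)
    have "emeasure (distr (iid p \<Otimes>\<^sub>M iid p) (iid p) (merge_on J)) (E K)
        = emeasure (iid p \<Otimes>\<^sub>M iid p) (merge_on J -` E K \<inter> space (iid p \<Otimes>\<^sub>M iid p))"
      by (rule emeasure_distr[OF measurable_merge_on]) (use Em K in auto)
    also have "merge_on J -` E K \<inter> space (iid p \<Otimes>\<^sub>M iid p) = E (K \<inter> J) \<times> E (K - J)"
      by (auto simp: E space_pair_measure merge_on_def split: if_splits)
    also have "emeasure (iid p \<Otimes>\<^sub>M iid p) \<dots> = emeasure (iid p) (E (K \<inter> J)) * emeasure (iid p) (E (K - J))"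
      by (rule P.emeasure_pair_measure_Times) (use Em K in auto)
    also have "\<dots> = (\<Prod>i\<in>K \<inter> J. emeasure (measure_pmf p) (F i)) * (\<Prod>i\<in>K - J. emeasure (measure_pmf p) (F i))"
      using K by (simp add: em)
    also have "\<dots> = (\<Prod>i\<in>K. emeasure (measure_pmf p) (F i))"
      using K by (subst prod.union_disjoint[symmetric]) (auto intro!: prod.cong)
    finally show "emeasure (distr (iid p \<Otimes>\<^sub>M iid p) (iid p) (merge_on J))
        (prod_emb UNIV (\<lambda>_. measure_pmf p) K (Pi\<^sub>E K F)) = (\<Prod>i\<in>K. emeasure (measure_pmf p) (F i))"
      by (simp add: E_def)
  qed
qed

lemma nn_integral_iid_block2:
  assumes f: "f \<in> borel_measurable (iid p)" "depends_on f J"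
    and g: "g \<in> borel_measurable (iid p)" "depends_on g (- J)"
  shows "(\<integral>\<^sup>+s. f s * g s \<partial>iid p) = (\<integral>\<^sup>+s. f s \<partial>iid p) * (\<integral>\<^sup>+s. g s \<partial>iid p)"
proof -
  interpret P: prob_space "iid p" by (rule prob_space_iid)
  note [measurable] = f(1) g(1)
  have "(\<integral>\<^sup>+s. f s * g s \<partial>iid p) = (\<integral>\<^sup>+s. f s * g s \<partial>distr (iid p \<Otimes>\<^sub>M iid p) (iid p) (merge_on J))"
    by (simp only: distr_iid_merge)
  also have "\<dots> = (\<integral>\<^sup>+z. f (fst z) * g (snd z) \<partial>(iid p \<Otimes>\<^sub>M iid p))"
    by (subst nn_integral_distr) (auto simp: depends_on_merge_on f g)
  also have "\<dots> = (\<integral>\<^sup>+s. \<integral>\<^sup>+s'. f s * g s' \<partial>iid p \<partial>iid p)"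
    by (subst P.nn_integral_fst[symmetric]) auto
  also have "\<dots> = (\<integral>\<^sup>+s. f s \<partial>iid p) * (\<integral>\<^sup>+s. g s \<partial>iid p)"
    by (simp add: nn_integral_cmult nn_integral_multc)
  finally show ?thesis .
qed

lemma depends_on_prod:
  fixes f :: "'l \<Rightarrow> ('i \<Rightarrow> 'a) \<Rightarrow> 'b::comm_monoid_mult"
  assumes "\<And>l. l \<in> I \<Longrightarrow> depends_on (f l) (J l)"
  shows "depends_on (\<lambda>s. \<Prod>l\<in>I. f l s) (\<Union>l\<in>I. J l)"
  unfolding depends_on_def
proof (intro allI impI prod.cong refl)
  fix s s' :: "'i \<Rightarrow> 'a" and l assume "\<forall>i\<in>\<Union>l\<in>I. J l. s i = s' i" "l \<in> I"
  then show "f l s = f l s'" by (intro depends_onD[OF assms]) auto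
qed

lemma nn_integral_iid_block:
  assumes "finite I" "\<And>l. l \<in> I \<Longrightarrow> f l \<in> borel_measurable (iid p)"
    "\<And>l. l \<in> I \<Longrightarrow> depends_on (f l) (J l)" "disjoint_family_on J I"
  shows "(\<integral>\<^sup>+s. (\<Prod>l\<in>I. f l s) \<partial>iid p) = (\<Prod>l\<in>I. \<integral>\<^sup>+s. f l s \<partial>iid p)"
  using assms
proof (induction I rule: finite_induct)
  case empty
  interpret P: prob_space "iid p" by (rule prob_space_iid)
  show ?case using P.emeasure_space_1 by simp
next
  case (insert l I)
  have "depends_on (\<lambda>s. \<Prod>l\<in>I. f l s) (- J l)"
  proof (rule depends_on_mono)
    show "depends_on (\<lambda>s. \<Prod>l\<in>I. f l s) (\<Union>l\<in>I. J l)"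
      by (rule depends_on_prod) (simp add: insert.prems)
    show "(\<Union>l\<in>I. J l) \<subseteq> - J l"
    proof
      fix x assume "x \<in> (\<Union>l\<in>I. J l)"
      then obtain m where "m \<in> I" "x \<in> J m" by blast
      then show "x \<in> - J l"
        using disjoint_family_onD[OF insert.prems(3), of m l] insert.hyps(2) by fastforce
    qed
  qed
  then have "(\<integral>\<^sup>+s. f l s * (\<Prod>l\<in>I. f l s) \<partial>iid p)
      = (\<integral>\<^sup>+s. f l s \<partial>iid p) * (\<integral>\<^sup>+s. (\<Prod>l\<in>I. f l s) \<partial>iid p)"
    by (intro nn_integral_iid_block2[where J="J l"] borel_measurable_prod_ennreal insert.prems) auto
  moreover have "(\<integral>\<^sup>+s. (\<Prod>l\<in>I. f l s) \<partial>iid p) = (\<Prod>l\<in>I. \<integral>\<^sup>+s. f l s \<partial>iid p)"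
  proof (rule insert.IH)
    show "disjoint_family_on J I"
      by (rule disjoint_family_on_mono[OF _ insert.prems(3)]) blast
  qed (simp_all add: insert.prems)
  ultimately show ?case using insert.hyps by simp
qed

lemma integral_iid_block2:
  fixes f g :: "('i \<Rightarrow> 'a) \<Rightarrow> real"
  assumes f: "f \<in> borel_measurable (iid p)" "depends_on f J" "\<And>s. \<bar>f s\<bar> \<le> B"
    and g: "g \<in> borel_measurable (iid p)" "depends_on g (- J)" "\<And>s. \<bar>g s\<bar> \<le> C"
  shows "(\<integral>s. f s * g s \<partial>iid p) = (\<integral>s. f s \<partial>iid p) * (\<integral>s. g s \<partial>iid p)"
proof -
  interpret P: prob_space "iid p :: ('i \<Rightarrow> 'a) measure" by (rule prob_space_iid)
  interpret PP: pair_prob_space "iid p :: ('i \<Rightarrow> 'a) measure" "iid p :: ('i \<Rightarrow> 'a) measure" ..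
  note [measurable] = f(1) g(1)
  have int: "integrable (iid p \<Otimes>\<^sub>M iid p) (\<lambda>(s, s'). f s * g s')"
  proof (rule PP.integrable_const_bound[where B="B * C"])
    show "AE z in iid p \<Otimes>\<^sub>M iid p. norm (case z of (s, s') \<Rightarrow> f s * g s') \<le> B * C"
      using f(3) g(3) by (intro AE_I2) (auto simp: split_beta abs_mult intro!: mult_mono order_trans[OF abs_ge_zero f(3)])
  qed measurable
  have "(\<integral>s. f s * g s \<partial>iid p) = (\<integral>s. f s * g s \<partial>distr (iid p \<Otimes>\<^sub>M iid p) (iid p) (merge_on J))"
    by (simp only: distr_iid_merge)
  also have "\<dots> = (\<integral>z. (case z of (s, s') \<Rightarrow> f s * g s') \<partial>(iid p \<Otimes>\<^sub>M iid p))"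
    by (subst integral_distr) (simp_all add: depends_on_merge_on f g case_prod_beta')
  also have "\<dots> = (\<integral>s. \<integral>s'. f s * g s' \<partial>iid p \<partial>iid p)"
    using PP.integral_fst'[OF int] by simp
  also have "\<dots> = (\<integral>s. f s \<partial>iid p) * (\<integral>s. g s \<partial>iid p)"
    by simp
  finally show ?thesis .
qed

text \<open>The number of children of \<open>v\<close> decides which subtrees enter the integrand,
  so independence applies only after this number is frozen at a value \<open>d\<close>. Countably
  many values keep the composite function measurable.\<close>

lemma integral_iid_freeze:
  fixes f :: "'a::countable \<Rightarrow> ('i \<Rightarrow> 'a) \<Rightarrow> real"
  assumes f: "\<And>d. f d \<in> borel_measurable (iid p)" "\<And>d. depends_on (f d) (- {v})" "\<And>d s. \<bar>f d s\<bar> \<le> B"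
  shows "(\<integral>s. f (s v) s \<partial>iid p) = (\<integral>d. (\<integral>s. f d s \<partial>iid p) \<partial>measure_pmf p)"
proof -
  interpret P: prob_space "iid p :: ('i \<Rightarrow> 'a) measure" by (rule prob_space_iid)
  interpret PP: pair_prob_space "iid p :: ('i \<Rightarrow> 'a) measure" "iid p :: ('i \<Rightarrow> 'a) measure" ..
  note [measurable] = f(1)
  have m1[measurable]: "(\<lambda>s. f (s v) s) \<in> borel_measurable (iid p)"
    by (rule measurable_compose_countable[where f=f and g="\<lambda>s. s v"]) measurable
  have m2[measurable]: "(\<lambda>z. f (fst z v) (snd z)) \<in> borel_measurable (iid p \<Otimes>\<^sub>M iid p)"
    by (rule measurable_compose_countable[where f="\<lambda>d z. f d (snd z)" and g="\<lambda>z. fst z v"]) measurable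
  have ff: "f (merge_on {v} z v) (merge_on {v} z) = f (fst z v) (snd z)" for z
    using depends_on_merge_on(2)[OF f(2)] by (simp add: merge_on_def)
  have int: "integrable (iid p \<Otimes>\<^sub>M iid p) (\<lambda>(s, s'). f (s v) s')"
    by (rule PP.integrable_const_bound[where B=B]) (use f(3) in \<open>auto simp: split_beta\<close>)
  have "(\<integral>s. f (s v) s \<partial>iid p) = (\<integral>s. f (s v) s \<partial>distr (iid p \<Otimes>\<^sub>M iid p) (iid p) (merge_on {v}))"
    by (simp only: distr_iid_merge)
  also have "\<dots> = (\<integral>z. (case z of (s, s') \<Rightarrow> f (s v) s') \<partial>(iid p \<Otimes>\<^sub>M iid p))"
    by (subst integral_distr) (simp_all add: ff case_prod_beta')
  also have "\<dots> = (\<integral>s. (\<integral>s'. f (s v) s' \<partial>iid p) \<partial>iid p)"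
    using PP.integral_fst'[OF int] by simp
  also have "\<dots> = (\<integral>d. (\<integral>s'. f d s' \<partial>iid p) \<partial>distr (iid p) (count_space UNIV) (\<lambda>s. s v))"
    by (subst integral_distr) auto
  finally show ?thesis by (simp only: distr_iid_component)
qed

lemma integral_iid_reindex:
  fixes f :: "('i \<Rightarrow> 'a) \<Rightarrow> real"
  assumes "inj r" "f \<in> borel_measurable (iid p)"
  shows "(\<integral>s. f (\<lambda>i. s (r i)) \<partial>iid p) = (\<integral>s. f s \<partial>iid p)"
proof -
  have "(\<integral>s. f s \<partial>iid p) = (\<integral>s. f s \<partial>distr (iid p) (iid p) (\<lambda>s i. s (r i)))"
    using assms(1) by (simp only: distr_iid_reindex)
  also have "\<dots> = (\<integral>s. f (\<lambda>i. s (r i)) \<partial>iid p)"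
    by (rule integral_distr) (auto intro!: measurable_iidI assms)
  finally show ?thesis by simp
qed

lemma nn_integral_iid_reindex:
  assumes "inj r" "f \<in> borel_measurable (iid p)"
  shows "(\<integral>\<^sup>+s. f (\<lambda>i. s (r i)) \<partial>iid p) = (\<integral>\<^sup>+s. f s \<partial>iid p)"
proof -
  have "(\<integral>\<^sup>+s. f s \<partial>iid p) = (\<integral>\<^sup>+s. f s \<partial>distr (iid p) (iid p) (\<lambda>s i. s (r i)))"
    using assms(1) by (simp only: distr_iid_reindex)
  also have "\<dots> = (\<integral>\<^sup>+s. f (\<lambda>i. s (r i)) \<partial>iid p)"
    by (rule nn_integral_distr) (auto intro!: measurable_iidI assms)
  finally show ?thesis by simp
qed

subsection \<open>Fractional-linear test functions\<close>

text \<open>Moebius maps that fix 0, with slope \<open>a\<close> at 0 and ceiling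
  \<open>a / c\<close>. Precomposition with a scaling or with \<open>satur 1\<close> stays within
  the family, which is why expectations of such functions satisfy a closed recursion over
  generations.\<close>

definition lft :: "real \<Rightarrow> real \<Rightarrow> real \<Rightarrow> real" where
  "lft a c x = a * x / (1 + c * x)"

lemma satur_eq_lft: "satur c = lft c c"
  by (simp add: fun_eq_iff satur_def lft_def)

lemma lft_0[simp]: "lft a c 0 = 0"
  by (simp add: lft_def)

lemma borel_measurable_lft[measurable]: "lft a c \<in> borel_measurable borel"
  unfolding lft_def[abs_def] by measurable

lemma borel_measurable_satur[measurable]: "satur c \<in> borel_measurable borel"
  unfolding satur_def[abs_def] by measurable

lemma lft_scale: "lft a c (b * x) = lft (a * b) (c * b) x"
  by (simp add: lft_def mult.assoc)

lemma lft_satur: "0 \<le> w \<Longrightarrow> lft a c (satur 1 w) = lft a (1 + c) w"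
  if "0 \<le> c"
proof -
  assume w: "0 \<le> w"
  have "1 + w + c * w \<noteq> 0" "1 + w \<noteq> 0"
    using w that by (smt (verit) mult_nonneg_nonneg)+
  then show ?thesis by (simp add: lft_def satur_def divide_simps) (simp add: algebra_simps)
qed

context
  fixes a c :: real
  assumes a: "0 < a" and c: "0 < c"
begin

lemma lft_nonneg: "0 \<le> x \<Longrightarrow> 0 \<le> lft a c x"
  using a c by (simp add: lft_def)

lemma lft_le: "0 \<le> x \<Longrightarrow> lft a c x \<le> a / c"
proof -
  assume "0 \<le> x"
  then have "0 < 1 + c * x" using c by (simp add: add_pos_nonneg)
  then show ?thesis using a c by (simp add: lft_def field_simps)
qed

lemma lft_le_lin: "0 \<le> x \<Longrightarrow> lft a c x \<le> a * x"
proof -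
  assume "0 \<le> x"
  then have "1 \<le> 1 + c * x" "0 \<le> a * x" using a c by simp_all
  then show ?thesis unfolding lft_def by (simp add: divide_le_eq mult_le_cancel_left1)
qed

lemma lft_mono: "0 \<le> x \<Longrightarrow> x \<le> y \<Longrightarrow> lft a c x \<le> lft a c y"
proof -
  assume xy: "0 \<le> x" "x \<le> y"
  then have "0 < 1 + c * x" "0 < 1 + c * y" using c by (simp_all add: add_pos_nonneg)
  then show ?thesis using a xy by (simp add: lft_def field_simps)
qed

lemma lft_add: "0 \<le> x \<Longrightarrow> 0 \<le> y \<Longrightarrow> lft a c (x + y) \<le> lft a c x + lft a c y"
proof -
  assume xy: "0 \<le> x" "0 \<le> y"
  have p: "0 < 1 + c * x" "0 < 1 + c * y" using xy c by (simp_all add: add_pos_nonneg)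
  have "a * x / (1 + c * (x + y)) \<le> a * x / (1 + c * x)" "a * y / (1 + c * (x + y)) \<le> a * y / (1 + c * y)"
    using xy a c p by (auto intro!: divide_left_mono mult_pos_pos simp: distrib_left add_pos_nonneg)
  then show ?thesis by (simp add: lft_def add_divide_distrib distrib_left)
qed

lemma lft_sum_le: "finite I \<Longrightarrow> (\<And>i. i \<in> I \<Longrightarrow> 0 \<le> y i) \<Longrightarrow> lft a c (\<Sum>i\<in>I. y i) \<le> (\<Sum>i\<in>I. lft a c (y i))"
proof (induction I rule: finite_induct)
  case (insert i I)
  have "lft a c (y i + (\<Sum>i\<in>I. y i)) \<le> lft a c (y i) + lft a c (\<Sum>i\<in>I. y i)"
    using insert.prems by (intro lft_add sum_nonneg) auto
  then show ?case using insert by force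
qed simp

text \<open>With \<open>X\<close> the total and \<open>Y\<close> the sum of the other terms, the
  share of term i in \<open>lft a c X\<close> is exactly
  \<open>lft a c (y i) * (1 - c * Y / (1 + c * X))\<close>. The correction is at most 1 and also at
  most a multiple of the sum of the other values. The \<open>min\<close> keeps both bounds, for use
  where the number of summands is only known to have a finite mean.\<close>

lemma lft_sum_ge:
  assumes I: "finite I" and y: "\<And>i. i \<in> I \<Longrightarrow> 0 \<le> y i"
  shows "(\<Sum>i\<in>I. lft a c (y i)) - (\<Sum>i\<in>I. lft a c (y i) * min 1 (c / a * (\<Sum>j\<in>I-{i}. lft a c (y j))))
    \<le> lft a c (\<Sum>i\<in>I. y i)"
proof -
  define X where "X = (\<Sum>i\<in>I. y i)"
  have X: "0 \<le> X" unfolding X_def using y by (rule sum_nonneg)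
  have pX: "0 < 1 + c * X" using c X by (simp add: add_pos_nonneg)
  have "lft a c (y i) - lft a c (y i) * min 1 (c / a * (\<Sum>j\<in>I-{i}. lft a c (y j))) \<le> a * y i / (1 + c * X)"
    if i: "i \<in> I" for i
  proof -
    define Y where "Y = (\<Sum>j\<in>I-{i}. y j)"
    have XY: "X = y i + Y" unfolding X_def Y_def using I i by (simp add: sum.remove)
    have Y: "0 \<le> Y" unfolding Y_def using y by (auto intro: sum_nonneg)
    have pY: "0 < 1 + c * Y" "0 < 1 + c * y i" using c Y y[OF i] by (auto simp: add_pos_nonneg)
    have "c * Y / (1 + c * X) \<le> c * Y / (1 + c * Y)"
    proof (rule divide_left_mono)
      show "1 + c * Y \<le> 1 + c * X" using c y[OF i] by (simp add: XY distrib_left)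
      show "0 \<le> c * Y" using c Y by simp
      show "0 < (1 + c * X) * (1 + c * Y)" using pX pY by (intro mult_pos_pos)
    qed
    also have "\<dots> = c / a * lft a c Y" using a by (simp add: lft_def)
    also have "\<dots> \<le> c / a * (\<Sum>j\<in>I-{i}. lft a c (y j))"
      unfolding Y_def using a c I y by (intro mult_left_mono lft_sum_le) auto
    finally have "c * Y / (1 + c * X) \<le> c / a * (\<Sum>j\<in>I-{i}. lft a c (y j))" .
    moreover have "c * Y / (1 + c * X) \<le> 1"
      using pX c y[OF i] by (simp add: XY distrib_left)
    ultimately have m: "c * Y / (1 + c * X) \<le> min 1 (c / a * (\<Sum>j\<in>I-{i}. lft a c (y j)))" by simp
    have "a * y i / (1 + c * X) = lft a c (y i) * (1 - c * Y / (1 + c * X))"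
    proof -
      have "1 - c * Y / (1 + c * X) = (1 + c * y i) / (1 + c * X)"
        using pX by (simp add: field_simps XY)
      then show ?thesis using pY by (simp add: lft_def)
    qed
    also have "\<dots> \<ge> lft a c (y i) * (1 - min 1 (c / a * (\<Sum>j\<in>I-{i}. lft a c (y j))))"
      using m lft_nonneg[OF y[OF i]] by (intro mult_left_mono) auto
    finally show ?thesis by (simp add: algebra_simps)
  qed
  then have "(\<Sum>i\<in>I. lft a c (y i) - lft a c (y i) * min 1 (c / a * (\<Sum>j\<in>I-{i}. lft a c (y j))))
    \<le> (\<Sum>i\<in>I. a * y i / (1 + c * X))" by (rule sum_mono)
  also have "\<dots> = lft a c X" by (simp add: lft_def X_def sum_distrib_left sum_divide_distrib)
  finally show ?thesis by (simp add: X_def sum_subtractf)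
qed

end

subsection \<open>Escape probabilities of killed excursions into a trap\<close>

text \<open>With \<open>q = 1 / (1 + \<epsilon>)\<close>, the number \<open>1 - trap \<beta> \<epsilon> s v\<close> is the expectation of
  \<open>q ^ T\<close>, where \<open>T\<close> is the time that the walk started at \<open>v\<close> takes to reach the parent of \<open>v\<close>.\<close>

primrec trapn :: "real \<Rightarrow> real \<Rightarrow> nat \<Rightarrow> (nat list \<Rightarrow> nat) \<Rightarrow> nat list \<Rightarrow> real" where
  "trapn \<beta> \<epsilon> 0 = (\<lambda>s v. 0)"
| "trapn \<beta> \<epsilon> (Suc n) = (\<lambda>s v.
     satur 1 (\<epsilon> * (1 + \<beta> * real (s v)) + \<beta> * (\<Sum>j<s v. trapn \<beta> \<epsilon> n s (j # v))))"

text \<open>The truncations treat vertices at the cut as free of killing, hence increase with the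
  depth \<open>n\<close> and stay below 1. The limit therefore exists on every tree, finite or
  not.\<close>

definition trap :: "real \<Rightarrow> real \<Rightarrow> (nat list \<Rightarrow> nat) \<Rightarrow> nat list \<Rightarrow> real" where
  "trap \<beta> \<epsilon> s v = lim (\<lambda>n. trapn \<beta> \<epsilon> n s v)"

definition subtree :: "nat list \<Rightarrow> nat list set" where
  "subtree v = range (\<lambda>w. w @ v)"

lemma subtree_Cons: "subtree (j # v) \<subseteq> subtree v"
proof
  fix x assume "x \<in> subtree (j # v)"
  then obtain w where "x = (w @ [j]) @ v" unfolding subtree_def by auto
  then show "x \<in> subtree v" unfolding subtree_def by blast
qed

lemma subtree_disjoint:
  assumes "length v = length w" "v \<noteq> w"
  shows "subtree v \<inter> subtree w = {}"
  using assms unfolding subtree_def by auto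

lemma measurable_trapn[measurable]: "(\<lambda>s. trapn \<beta> \<epsilon> n s v) \<in> borel_measurable (iid \<xi>)"
proof (induction n arbitrary: v)
  case (Suc n)
  note [measurable] = Suc
  have "(\<lambda>s. satur 1 (\<epsilon> * (1 + \<beta> * real d) + \<beta> * (\<Sum>j<d. trapn \<beta> \<epsilon> n s (j # v)))) \<in> borel_measurable (iid \<xi>)" for d
    by measurable
  then show ?case
    unfolding trapn.simps
    by (rule measurable_compose_countable[where g="\<lambda>s. s v"]) measurable
qed simp

lemma measurable_trap[measurable]: "(\<lambda>s. trap \<beta> \<epsilon> s v) \<in> borel_measurable (iid \<xi>)"
  unfolding trap_def by measurable

lemma trapn_shift: "trapn \<beta> \<epsilon> n s (w @ v) = trapn \<beta> \<epsilon> n (\<lambda>x. s (x @ v)) w"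
proof (induction n arbitrary: w)
  case (Suc n)
  then show ?case using Suc[of "_ # w"] by simp
qed simp

lemma trap_shift: "trap \<beta> \<epsilon> s (w @ v) = trap \<beta> \<epsilon> (\<lambda>x. s (x @ v)) w"
  by (simp add: trap_def trapn_shift)

lemma depends_on_trap: "depends_on (\<lambda>s. trap \<beta> \<epsilon> s v) (subtree v)"
  unfolding depends_on_def
proof (intro allI impI)
  fix s s' :: "nat list \<Rightarrow> nat" assume "\<forall>i\<in>subtree v. s i = s' i"
  then have "(\<lambda>x. s (x @ v)) = (\<lambda>x. s' (x @ v))" by (auto simp: subtree_def)
  then show "trap \<beta> \<epsilon> s v = trap \<beta> \<epsilon> s' v"
    using trap_shift[of \<beta> \<epsilon> s "[]" v] trap_shift[of \<beta> \<epsilon> s' "[]" v] by simp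
qed

lemma inj_append_right: "inj (\<lambda>w. w @ v)"
  by (auto intro: injI)

context
  fixes \<beta> \<epsilon> :: real
  assumes \<beta>: "1 < \<beta>" and \<epsilon>: "0 < \<epsilon>"
begin

lemma trapn_bounds: "0 \<le> trapn \<beta> \<epsilon> n s v" "trapn \<beta> \<epsilon> n s v \<le> 1"
proof -
  have "0 \<le> trapn \<beta> \<epsilon> n s v \<and> trapn \<beta> \<epsilon> n s v \<le> 1"
  proof (induction n arbitrary: v)
    case (Suc n)
    have "0 \<le> \<epsilon> * (1 + \<beta> * real (s v)) + \<beta> * (\<Sum>j<s v. trapn \<beta> \<epsilon> n s (j # v))"
      using \<beta> \<epsilon> Suc by (intro add_nonneg_nonneg mult_nonneg_nonneg sum_nonneg) auto
    then show ?case using satur_bounds[of 1] by simp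
  qed simp
  then show "0 \<le> trapn \<beta> \<epsilon> n s v" "trapn \<beta> \<epsilon> n s v \<le> 1" by auto
qed

lemma trapn_incr: "trapn \<beta> \<epsilon> n s v \<le> trapn \<beta> \<epsilon> (Suc n) s v"
proof (induction n arbitrary: v)
  case 0
  show ?case using trapn_bounds(1)[of "Suc 0"] by simp
next
  case (Suc n)
  have "0 \<le> \<epsilon> * (1 + \<beta> * real (s v)) + \<beta> * (\<Sum>j<s v. trapn \<beta> \<epsilon> n s (j # v))"
    using \<beta> \<epsilon> trapn_bounds by (intro add_nonneg_nonneg mult_nonneg_nonneg sum_nonneg) auto
  then show ?case
    unfolding trapn.simps(2)[of _ _ "Suc n"] trapn.simps(2)[of _ _ n] using \<beta>
    by (intro satur_mono add_left_mono mult_left_mono sum_mono Suc[unfolded trapn.simps(2)[of _ _ n]]) auto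
qed

lemma trapn_LIMSEQ: "(\<lambda>n. trapn \<beta> \<epsilon> n s v) \<longlonglongrightarrow> trap \<beta> \<epsilon> s v"
proof -
  have "Bseq (\<lambda>n. trapn \<beta> \<epsilon> n s v)"
    by (rule BseqI'[where K=1]) (use trapn_bounds in auto)
  moreover have "monoseq (\<lambda>n. trapn \<beta> \<epsilon> n s v)"
    using trapn_incr by (intro mono_SucI1) auto
  ultimately show ?thesis unfolding trap_def
    by (simp add: Bseq_monoseq_convergent convergent_LIMSEQ_iff[symmetric])
qed

lemma trap_bounds: "0 \<le> trap \<beta> \<epsilon> s v" "trap \<beta> \<epsilon> s v \<le> 1"
  using LIMSEQ_le_const[OF trapn_LIMSEQ] LIMSEQ_le_const2[OF trapn_LIMSEQ] trapn_bounds by blast+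

lemma trap_weight_nonneg: "0 \<le> \<epsilon> * (1 + \<beta> * real (s v)) + \<beta> * (\<Sum>j<s v. trap \<beta> \<epsilon> s (j # v))"
  using \<beta> \<epsilon> trap_bounds by (intro add_nonneg_nonneg mult_nonneg_nonneg sum_nonneg) auto

lemma trap_eq:
  "trap \<beta> \<epsilon> s v = satur 1 (\<epsilon> * (1 + \<beta> * real (s v)) + \<beta> * (\<Sum>j<s v. trap \<beta> \<epsilon> s (j # v)))"
proof (rule LIMSEQ_unique)
  show "(\<lambda>n. trapn \<beta> \<epsilon> (Suc n) s v) \<longlonglongrightarrow> trap \<beta> \<epsilon> s v"
    using trapn_LIMSEQ by (rule LIMSEQ_Suc)
  show "(\<lambda>n. trapn \<beta> \<epsilon> (Suc n) s v)
    \<longlonglongrightarrow> satur 1 (\<epsilon> * (1 + \<beta> * real (s v)) + \<beta> * (\<Sum>j<s v. trap \<beta> \<epsilon> s (j # v)))"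
    unfolding trapn.simps satur_def using trap_weight_nonneg[of s v]
    by (intro tendsto_intros trapn_LIMSEQ) auto
qed

lemma trap_pos: "0 < trap \<beta> \<epsilon> s v"
proof -
  have "\<epsilon> \<le> \<epsilon> * (1 + \<beta> * real (s v)) + \<beta> * (\<Sum>j<s v. trap \<beta> \<epsilon> s (j # v))"
    using \<beta> \<epsilon> trap_bounds by (simp add: distrib_left sum_nonneg)
  then show ?thesis
    unfolding trap_eq[of s v] using \<epsilon> by (simp add: satur_def)
qed

text \<open>One induction has to carry both monotonicities: comparing the ratios of
  \<open>w / (1 + w)\<close> and \<open>w' / (1 + w')\<close> uses \<open>w \<le> w'\<close> in the
  denominators besides \<open>\<epsilon> * w' \<le> \<epsilon>' * w\<close>.\<close>

lemma trapn_mono_ratio: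
  assumes "\<epsilon> \<le> \<epsilon>'"
  shows "trapn \<beta> \<epsilon> n s v \<le> trapn \<beta> \<epsilon>' n s v" "\<epsilon> * trapn \<beta> \<epsilon>' n s v \<le> \<epsilon>' * trapn \<beta> \<epsilon> n s v"
proof -
  have "trapn \<beta> \<epsilon> n s v \<le> trapn \<beta> \<epsilon>' n s v \<and> \<epsilon> * trapn \<beta> \<epsilon>' n s v \<le> \<epsilon>' * trapn \<beta> \<epsilon> n s v"
  proof (induction n arbitrary: v)
    case (Suc n)
    define w where "w = \<epsilon> * (1 + \<beta> * real (s v)) + \<beta> * (\<Sum>j<s v. trapn \<beta> \<epsilon> n s (j # v))"
    define w' where "w' = \<epsilon>' * (1 + \<beta> * real (s v)) + \<beta> * (\<Sum>j<s v. trapn \<beta> \<epsilon>' n s (j # v))"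
    have w0: "0 \<le> w" unfolding w_def
      using \<beta> \<epsilon> trapn_bounds by (intro add_nonneg_nonneg mult_nonneg_nonneg sum_nonneg) auto
    have ww: "w \<le> w'" unfolding w_def w'_def using \<beta> assms Suc
      by (intro add_mono mult_left_mono mult_right_mono sum_mono) auto
    have "(\<Sum>j<s v. \<epsilon> * trapn \<beta> \<epsilon>' n s (j # v)) \<le> (\<Sum>j<s v. \<epsilon>' * trapn \<beta> \<epsilon> n s (j # v))"
      using Suc by (intro sum_mono) auto
    then have "\<beta> * (\<epsilon> * (\<Sum>j<s v. trapn \<beta> \<epsilon>' n s (j # v))) \<le> \<beta> * (\<epsilon>' * (\<Sum>j<s v. trapn \<beta> \<epsilon> n s (j # v)))"
      using \<beta> by (intro mult_left_mono) (auto simp: sum_distrib_left)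
    then have r: "\<epsilon> * w' \<le> \<epsilon>' * w" unfolding w_def w'_def by (simp add: algebra_simps)
    have "\<epsilon> * (w' / (1 + w')) \<le> \<epsilon> * w' / (1 + w)"
      using w0 ww \<epsilon> by (simp, intro divide_left_mono) auto
    also have "\<dots> \<le> \<epsilon>' * w / (1 + w)" using r w0 by (intro divide_right_mono) auto
    finally show ?case using satur_mono[OF _ w0 ww, of 1] by (simp add: w_def w'_def satur_def)
  qed simp
  then show "trapn \<beta> \<epsilon> n s v \<le> trapn \<beta> \<epsilon>' n s v" "\<epsilon> * trapn \<beta> \<epsilon>' n s v \<le> \<epsilon>' * trapn \<beta> \<epsilon> n s v" by auto
qed

end

lemma trap_ratio_mono:
  assumes "1 < \<beta>" "0 < \<epsilon>" "\<epsilon> \<le> \<epsilon>'"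
  shows "\<epsilon> / trap \<beta> \<epsilon> s v \<le> \<epsilon>' / trap \<beta> \<epsilon>' s v"
proof -
  have e': "0 < \<epsilon>'" using assms by simp
  have "\<epsilon> * trap \<beta> \<epsilon>' s v \<le> \<epsilon>' * trap \<beta> \<epsilon> s v"
    by (rule LIMSEQ_le[OF tendsto_mult_left[OF trapn_LIMSEQ] tendsto_mult_left[OF trapn_LIMSEQ]])
      (use assms e' trapn_mono_ratio in blast)+
  then show ?thesis
    using trap_pos[OF assms(1,2), of s v] trap_pos[OF assms(1) e', of s v] by (simp add: field_simps)
qed

text \<open>The quotient is taken with the trap value below: \<open>\<epsilon> / trap\<close> is
  monotone in \<epsilon> and bounded below by 0, so its limit is a real infimum for every tree, even
  where the reciprocal is unbounded.\<close>

lemma trap_ratio_convergent: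
  assumes \<beta>: "1 < \<beta>" and e: "\<And>k. 0 < \<epsilon> k" "\<epsilon> \<longlonglongrightarrow> 0"
  shows "(\<lambda>k. \<epsilon> k / trap \<beta> (\<epsilon> k) s v) \<longlonglongrightarrow> (INF x\<in>{0<..}. x / trap \<beta> x s v)"
proof -
  let ?y = "\<lambda>x. x / trap \<beta> x s v"
  have bdd: "bdd_below (?y ` {0<..})"
    using trap_pos[OF \<beta>] by (intro bdd_belowI2[where m=0]) (auto simp: less_imp_le)
  show ?thesis
  proof (rule order_tendstoI)
    fix u assume "u < (INF x\<in>{0<..}. ?y x)"
    moreover have "(INF x\<in>{0<..}. ?y x) \<le> ?y (\<epsilon> k)" for k
      using e(1) by (intro cINF_lower bdd) auto
    ultimately show "\<forall>\<^sub>F k in sequentially. u < ?y (\<epsilon> k)"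
      by (intro always_eventually) (auto intro: less_le_trans)
  next
    fix u assume "(INF x\<in>{0<..}. ?y x) < u"
    then obtain x where x: "0 < x" "?y x < u"
      using cINF_less_iff[OF _ bdd] by (auto simp: ex_in_conv[symmetric])
    have "\<forall>\<^sub>F k in sequentially. \<epsilon> k < x" using e(2) x(1) by (rule order_tendstoD)
    then show "\<forall>\<^sub>F k in sequentially. ?y (\<epsilon> k) < u"
    proof eventually_elim
      case (elim k)
      then have "?y (\<epsilon> k) \<le> ?y x" by (intro trap_ratio_mono \<beta> e) simp
      then show ?case using x(2) by simp
    qed
  qed
qed

subsection \<open>Expectations over independent traps\<close>

definition trap_mean :: "nat pmf \<Rightarrow> real \<Rightarrow> real \<Rightarrow> real \<Rightarrow> real \<Rightarrow> real" where
  "trap_mean \<xi> \<beta> \<epsilon> a c = (\<integral>s. lft a c (trap \<beta> \<epsilon> s []) \<partial>iid \<xi>)"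

lemma integral_trap_shift:
  assumes "f \<in> borel_measurable borel"
  shows "(\<integral>s. f (trap \<beta> \<epsilon> s v) \<partial>iid \<xi>) = (\<integral>s. f (trap \<beta> \<epsilon> s []) \<partial>iid \<xi> :: real)"
proof -
  have "(\<integral>s. f (trap \<beta> \<epsilon> s v) \<partial>iid \<xi>) = (\<integral>s. f (trap \<beta> \<epsilon> (\<lambda>x. s (x @ v)) []) \<partial>iid \<xi>)"
    using trap_shift[of \<beta> \<epsilon> _ "[]" v] by simp
  also have "\<dots> = (\<integral>s. f (trap \<beta> \<epsilon> s []) \<partial>iid \<xi>)"
    by (rule integral_iid_reindex[OF inj_append_right, of "\<lambda>s. f (trap \<beta> \<epsilon> s [])"])
      (rule measurable_compose[OF measurable_trap assms])
  finally show ?thesis .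
qed

context
  fixes \<xi> :: "nat pmf" and \<beta> \<epsilon> a c b x\<^sub>0 :: real and I :: "'l set" and v :: "'l \<Rightarrow> nat list"
  assumes \<beta>: "1 < \<beta>" and \<epsilon>: "0 < \<epsilon>" and a: "0 < a" and c: "0 < c" and b: "0 < b" and x0: "0 \<le> x\<^sub>0"
    and I: "finite I" and disj: "\<And>i j. i \<in> I \<Longrightarrow> j \<in> I \<Longrightarrow> i \<noteq> j \<Longrightarrow> subtree (v i) \<inter> subtree (v j) = {}"
begin

interpretation P: prob_space "iid \<xi> :: (nat list \<Rightarrow> nat) measure" by (rule prob_space_iid)

private abbreviation (input) y where "y s i \<equiv> b * trap \<beta> \<epsilon> s (v i)"

private lemma y_nonneg: "0 \<le> y s i"
  using b trap_bounds[OF \<beta> \<epsilon>] by simp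

private lemma y_integrable: "integrable (iid \<xi>) (\<lambda>s. lft a c (y s i))"
  by (rule P.integrable_const_bound[where B="a / c"])
    (use lft_nonneg[OF a c y_nonneg] lft_le[OF a c y_nonneg] in auto)

private lemma y_mean: "(\<integral>s. lft a c (y s i) \<partial>iid \<xi>) = trap_mean \<xi> \<beta> \<epsilon> (a * b) (c * b)"
  unfolding trap_mean_def lft_scale by (rule integral_trap_shift) measurable

private lemma sum_measurable: "(\<lambda>s. lft a c (x\<^sub>0 + (\<Sum>i\<in>I. y s i))) \<in> borel_measurable (iid \<xi>)"
  by measurable

private lemma sum_integrable: "integrable (iid \<xi>) (\<lambda>s. lft a c (x\<^sub>0 + (\<Sum>i\<in>I. y s i)))"
proof (rule P.integrable_const_bound[where B="a / c"])
  have "0 \<le> x\<^sub>0 + (\<Sum>i\<in>I. y s i)" for s using x0 y_nonneg by (intro add_nonneg_nonneg sum_nonneg) auto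
  then show "AE s in iid \<xi>. norm (lft a c (x\<^sub>0 + (\<Sum>i\<in>I. y s i))) \<le> a / c"
    using lft_nonneg[OF a c] lft_le[OF a c] by auto
qed (rule sum_measurable)

lemma trap_sum_upper:
  "(\<integral>s. lft a c (x\<^sub>0 + (\<Sum>i\<in>I. b * trap \<beta> \<epsilon> s (v i))) \<partial>iid \<xi>)
    \<le> a * x\<^sub>0 + real (card I) * trap_mean \<xi> \<beta> \<epsilon> (a * b) (c * b)"
proof -
  have "(\<integral>s. lft a c (x\<^sub>0 + (\<Sum>i\<in>I. y s i)) \<partial>iid \<xi>) \<le> (\<integral>s. a * x\<^sub>0 + (\<Sum>i\<in>I. lft a c (y s i)) \<partial>iid \<xi>)"
  proof (rule integral_mono[OF sum_integrable])
    show "integrable (iid \<xi>) (\<lambda>s. a * x\<^sub>0 + (\<Sum>i\<in>I. lft a c (y s i)))"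
      by (intro Bochner_Integration.integrable_add Bochner_Integration.integrable_sum y_integrable) simp
    fix s
    have "lft a c (x\<^sub>0 + (\<Sum>i\<in>I. y s i)) \<le> lft a c x\<^sub>0 + lft a c (\<Sum>i\<in>I. y s i)"
      using x0 y_nonneg by (intro lft_add[OF a c] sum_nonneg) auto
    also have "\<dots> \<le> a * x\<^sub>0 + (\<Sum>i\<in>I. lft a c (y s i))"
      using x0 y_nonneg I by (intro add_mono lft_le_lin[OF a c] lft_sum_le[OF a c]) auto
    finally show "lft a c (x\<^sub>0 + (\<Sum>i\<in>I. y s i)) \<le> a * x\<^sub>0 + (\<Sum>i\<in>I. lft a c (y s i))" .
  qed
  also have "\<dots> = a * x\<^sub>0 + (\<Sum>i\<in>I. \<integral>s. lft a c (y s i) \<partial>iid \<xi>)"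
    using P.prob_space by (subst Bochner_Integration.integral_add)
      (auto intro!: Bochner_Integration.integrable_sum y_integrable simp: y_integrable)
  finally show ?thesis by (simp add: y_mean)
qed

private lemma pair_mean:
  assumes "i \<in> I" "j \<in> I" "i \<noteq> j"
  shows "(\<integral>s. lft a c (y s i) * lft a c (y s j) \<partial>iid \<xi>) = trap_mean \<xi> \<beta> \<epsilon> (a * b) (c * b) ^ 2"
proof -
  have d: "depends_on (\<lambda>s. lft a c (y s i)) (subtree (v i))" for i
    using depends_on_trap[of \<beta> \<epsilon> "v i"] unfolding depends_on_def by metis
  have bd: "\<bar>lft a c (y s i)\<bar> \<le> a / c" for s i
    using lft_nonneg[OF a c y_nonneg] lft_le[OF a c y_nonneg] by auto
  have "(\<integral>s. lft a c (y s i) * lft a c (y s j) \<partial>iid \<xi>)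
      = (\<integral>s. lft a c (y s i) \<partial>iid \<xi>) * (\<integral>s. lft a c (y s j) \<partial>iid \<xi>)"
  proof (rule integral_iid_block2[OF _ d bd _ _ bd])
    show "depends_on (\<lambda>s. lft a c (y s j)) (- subtree (v i))"
      by (rule depends_on_mono[OF d]) (use disj[OF assms] in auto)
  qed measurable
  then show ?thesis by (simp add: y_mean power2_eq_square)
qed

text \<open>The deterministic part is dropped by monotonicity. In the correction of
  \<open>lft_sum_ge\<close>, traps on disjoint subtrees are independent, so each pair contributes
  \<open>e\<^sup>2\<close>. The trivial bound and this quadratic bound on the expected correction
  recombine to the \<open>min\<close>.\<close>

lemma trap_sum_lower:
  defines "e \<equiv> trap_mean \<xi> \<beta> \<epsilon> (a * b) (c * b)"
  shows "real (card I) * e - real (card I) * e * min 1 (c / a * real (card I) * e)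
    \<le> (\<integral>s. lft a c (x\<^sub>0 + (\<Sum>i\<in>I. b * trap \<beta> \<epsilon> s (v i))) \<partial>iid \<xi>)"
proof -
  let ?g = "\<lambda>s i. lft a c (y s i)"
  let ?m = "\<lambda>s i. min 1 (c / a * (\<Sum>j\<in>I-{i}. ?g s j))"
  have e0: "0 \<le> e" unfolding e_def y_mean[of undefined, symmetric]
    by (intro Bochner_Integration.integral_nonneg lft_nonneg[OF a c y_nonneg])
  have g0: "0 \<le> ?g s i" for s i by (rule lft_nonneg[OF a c y_nonneg])
  have m0: "0 \<le> ?m s i" for s i using a c g0 by (intro min.boundedI mult_nonneg_nonneg sum_nonneg) auto
  have im: "integrable (iid \<xi>) (\<lambda>s. ?g s i * ?m s i)" for i
  proof (rule P.integrable_const_bound[where B="a / c"])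
    have "?g s i * ?m s i \<le> a / c * 1" for s
      using g0 m0 lft_le[OF a c y_nonneg] a c by (intro mult_mono) auto
    then show "AE s in iid \<xi>. norm (?g s i * ?m s i) \<le> a / c"
      using g0 m0 by (simp add: abs_mult)
  qed measurable
  have ip: "integrable (iid \<xi>) (\<lambda>s. ?g s i * ?g s j)" for i j
  proof (rule P.integrable_const_bound[where B="a / c * (a / c)"])
    have "?g s i * ?g s j \<le> a / c * (a / c)" for s
      using g0 lft_le[OF a c y_nonneg] a c by (intro mult_mono) auto
    then show "AE s in iid \<xi>. norm (?g s i * ?g s j) \<le> a / c * (a / c)"
      using g0 by (simp add: abs_mult)
  qed measurable
  have b1: "(\<integral>s. ?g s i * ?m s i \<partial>iid \<xi>) \<le> e" for i
  proof -
    have "(\<integral>s. ?g s i * ?m s i \<partial>iid \<xi>) \<le> (\<integral>s. ?g s i \<partial>iid \<xi>)"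
      using g0 by (intro integral_mono im y_integrable) (auto intro: mult_left_le)
    then show ?thesis by (simp add: y_mean e_def)
  qed
  have b2: "(\<integral>s. ?g s i * ?m s i \<partial>iid \<xi>) \<le> e * (c / a * real (card I) * e)" if i: "i \<in> I" for i
  proof -
    have "(\<integral>s. ?g s i * ?m s i \<partial>iid \<xi>) \<le> (\<integral>s. c / a * (\<Sum>j\<in>I-{i}. ?g s i * ?g s j) \<partial>iid \<xi>)"
    proof (rule integral_mono[OF im])
      show "integrable (iid \<xi>) (\<lambda>s. c / a * (\<Sum>j\<in>I-{i}. ?g s i * ?g s j))"
        by (intro integrable_mult_right Bochner_Integration.integrable_sum ip)
      fix s
      have "?g s i * ?m s i \<le> ?g s i * (c / a * (\<Sum>j\<in>I-{i}. ?g s j))"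
        by (intro mult_left_mono g0) simp
      then show "?g s i * ?m s i \<le> c / a * (\<Sum>j\<in>I-{i}. ?g s i * ?g s j)"
        by (simp add: sum_distrib_left mult_ac)
    qed
    also have "\<dots> = c / a * (\<Sum>j\<in>I-{i}. \<integral>s. ?g s i * ?g s j \<partial>iid \<xi>)"
      by (simp add: ip)
    also have "\<dots> = c / a * (\<Sum>j\<in>I-{i}. e\<^sup>2)"
      using pair_mean i by (intro arg_cong[of _ _ "(*) (c / a)"] sum.cong) (auto simp: e_def)
    also have "\<dots> \<le> c / a * (real (card I) * e\<^sup>2)"
      using a c e0 I by (intro mult_left_mono) (auto intro!: mult_right_mono intro: card_mono)
    finally show ?thesis by (simp add: power2_eq_square mult_ac)
  qed
  have "real (card I) * e - real (card I) * e * min 1 (c / a * real (card I) * e)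
      = (\<Sum>i\<in>I. e) - (\<Sum>i\<in>I. e * min 1 (c / a * real (card I) * e))" by simp
  also have "\<dots> \<le> (\<Sum>i\<in>I. \<integral>s. ?g s i \<partial>iid \<xi>) - (\<Sum>i\<in>I. \<integral>s. ?g s i * ?m s i \<partial>iid \<xi>)"
    using b1 b2 by (intro diff_mono sum_mono) (auto simp: y_mean e_def[symmetric] min_def)
  also have "\<dots> = (\<integral>s. (\<Sum>i\<in>I. ?g s i) \<partial>iid \<xi>) - (\<integral>s. (\<Sum>i\<in>I. ?g s i * ?m s i) \<partial>iid \<xi>)"
    by (simp only: Bochner_Integration.integral_sum y_integrable im)
  also have "\<dots> = (\<integral>s. (\<Sum>i\<in>I. ?g s i) - (\<Sum>i\<in>I. ?g s i * ?m s i) \<partial>iid \<xi>)"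
    by (rule Bochner_Integration.integral_diff[symmetric])
      (intro Bochner_Integration.integrable_sum y_integrable im)+
  also have "\<dots> \<le> (\<integral>s. lft a c (x\<^sub>0 + (\<Sum>i\<in>I. y s i)) \<partial>iid \<xi>)"
  proof (rule integral_mono[OF _ sum_integrable])
    show "integrable (iid \<xi>) (\<lambda>s. (\<Sum>i\<in>I. ?g s i) - (\<Sum>i\<in>I. ?g s i * ?m s i))"
      by (intro Bochner_Integration.integrable_diff Bochner_Integration.integrable_sum y_integrable im)
    fix s
    have "(\<Sum>i\<in>I. ?g s i) - (\<Sum>i\<in>I. ?g s i * ?m s i) \<le> lft a c (\<Sum>i\<in>I. y s i)"
      using y_nonneg I by (intro lft_sum_ge[OF a c]) auto
    also have "\<dots> \<le> lft a c (x\<^sub>0 + (\<Sum>i\<in>I. y s i))"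
      using x0 y_nonneg by (intro lft_mono[OF a c] sum_nonneg) auto
    finally show "(\<Sum>i\<in>I. ?g s i) - (\<Sum>i\<in>I. ?g s i * ?m s i) \<le> lft a c (x\<^sub>0 + (\<Sum>i\<in>I. y s i))" .
  qed
  finally show ?thesis .
qed

end

subsection \<open>Tail asymptotics of a single trap\<close>

text \<open>Uniform closeness makes \<open>x\<close> Cauchy, and the convergence of \<open>b\<close>
  comes out as a by-product. As the limit is named through \<open>b\<close> alone, all sequences
  \<open>x\<close> with the same inner limits share it; this makes \<open>trap_rate\<close> a
  function of \<sigma> only.\<close>

lemma double_limit:
  fixes x :: "nat \<Rightarrow> real"
  assumes y: "\<And>L. y L \<longlonglongrightarrow> b L" and close: "\<And>L k. L \<le> k \<Longrightarrow> \<bar>x k - y L k\<bar> \<le> \<delta> L"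
    and \<delta>: "\<delta> \<longlonglongrightarrow> 0"
  shows "x \<longlonglongrightarrow> lim b"
proof -
  have "Cauchy x"
  proof (rule CauchyI)
    fix e :: real assume e: "0 < e"
    obtain L where L: "\<delta> L < e / 4"
      using order_tendstoD(2)[OF \<delta>, of "e/4"] e by (auto simp: eventually_sequentially)
    have "Cauchy (y L)" using y by (rule LIMSEQ_imp_Cauchy)
    then obtain M where M: "\<And>m n. m \<ge> M \<Longrightarrow> n \<ge> M \<Longrightarrow> norm (y L m - y L n) < e / 4"
      using CauchyD[of "y L" "e/4"] e by auto
    have "norm (x m - x n) < e" if "m \<ge> max M L" "n \<ge> max M L" for m n
    proof -
      have "\<bar>y L m - y L n\<bar> < e / 4" "\<bar>x m - y L m\<bar> \<le> \<delta> L" "\<bar>x n - y L n\<bar> \<le> \<delta> L"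
        using M[of m n] close[of L m] close[of L n] that by auto
      then show ?thesis using L e unfolding real_norm_def by linarith
    qed
    then show "\<exists>M. \<forall>m\<ge>M. \<forall>n\<ge>M. norm (x m - x n) < e" by blast
  qed
  then obtain l where l: "x \<longlonglongrightarrow> l" using Cauchy_convergent_iff convergent_def by blast
  have "\<bar>l - b L\<bar> \<le> \<delta> L" for L
  proof (rule LIMSEQ_le_const2)
    show "(\<lambda>k. \<bar>x k - y L k\<bar>) \<longlonglongrightarrow> \<bar>l - b L\<bar>" by (intro tendsto_intros l y)
    show "\<exists>N. \<forall>k\<ge>N. \<bar>x k - y L k\<bar> \<le> \<delta> L" using close by blast
  qed
  then have "(\<lambda>L. b L - l) \<longlonglongrightarrow> 0"
    by (intro Lim_null_comparison[OF _ \<delta>] always_eventually) (simp add: abs_minus_commute)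
  then have "b \<longlonglongrightarrow> l" by (simp add: LIM_zero_iff)
  then show ?thesis using l by (simp add: limI)
qed

text \<open>The linear error grows faster than \<open>\<mu> ^ i\<close> decays, and the quadratic error is harmless only for
  \<open>i\<close> far below \<open>k\<close>; comparing the indices \<open>0\<close> and \<open>k - L\<close> balances both.\<close>

context
  fixes \<mu> \<beta> K W \<epsilon> :: real and k :: nat and x :: "nat \<Rightarrow> real"
  assumes \<mu>: "0 < \<mu>" "\<mu> < 1" and \<nu>: "1 < \<mu> * \<beta>" and K: "0 \<le> K" and W: "0 \<le> W" and \<epsilon>: "0 \<le> \<epsilon>"
    and x: "\<And>i. 0 \<le> x i" "\<And>i. x i \<le> 1"
    and up: "\<And>i. x i \<le> K * \<beta> ^ i * \<epsilon> + \<mu> * x (Suc i)"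
    and low: "\<And>i. \<mu> * x (Suc i) - W * (x (Suc i))\<^sup>2 \<le> x i"
begin

text \<open>Weighting by \<open>\<mu> ^ i\<close> telescopes the recursion and turns its linear
  error into a geometric sum of ratio \<mu>\<beta> > 1, which is dominated by its last term.\<close>

lemma geometric_upper_step:
  "i \<le> j \<Longrightarrow> \<mu> ^ i * x i - \<mu> ^ j * x j \<le> K * \<epsilon> * (\<mu> * \<beta>) ^ j / (\<mu> * \<beta> - 1)"
proof -
  let ?\<nu> = "\<mu> * \<beta>"
  assume ij: "i \<le> j"
  have "\<mu> ^ i * x i - \<mu> ^ j * x j \<le> K * \<epsilon> * (?\<nu> ^ j - ?\<nu> ^ i) / (?\<nu> - 1)"
    using ij
  proof (induction rule: dec_induct)
    case (step n)
    have "\<mu> ^ n * x n \<le> \<mu> ^ n * (K * \<beta> ^ n * \<epsilon> + \<mu> * x (Suc n))"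
      using \<mu> by (intro mult_left_mono up) auto
    also have "\<dots> = K * \<epsilon> * ?\<nu> ^ n + \<mu> ^ Suc n * x (Suc n)"
      by (simp add: algebra_simps power_mult_distrib)
    finally have "\<mu> ^ i * x i - \<mu> ^ Suc n * x (Suc n) \<le> K * \<epsilon> * (?\<nu> ^ n - ?\<nu> ^ i) / (?\<nu> - 1) + K * \<epsilon> * ?\<nu> ^ n"
      using step.IH by linarith
    also have "\<dots> = K * \<epsilon> * (?\<nu> ^ Suc n - ?\<nu> ^ i) / (?\<nu> - 1)"
    proof -
      have "?\<nu> - 1 \<noteq> 0" using \<nu> by simp
      then show ?thesis by (simp add: divide_simps) (simp add: algebra_simps)
    qed
    finally show ?case .
  qed simp
  also have "\<dots> \<le> K * \<epsilon> * ?\<nu> ^ j / (?\<nu> - 1)"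
    using \<nu> K \<epsilon> by (intro divide_right_mono mult_left_mono) auto
  finally show ?thesis .
qed

text \<open>The a priori constant for index \<open>k\<close> as end point: the 1 bounds
  \<open>x k\<close>, and the rest is the accumulated linear error, which sees \<epsilon> only
  through \<open>\<epsilon> * \<beta> ^ k\<close>.\<close>

definition "gbound = 1 + K * (\<epsilon> * \<beta> ^ k) / (\<mu> * \<beta> - 1)"

lemma gbound_ge1: "1 \<le> gbound"
proof -
  have "0 < \<mu> * \<beta>" using \<nu> by linarith
  then have "0 < \<beta>" using \<mu> by (simp add: zero_less_mult_iff)
  then show ?thesis using \<nu> K \<epsilon> unfolding gbound_def by simp
qed

lemma geometric_weighted_le: "i \<le> k \<Longrightarrow> \<mu> ^ i * x i \<le> \<mu> ^ k * gbound"
proof -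
  assume i: "i \<le> k"
  have "\<mu> ^ k * x k \<le> \<mu> ^ k * 1" using \<mu> x by (intro mult_left_mono) auto
  then have "\<mu> ^ i * x i \<le> \<mu> ^ k + K * \<epsilon> * (\<mu> * \<beta>) ^ k / (\<mu> * \<beta> - 1)"
    using geometric_upper_step[OF i] by linarith
  also have "\<dots> = \<mu> ^ k * gbound"
    by (simp add: gbound_def power_mult_distrib distrib_left mult_ac)
  finally show ?thesis .
qed

lemma geometric_le: "i \<le> k \<Longrightarrow> x i \<le> \<mu> ^ (k - i) * gbound"
proof -
  assume i: "i \<le> k"
  have "\<mu> ^ i * x i \<le> \<mu> ^ i * (\<mu> ^ (k - i) * gbound)"
    using geometric_weighted_le[OF i] i by (simp add: mult.assoc[symmetric] power_add[symmetric])
  then show ?thesis using \<mu> by simp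
qed

text \<open>By the a priori bounds, the weighted square at index i is of order
  \<open>\<mu> ^ k * \<mu> ^ (k - i)\<close>. These quadratic errors increase geometrically in i, so
  their sum up to \<open>j\<close> is governed by the last one.\<close>

lemma geometric_lower_step:
  "j \<le> k \<Longrightarrow> \<mu> ^ j * x j - x 0 \<le> W * gbound\<^sup>2 / (\<mu> * (1 - \<mu>)) * \<mu> ^ k * \<mu> ^ (k - j)"
proof -
  assume jk: "j \<le> k"
  define C where "C = W * gbound\<^sup>2 / \<mu> * \<mu> ^ k"
  have C: "0 \<le> C" unfolding C_def using W \<mu> by simp
  have "\<mu> ^ j * x j - x 0 \<le> C * (\<mu> ^ (k - j) - \<mu> ^ k) / (1 - \<mu>)"
    using jk
  proof (induction j)
    case (Suc j)
    then have jk: "Suc j \<le> k" by simp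
    have "\<mu> ^ j * (x (Suc j))\<^sup>2 = (\<mu> ^ Suc j * x (Suc j)) * x (Suc j) / \<mu>"
      using \<mu> by (simp add: power2_eq_square)
    also have "\<dots> \<le> (\<mu> ^ k * gbound) * (\<mu> ^ (k - Suc j) * gbound) / \<mu>"
    proof (intro divide_right_mono mult_mono[OF geometric_weighted_le[OF jk] geometric_le[OF jk]])
      show "0 \<le> \<mu> ^ k * gbound" using \<mu> gbound_ge1 by simp
    qed (use \<mu> x in auto)
    finally have "W * (\<mu> ^ j * (x (Suc j))\<^sup>2) \<le> W * ((\<mu> ^ k * gbound) * (\<mu> ^ (k - Suc j) * gbound) / \<mu>)"
      using W by (rule mult_left_mono)
    also have "\<dots> = C * \<mu> ^ (k - Suc j)"
      by (simp add: C_def power2_eq_square mult_ac)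
    finally have q: "W * (\<mu> ^ j * (x (Suc j))\<^sup>2) \<le> C * \<mu> ^ (k - Suc j)" .
    have "\<mu> ^ j * (\<mu> * x (Suc j) - W * (x (Suc j))\<^sup>2) \<le> \<mu> ^ j * x j"
      using \<mu> by (intro mult_left_mono low) auto
    then have "\<mu> ^ Suc j * x (Suc j) \<le> \<mu> ^ j * x j + C * \<mu> ^ (k - Suc j)"
      using q by (simp add: algebra_simps)
    then have "\<mu> ^ Suc j * x (Suc j) - x 0 \<le> C * (\<mu> ^ (k - j) - \<mu> ^ k) / (1 - \<mu>) + C * \<mu> ^ (k - Suc j)"
      using Suc by linarith
    also have "\<mu> ^ (k - j) = \<mu> * \<mu> ^ (k - Suc j)"
      using jk by (simp add: power_Suc[symmetric] Suc_diff_Suc)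
    also have "C * (\<mu> * \<mu> ^ (k - Suc j) - \<mu> ^ k) / (1 - \<mu>) + C * \<mu> ^ (k - Suc j)
        = C * (\<mu> ^ (k - Suc j) - \<mu> ^ k) / (1 - \<mu>)"
    proof -
      have "1 - \<mu> \<noteq> 0" using \<mu> by simp
      then show ?thesis by (simp add: divide_simps) (simp add: algebra_simps)
    qed
    finally show ?case .
  qed simp
  also have "\<dots> \<le> C * \<mu> ^ (k - j) / (1 - \<mu>)"
    using \<mu> C by (intro divide_right_mono mult_left_mono) auto
  finally show ?thesis by (simp add: C_def mult_ac)
qed

text \<open>At \<open>j = k - L\<close> and after division by \<open>\<mu> ^ k\<close>, the linear
  error is of order (\<mu>\<beta>)^(-L) and the quadratic one of order \<mu>^L. Both are uniform in
  \<open>k\<close> as long as \<open>\<epsilon> * \<beta> ^ k\<close> stays bounded.\<close>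

lemma geometric_approx:
  assumes L: "L \<le> k"
  shows "\<bar>x 0 / \<mu> ^ k - x (k - L) / \<mu> ^ L\<bar>
    \<le> K * (\<epsilon> * \<beta> ^ k) / (\<mu> * \<beta> - 1) * (1 / (\<mu> * \<beta>)) ^ L + W * gbound\<^sup>2 / (\<mu> * (1 - \<mu>)) * \<mu> ^ L"
proof -
  define j where "j = k - L"
  have jk: "j \<le> k" "k - j = L" "k = j + L" using L by (auto simp: j_def)
  have nz: "\<mu> \<noteq> 0" "\<mu> * \<beta> \<noteq> 0" using \<mu> \<nu> by auto
  have pk: "0 < \<mu> ^ k" using \<mu> by simp
  have e1: "x 0 / \<mu> ^ k - x j / \<mu> ^ L = (x 0 - \<mu> ^ j * x j) / \<mu> ^ k"
    using nz by (simp add: jk(3) power_add field_simps)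
  have "x 0 - \<mu> ^ j * x j \<le> K * \<epsilon> * (\<mu> * \<beta>) ^ j / (\<mu> * \<beta> - 1)"
    using geometric_upper_step[of 0 j] by simp
  also have "\<dots> = K * (\<epsilon> * \<beta> ^ k) / (\<mu> * \<beta> - 1) * (1 / (\<mu> * \<beta>)) ^ L * \<mu> ^ k"
    using nz by (simp add: jk(3) power_add power_mult_distrib power_divide divide_simps)
  finally have u: "x 0 - \<mu> ^ j * x j \<le> K * (\<epsilon> * \<beta> ^ k) / (\<mu> * \<beta> - 1) * (1 / (\<mu> * \<beta>)) ^ L * \<mu> ^ k" .
  have l: "\<mu> ^ j * x j - x 0 \<le> W * gbound\<^sup>2 / (\<mu> * (1 - \<mu>)) * \<mu> ^ L * \<mu> ^ k"
    using geometric_lower_step[OF jk(1)] by (simp add: jk(2) mult_ac)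
  have p: "0 \<le> K * (\<epsilon> * \<beta> ^ k) / (\<mu> * \<beta> - 1) * (1 / (\<mu> * \<beta>)) ^ L * \<mu> ^ k"
    "0 \<le> W * gbound\<^sup>2 / (\<mu> * (1 - \<mu>)) * \<mu> ^ L * \<mu> ^ k"
  proof -
    have "0 < \<mu> * \<beta>" using \<nu> by linarith
    then have "0 < \<beta>" using \<mu> by (simp add: zero_less_mult_iff)
    then show "0 \<le> K * (\<epsilon> * \<beta> ^ k) / (\<mu> * \<beta> - 1) * (1 / (\<mu> * \<beta>)) ^ L * \<mu> ^ k"
      using \<nu> K \<epsilon> \<mu> by simp
    show "0 \<le> W * gbound\<^sup>2 / (\<mu> * (1 - \<mu>)) * \<mu> ^ L * \<mu> ^ k" using W \<mu> by simp
  qed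
  have "\<bar>x 0 - \<mu> ^ j * x j\<bar> \<le> (K * (\<epsilon> * \<beta> ^ k) / (\<mu> * \<beta> - 1) * (1 / (\<mu> * \<beta>)) ^ L
      + W * gbound\<^sup>2 / (\<mu> * (1 - \<mu>)) * \<mu> ^ L) * \<mu> ^ k"
    using u l p by (simp add: abs_le_iff distrib_right)
  then show ?thesis
    unfolding j_def[symmetric] e1 using pk by (simp add: abs_divide divide_le_eq)
qed

end

section \<open>The recursion of trap expectations over generations\<close>

locale subcritical_walk =
  fixes \<xi> :: "nat pmf" and \<beta> :: real
  assumes mean_pos: "0 < mean_off \<xi>" and mean_lt1: "mean_off \<xi> < 1"
    and second_moment: "integrable (measure_pmf \<xi>) (\<lambda>k. (real k)\<^sup>2)"
    and bias: "1 / mean_off \<xi> < \<beta>"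
begin

abbreviation \<mu> where "\<mu> \<equiv> mean_off \<xi>"
definition \<kappa> where "\<kappa> = \<beta> / (\<beta> - 1)"
definition V where "V = measure_pmf.expectation \<xi> (\<lambda>k. (real k)\<^sup>2)"

lemma bias_mean: "1 < \<mu> * \<beta>"
  using bias mean_pos by (simp add: field_simps)

lemma bias_gt1: "1 < \<beta>"
proof -
  have "1 < 1 / \<mu>" using mean_pos mean_lt1 by simp
  then show ?thesis using bias by simp
qed

lemma kappa_ge1: "1 \<le> \<kappa>" and kappa_pos: "0 < \<kappa>"
  using bias_gt1 by (simp_all add: \<kappa>_def)

lemma kappa_eq: "\<kappa> * (\<beta> - 1) = \<beta>"
  using bias_gt1 by (simp add: \<kappa>_def)

lemma integrable_offspring: "integrable (measure_pmf \<xi>) real"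
proof (rule Bochner_Integration.integrable_bound[OF second_moment])
  show "AE k in measure_pmf \<xi>. norm (real k) \<le> norm ((real k)\<^sup>2)"
  proof (intro AE_I2)
    fix k :: nat
    have "k \<le> k\<^sup>2" by (simp add: power2_eq_square)
    then show "norm (real k) \<le> norm ((real k)\<^sup>2)" by (simp flip: of_nat_power)
  qed
qed simp

lemma V_nonneg: "0 \<le> V"
  unfolding V_def by (intro Bochner_Integration.integral_nonneg) simp

text \<open>By the trap equation and \<open>lft_satur\<close>, the test function at the root becomes
  \<open>lft a (1 + c)\<close> of a sum over the children. With the root degree frozen, the children
  carry independent copies; averaging the two bounds over the degree puts \<open>\<mu>\<close> in
  front of the linear terms and \<open>V\<close> in front of the square.\<close>

lemma trap_mean_recursion:
  assumes \<epsilon>: "0 < \<epsilon>" and a: "0 < a" and c: "0 < c"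
  defines "e \<equiv> trap_mean \<xi> \<beta> \<epsilon> (a * \<beta>) ((1 + c) * \<beta>)"
  shows "trap_mean \<xi> \<beta> \<epsilon> a c \<le> a * \<epsilon> * (1 + \<beta> * \<mu>) + \<mu> * e"
    and "\<mu> * e - (1 + c) / a * V * e\<^sup>2 \<le> trap_mean \<xi> \<beta> \<epsilon> a c"
proof -
  interpret P: prob_space "iid \<xi> :: (nat list \<Rightarrow> nat) measure" by (rule prob_space_iid)
  have \<beta>: "1 < \<beta>" by (rule bias_gt1)
  have b0: "0 < \<beta>" using \<beta> by simp
  have c1: "0 < 1 + c" using c by simp
  define f where "f d s = lft a (1 + c) (\<epsilon> * (1 + \<beta> * real d) + (\<Sum>j<d. \<beta> * trap \<beta> \<epsilon> s [j]))" for d s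
  have w0: "0 \<le> \<epsilon> * (1 + \<beta> * real d) + (\<Sum>j<d. \<beta> * trap \<beta> \<epsilon> s [j])" for d s
    using \<beta> \<epsilon> trap_bounds[OF \<beta> \<epsilon>] by (intro add_nonneg_nonneg mult_nonneg_nonneg sum_nonneg) auto
  have fb: "0 \<le> f d s" "f d s \<le> a / (1 + c)" for d s
    unfolding f_def using lft_nonneg[OF a c1 w0] lft_le[OF a c1 w0] by auto
  have fm[measurable]: "f d \<in> borel_measurable (iid \<xi>)" for d
    unfolding f_def[abs_def] by measurable
  have fdep: "depends_on (f d) (- {[]})" for d
    unfolding depends_on_def
  proof (intro allI impI)
    fix s s' :: "nat list \<Rightarrow> nat" assume eq: "\<forall>i\<in>- {[]}. s i = s' i"
    have "trap \<beta> \<epsilon> s [j] = trap \<beta> \<epsilon> s' [j]" for j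
      by (rule depends_onD[OF depends_on_trap]) (use eq in \<open>auto simp: subtree_def\<close>)
    then show "f d s = f d s'" by (simp add: f_def)
  qed
  have E: "trap_mean \<xi> \<beta> \<epsilon> a c = (\<integral>d. (\<integral>s. f d s \<partial>iid \<xi>) \<partial>measure_pmf \<xi>)"
  proof -
    have "lft a c (trap \<beta> \<epsilon> s []) = f (s []) s" for s
      unfolding trap_eq[OF \<beta> \<epsilon>, of s "[]"] f_def
      using lft_satur[OF less_imp_le[OF c] trap_weight_nonneg[OF \<beta> \<epsilon>, of s "[]"]]
      by (simp add: sum_distrib_left)
    then have "trap_mean \<xi> \<beta> \<epsilon> a c = (\<integral>s. f (s []) s \<partial>iid \<xi>)" by (simp add: trap_mean_def)
    also have "\<dots> = (\<integral>d. (\<integral>s. f d s \<partial>iid \<xi>) \<partial>measure_pmf \<xi>)"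
      by (rule integral_iid_freeze[where B="a / (1 + c)"]) (use fm fdep fb in \<open>auto simp: abs_of_nonneg\<close>)
    finally show ?thesis .
  qed
  have disj: "subtree [i] \<inter> subtree [j] = {}" if "i \<noteq> j" for i j
    by (rule subtree_disjoint) (use that in auto)
  have e_nonneg: "0 \<le> e" unfolding e_def trap_mean_def
    using a b0 c1 trap_bounds[OF \<beta> \<epsilon>] by (intro Bochner_Integration.integral_nonneg lft_nonneg mult_pos_pos) auto
  have U: "(\<integral>s. f d s \<partial>iid \<xi>) \<le> a * \<epsilon> * (1 + \<beta> * real d) + real d * e" for d
    using trap_sum_upper[OF \<beta> \<epsilon> a c1 b0, of "\<epsilon> * (1 + \<beta> * real d)" "{..<d}" "\<lambda>j. [j]" \<xi>] disj \<epsilon> b0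
    by (simp add: f_def e_def mult.assoc)
  have Lo: "real d * e - (1 + c) / a * e\<^sup>2 * (real d)\<^sup>2 \<le> (\<integral>s. f d s \<partial>iid \<xi>)" for d
  proof -
    have "real d * e - real d * e * min 1 ((1 + c) / a * real d * e) \<le> (\<integral>s. f d s \<partial>iid \<xi>)"
      using trap_sum_lower[OF \<beta> \<epsilon> a c1 b0, of "\<epsilon> * (1 + \<beta> * real d)" "{..<d}" "\<lambda>j. [j]" \<xi>] disj \<epsilon> b0
      by (simp add: f_def e_def)
    moreover have "real d * e * min 1 ((1 + c) / a * real d * e) \<le> real d * e * ((1 + c) / a * real d * e)"
      using e_nonneg by (intro mult_left_mono) auto
    ultimately show ?thesis by (simp add: power2_eq_square mult_ac)
  qed
  have fi0: "0 \<le> (\<integral>s. f d s \<partial>iid \<xi>)" for d using fb by (intro Bochner_Integration.integral_nonneg)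
  have fi1: "(\<integral>s. f d s \<partial>iid \<xi>) \<le> a / (1 + c)" for d
    using fb by (intro P.integral_le_const P.integrable_const_bound[where B="a/(1+c)"]) (auto simp: abs_of_nonneg)
  have fint: "integrable (measure_pmf \<xi>) (\<lambda>d. \<integral>s. f d s \<partial>iid \<xi>)"
    by (rule measure_pmf.integrable_const_bound[where B="a / (1 + c)"]) (use fi0 fi1 in auto)
  have "trap_mean \<xi> \<beta> \<epsilon> a c \<le> (\<integral>d. a * \<epsilon> * (1 + \<beta> * real d) + real d * e \<partial>measure_pmf \<xi>)"
    unfolding E using U integrable_offspring by (intro integral_mono fint) auto
  also have "\<dots> = a * \<epsilon> * (1 + \<beta> * \<mu>) + \<mu> * e"
    using integrable_offspring by (simp add: mean_off_def)
  finally show "trap_mean \<xi> \<beta> \<epsilon> a c \<le> a * \<epsilon> * (1 + \<beta> * \<mu>) + \<mu> * e" .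
  have "\<mu> * e - (1 + c) / a * V * e\<^sup>2 = (\<integral>d. real d * e - (1 + c) / a * e\<^sup>2 * (real d)\<^sup>2 \<partial>measure_pmf \<xi>)"
    using integrable_offspring second_moment by (simp add: mean_off_def V_def)
  also have "\<dots> \<le> trap_mean \<xi> \<beta> \<epsilon> a c"
    unfolding E using Lo integrable_offspring second_moment by (intro integral_mono fint) auto
  finally show "\<mu> * e - (1 + c) / a * V * e\<^sup>2 \<le> trap_mean \<xi> \<beta> \<epsilon> a c" .
qed

text \<open>The coefficients solve the iteration (a, c) -> (a\<beta>, (1 + c)\<beta>) of
  \<open>trap_mean_recursion\<close> started at (\<kappa>, \<kappa>), the pair belonging to
  \<open>satur \<kappa>\<close>; the closed form of the second one relies on \<kappa>(\<beta> - 1) =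
  \<beta>. Level \<open>m\<close> thus stands for the test function pushed down \<open>m\<close>
  generations.\<close>

definition level_mean :: "nat \<Rightarrow> real \<Rightarrow> real" where
  "level_mean m \<epsilon> = trap_mean \<xi> \<beta> \<epsilon> (\<kappa> * \<beta> ^ m) (\<kappa> * (2 * \<beta> ^ m - 1))"

lemma level_coeffs: "0 < \<kappa> * \<beta> ^ m" "0 < \<kappa> * (2 * \<beta> ^ m - 1)"
proof -
  have "1 \<le> \<beta> ^ m" using bias_gt1 by simp
  then have "0 < 2 * \<beta> ^ m - 1" by linarith
  then show "0 < \<kappa> * \<beta> ^ m" "0 < \<kappa> * (2 * \<beta> ^ m - 1)" using kappa_pos bias_gt1 by auto
qed

lemma level_mean_bounds:
  assumes "0 < \<epsilon>"
  shows "0 \<le> level_mean m \<epsilon>" "level_mean m \<epsilon> \<le> 1"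
proof -
  interpret P: prob_space "iid \<xi> :: (nat list \<Rightarrow> nat) measure" by (rule prob_space_iid)
  note tb = trap_bounds(1)[OF bias_gt1 assms]
  have 1: "0 \<le> lft (\<kappa> * \<beta> ^ m) (\<kappa> * (2 * \<beta> ^ m - 1)) (trap \<beta> \<epsilon> s [])" for s
    by (rule lft_nonneg[OF level_coeffs tb])
  have "\<kappa> * \<beta> ^ m \<le> \<kappa> * (2 * \<beta> ^ m - 1)"
    using kappa_pos bias_gt1 by (intro mult_left_mono) auto
  then have "\<kappa> * \<beta> ^ m / (\<kappa> * (2 * \<beta> ^ m - 1)) \<le> 1"
    by (subst divide_le_eq_1_pos[OF level_coeffs(2)])
  then have 2: "lft (\<kappa> * \<beta> ^ m) (\<kappa> * (2 * \<beta> ^ m - 1)) (trap \<beta> \<epsilon> s []) \<le> 1" for s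
    using lft_le[OF level_coeffs(1)[of m] level_coeffs(2)[of m] tb[of s "[]"]] by linarith
  show "0 \<le> level_mean m \<epsilon>" unfolding level_mean_def trap_mean_def
    by (rule Bochner_Integration.integral_nonneg) (rule 1)
  show "level_mean m \<epsilon> \<le> 1" unfolding level_mean_def trap_mean_def
    using 1 2 by (intro P.integral_le_const P.integrable_const_bound[where B=1]) auto
qed

lemma level_mean_recursion:
  assumes \<epsilon>: "0 < \<epsilon>"
  shows "level_mean m \<epsilon> \<le> \<kappa> * (1 + \<beta> * \<mu>) * \<beta> ^ m * \<epsilon> + \<mu> * level_mean (Suc m) \<epsilon>"
    and "\<mu> * level_mean (Suc m) \<epsilon> - 2 * V * (level_mean (Suc m) \<epsilon>)\<^sup>2 \<le> level_mean m \<epsilon>"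
proof -
  let ?a = "\<kappa> * \<beta> ^ m" and ?c = "\<kappa> * (2 * \<beta> ^ m - 1)"
  have "(1 + ?c) * \<beta> = \<kappa> * (2 * \<beta> ^ Suc m) + (\<beta> - \<kappa> * \<beta>)" by (simp add: algebra_simps)
  also have "\<beta> - \<kappa> * \<beta> = - \<kappa>" using kappa_eq by (simp add: algebra_simps)
  finally have c: "(1 + ?c) * \<beta> = \<kappa> * (2 * \<beta> ^ Suc m - 1)" by (simp add: algebra_simps)
  have e: "trap_mean \<xi> \<beta> \<epsilon> (?a * \<beta>) ((1 + ?c) * \<beta>) = level_mean (Suc m) \<epsilon>"
    unfolding level_mean_def c by (simp add: mult_ac)
  note R = trap_mean_recursion[OF \<epsilon> level_coeffs[of m], unfolded e]
  show "level_mean m \<epsilon> \<le> \<kappa> * (1 + \<beta> * \<mu>) * \<beta> ^ m * \<epsilon> + \<mu> * level_mean (Suc m) \<epsilon>"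
    using R(1) by (simp add: level_mean_def mult_ac)
  \<comment> \<open>As \<kappa> \<ge> 1, the quadratic coefficient is bounded uniformly in the
    level, so it does not grow on the way down.\<close>
  have "(1 + ?c) / ?a \<le> 2"
    using kappa_ge1 level_coeffs(1)[of m] by (simp add: divide_le_eq algebra_simps)
  then have "(1 + ?c) / ?a * (V * (level_mean (Suc m) \<epsilon>)\<^sup>2) \<le> 2 * (V * (level_mean (Suc m) \<epsilon>)\<^sup>2)"
    using V_nonneg by (intro mult_right_mono) auto
  then show "\<mu> * level_mean (Suc m) \<epsilon> - 2 * V * (level_mean (Suc m) \<epsilon>)\<^sup>2 \<le> level_mean m \<epsilon>"
    using R(2) by (simp add: level_mean_def mult.assoc)
qed

definition trap_limit :: "(nat list \<Rightarrow> nat) \<Rightarrow> real" where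
  "trap_limit s = (INF x\<in>{0<..}. x / trap \<beta> x s [])"

text \<open>The integral is the limit of level \<open>k - L\<close> as k tends to infinity, and
  \<open>L\<close> is sent to infinity afterwards. The 2 is the limit of the coefficient ratio
  \<open>c / a\<close> at high levels.\<close>

definition trap_rate :: "real \<Rightarrow> real" where
  "trap_rate \<sigma> = lim (\<lambda>L. (\<integral>s. 1 / (\<beta> ^ L * trap_limit s / (\<kappa> * \<sigma>) + 2) \<partial>iid \<xi>) / \<mu> ^ L)"

text \<open>Written as 1 / (1 / (a p) + c / a), the value depends on the trap only through
  \<epsilon>/p, the quotient whose limit is known.\<close>

lemma lft_trap_eq:
  assumes "0 < \<epsilon>" "L \<le> k"
  shows "lft (\<kappa> * \<beta> ^ (k - L)) (\<kappa> * (2 * \<beta> ^ (k - L) - 1)) (trap \<beta> \<epsilon> s [])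
    = 1 / (\<beta> ^ L * (\<epsilon> / trap \<beta> \<epsilon> s []) / (\<kappa> * (\<epsilon> * \<beta> ^ k)) + (2 - 1 / \<beta> ^ (k - L)))"
proof -
  define p where "p = trap \<beta> \<epsilon> s []"
  define m where "m = k - L"
  have p: "0 < p" unfolding p_def by (rule trap_pos[OF bias_gt1 assms(1)])
  have b: "0 < \<beta>" using bias_gt1 by simp
  have k: "\<beta> ^ k = \<beta> ^ m * \<beta> ^ L" using assms(2) by (simp add: m_def power_add[symmetric])
  define B where "B = \<beta> ^ m"
  have B: "0 < B" "0 < \<beta> ^ L" using b by (simp_all add: B_def)
  have eq: "\<beta> ^ L * (\<epsilon> / p) / (\<kappa> * (\<epsilon> * \<beta> ^ k)) + (2 - 1 / B)
      = (1 + \<kappa> * (2 * B - 1) * p) / (\<kappa> * B * p)"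
    unfolding k B_def[symmetric] using p B kappa_pos assms(1) b by (simp add: field_simps)
  show ?thesis unfolding p_def[symmetric] m_def[symmetric] B_def[symmetric] eq by (simp add: lft_def)
qed

lemma level_mean_tendsto:
  assumes e: "\<And>k. 0 < \<epsilon> k" and lim: "(\<lambda>k. \<epsilon> k * \<beta> ^ k) \<longlonglongrightarrow> \<sigma>" and \<sigma>: "0 < \<sigma>"
  shows "(\<lambda>k. level_mean (k - L) (\<epsilon> k)) \<longlonglongrightarrow> (\<integral>s. 1 / (\<beta> ^ L * trap_limit s / (\<kappa> * \<sigma>) + 2) \<partial>iid \<xi>)"
proof -
  interpret P: prob_space "iid \<xi> :: (nat list \<Rightarrow> nat) measure" by (rule prob_space_iid)
  have inv0: "(\<lambda>k. (1 / \<beta>) ^ k) \<longlonglongrightarrow> 0"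
    using bias_gt1 by (intro LIMSEQ_power_zero) simp
  have "(\<lambda>k. (\<epsilon> k * \<beta> ^ k) * (1 / \<beta>) ^ k) \<longlonglongrightarrow> \<sigma> * 0"
    by (intro tendsto_mult lim inv0)
  then have e0: "\<epsilon> \<longlonglongrightarrow> 0" using bias_gt1 by (simp add: power_divide)
  have y: "(\<lambda>k. \<epsilon> k / trap \<beta> (\<epsilon> k) s []) \<longlonglongrightarrow> trap_limit s" for s
    unfolding trap_limit_def by (rule trap_ratio_convergent[OF bias_gt1 e e0])
  have y0: "0 \<le> \<epsilon> k / trap \<beta> (\<epsilon> k) s []" for k s
    using e[of k] trap_pos[OF bias_gt1 e[of k]] by (simp add: less_imp_le)
  have l0: "0 \<le> trap_limit s" for s using LIMSEQ_le_const[OF y] y0 by blast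
  have lm[measurable]: "trap_limit \<in> borel_measurable (iid \<xi>)"
    by (rule borel_measurable_LIMSEQ_real[OF y]) measurable
  have inv1: "(\<lambda>k. 1 / \<beta> ^ (k - L)) \<longlonglongrightarrow> 0"
  proof -
    have "(\<lambda>k. (1 / \<beta>) ^ (k - L)) \<longlonglongrightarrow> 0"
      by (subst LIMSEQ_offset[of _ L]) (use inv0 in auto)
    then show ?thesis by (simp add: power_divide)
  qed
  define g where "g k s = 1 / (\<beta> ^ L * (\<epsilon> k / trap \<beta> (\<epsilon> k) s []) / (\<kappa> * (\<epsilon> k * \<beta> ^ k)) + (2 - 1 / \<beta> ^ (k - L)))" for k s
  have "(\<lambda>k. \<integral>s. g k s \<partial>iid \<xi>) \<longlonglongrightarrow> (\<integral>s. 1 / (\<beta> ^ L * trap_limit s / (\<kappa> * \<sigma>) + 2) \<partial>iid \<xi>)"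
  proof (rule integral_dominated_convergence[where w="\<lambda>_. 1"])
    show "AE s in iid \<xi>. (\<lambda>k. g k s) \<longlonglongrightarrow> 1 / (\<beta> ^ L * trap_limit s / (\<kappa> * \<sigma>) + 2)"
    proof (intro AE_I2)
      fix s
      have nz: "\<beta> ^ L * trap_limit s / (\<kappa> * \<sigma>) + (2 - 0) \<noteq> 0"
        using l0[of s] kappa_pos \<sigma> bias_gt1 by (intro less_imp_neq[symmetric] add_nonneg_pos) auto
      have "(\<lambda>k. g k s) \<longlonglongrightarrow> 1 / (\<beta> ^ L * trap_limit s / (\<kappa> * \<sigma>) + (2 - 0))"
        unfolding g_def using nz kappa_pos \<sigma> by (intro tendsto_intros y lim inv1) auto
      then show "(\<lambda>k. g k s) \<longlonglongrightarrow> 1 / (\<beta> ^ L * trap_limit s / (\<kappa> * \<sigma>) + 2)" by simp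
    qed
    show "AE s in iid \<xi>. norm (g k s) \<le> 1" for k
    proof (intro AE_I2)
      fix s
      \<comment> \<open>Hence the last summand \<open>2 - 1 / \<beta> ^ (k - L)\<close> of the
        denominator is at least 1, and the constant 1 dominates all integrands.\<close>
      have "1 / \<beta> ^ (k - L) \<le> 1" using bias_gt1 by simp
      moreover have "0 \<le> \<beta> ^ L * (\<epsilon> k / trap \<beta> (\<epsilon> k) s []) / (\<kappa> * (\<epsilon> k * \<beta> ^ k))"
        by (rule divide_nonneg_nonneg[OF mult_nonneg_nonneg[OF _ y0]])
          (use kappa_pos e[of k] bias_gt1 in auto)
      ultimately have "1 \<le> \<beta> ^ L * (\<epsilon> k / trap \<beta> (\<epsilon> k) s []) / (\<kappa> * (\<epsilon> k * \<beta> ^ k)) + (2 - 1 / \<beta> ^ (k - L))"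
        by linarith
      then show "norm (g k s) \<le> 1" unfolding g_def by simp
    qed
    show "(\<lambda>s. 1 / (\<beta> ^ L * trap_limit s / (\<kappa> * \<sigma>) + 2)) \<in> borel_measurable (iid \<xi>)" by measurable
    show "g k \<in> borel_measurable (iid \<xi>)" for k unfolding g_def[abs_def] by measurable
  qed simp
  moreover have "\<forall>\<^sub>F k in sequentially. (\<integral>s. g k s \<partial>iid \<xi>) = level_mean (k - L) (\<epsilon> k)"
    using eventually_ge_at_top[of L]
  proof eventually_elim
    case (elim k)
    show ?case unfolding level_mean_def trap_mean_def g_def lft_trap_eq[OF e elim] ..
  qed
  ultimately show ?thesis by (rule Lim_transform_eventually)
qed

lemma level_mean_approx:
  assumes \<epsilon>: "0 < \<epsilon>" "\<epsilon> * \<beta> ^ k \<le> C"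
  defines "B \<equiv> 1 + \<kappa> * (1 + \<beta> * \<mu>) * C / (\<mu> * \<beta> - 1)"
  shows "L \<le> k \<Longrightarrow> \<bar>level_mean 0 \<epsilon> / \<mu> ^ k - level_mean (k - L) \<epsilon> / \<mu> ^ L\<bar>
    \<le> \<kappa> * (1 + \<beta> * \<mu>) * C / (\<mu> * \<beta> - 1) * (1 / (\<mu> * \<beta>)) ^ L + 2 * V * B\<^sup>2 / (\<mu> * (1 - \<mu>)) * \<mu> ^ L"
    and "level_mean 0 \<epsilon> \<le> \<mu> ^ k * B"
proof -
  let ?K = "\<kappa> * (1 + \<beta> * \<mu>)" and ?W = "2 * V"
  have K: "0 \<le> ?K" using kappa_pos bias_gt1 mean_pos by simp
  have W: "0 \<le> ?W" using V_nonneg by simp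
  have hyps: "0 < \<mu>" "\<mu> < 1" "1 < \<mu> * \<beta>" "0 \<le> ?K" "0 \<le> ?W" "0 \<le> \<epsilon>"
      "\<And>i. 0 \<le> level_mean i \<epsilon>" "\<And>i. level_mean i \<epsilon> \<le> 1"
      "\<And>i. level_mean i \<epsilon> \<le> ?K * \<beta> ^ i * \<epsilon> + \<mu> * level_mean (Suc i) \<epsilon>"
      "\<And>i. \<mu> * level_mean (Suc i) \<epsilon> - ?W * (level_mean (Suc i) \<epsilon>)\<^sup>2 \<le> level_mean i \<epsilon>"
    using mean_pos mean_lt1 bias_mean K W \<epsilon>(1) level_mean_bounds[OF \<epsilon>(1)] level_mean_recursion[OF \<epsilon>(1)]
    by auto
  let ?G = "gbound \<mu> \<beta> ?K \<epsilon> k"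
  have gd: "?G = 1 + ?K * (\<epsilon> * \<beta> ^ k) / (\<mu> * \<beta> - 1)"
    by (rule gbound_def[OF hyps])
  have g1: "1 \<le> ?G" by (rule gbound_ge1[OF hyps])
  have kk: "?K * (\<epsilon> * \<beta> ^ k) / (\<mu> * \<beta> - 1) \<le> ?K * C / (\<mu> * \<beta> - 1)"
    using K bias_mean \<epsilon> by (intro divide_right_mono mult_left_mono) auto
  have gB: "?G \<le> B" using kk by (simp add: gd B_def)
  show "level_mean 0 \<epsilon> \<le> \<mu> ^ k * B"
    using geometric_weighted_le[OF hyps, of 0 k] mult_left_mono[OF gB, of "\<mu> ^ k"] mean_pos
    by (simp add: order_trans)
  assume L: "L \<le> k"
  have "\<bar>level_mean 0 \<epsilon> / \<mu> ^ k - level_mean (k - L) \<epsilon> / \<mu> ^ L\<bar>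
    \<le> ?K * (\<epsilon> * \<beta> ^ k) / (\<mu> * \<beta> - 1) * (1 / (\<mu> * \<beta>)) ^ L + ?W * ?G\<^sup>2 / (\<mu> * (1 - \<mu>)) * \<mu> ^ L"
    by (rule geometric_approx[OF hyps L])
  also have "\<dots> \<le> ?K * C / (\<mu> * \<beta> - 1) * (1 / (\<mu> * \<beta>)) ^ L + ?W * B\<^sup>2 / (\<mu> * (1 - \<mu>)) * \<mu> ^ L"
  proof (intro add_mono mult_right_mono kk)
    have "?G\<^sup>2 \<le> B\<^sup>2" using g1 gB by (intro power_mono) auto
    then show "?W * ?G\<^sup>2 / (\<mu> * (1 - \<mu>)) \<le> ?W * B\<^sup>2 / (\<mu> * (1 - \<mu>))"
      using W mean_pos mean_lt1 by (intro divide_right_mono mult_left_mono) auto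
  qed (use mean_pos bias_mean in auto)
  finally show "\<bar>level_mean 0 \<epsilon> / \<mu> ^ k - level_mean (k - L) \<epsilon> / \<mu> ^ L\<bar>
    \<le> ?K * C / (\<mu> * \<beta> - 1) * (1 / (\<mu> * \<beta>)) ^ L + 2 * V * B\<^sup>2 / (\<mu> * (1 - \<mu>)) * \<mu> ^ L" .
qed

lemma trap_rate_limit:
  assumes e: "\<And>k. 0 < \<epsilon> k" and lim: "(\<lambda>k. \<epsilon> k * \<beta> ^ k) \<longlonglongrightarrow> \<sigma>" and \<sigma>: "0 < \<sigma>"
  shows "(\<lambda>k. level_mean 0 (\<epsilon> k) / \<mu> ^ k) \<longlonglongrightarrow> trap_rate \<sigma>"
proof -
  obtain C where C: "\<And>k. \<epsilon> k * \<beta> ^ k \<le> C"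
  proof -
    have "Bseq (\<lambda>k. \<epsilon> k * \<beta> ^ k)" using lim by (intro convergent_imp_Bseq convergentI)
    then obtain C where "\<And>k. norm (\<epsilon> k * \<beta> ^ k) \<le> C" by (auto simp: Bseq_def)
    then show ?thesis using that[of C] by (auto simp: abs_le_iff)
  qed
  let ?B = "1 + \<kappa> * (1 + \<beta> * \<mu>) * C / (\<mu> * \<beta> - 1)"
  show ?thesis unfolding trap_rate_def
  proof (rule double_limit)
    show "(\<lambda>k. level_mean (k - L) (\<epsilon> k) / \<mu> ^ L)
      \<longlonglongrightarrow> (\<integral>s. 1 / (\<beta> ^ L * trap_limit s / (\<kappa> * \<sigma>) + 2) \<partial>iid \<xi>) / \<mu> ^ L" for L
      using mean_pos by (intro tendsto_divide level_mean_tendsto[OF e lim \<sigma>] tendsto_const) auto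
    show "\<bar>level_mean 0 (\<epsilon> k) / \<mu> ^ k - level_mean (k - L) (\<epsilon> k) / \<mu> ^ L\<bar>
      \<le> \<kappa> * (1 + \<beta> * \<mu>) * C / (\<mu> * \<beta> - 1) * (1 / (\<mu> * \<beta>)) ^ L + 2 * V * ?B\<^sup>2 / (\<mu> * (1 - \<mu>)) * \<mu> ^ L"
      if "L \<le> k" for L k by (rule level_mean_approx(1)[OF e C that])
    have "(\<lambda>L. \<kappa> * (1 + \<beta> * \<mu>) * C / (\<mu> * \<beta> - 1) * (1 / (\<mu> * \<beta>)) ^ L + 2 * V * ?B\<^sup>2 / (\<mu> * (1 - \<mu>)) * \<mu> ^ L)
      \<longlonglongrightarrow> \<kappa> * (1 + \<beta> * \<mu>) * C / (\<mu> * \<beta> - 1) * 0 + 2 * V * ?B\<^sup>2 / (\<mu> * (1 - \<mu>)) * 0"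
      using bias_mean mean_pos mean_lt1 by (intro tendsto_add tendsto_mult_left LIMSEQ_power_zero) auto
    then show "(\<lambda>L. \<kappa> * (1 + \<beta> * \<mu>) * C / (\<mu> * \<beta> - 1) * (1 / (\<mu> * \<beta>)) ^ L
        + 2 * V * ?B\<^sup>2 / (\<mu> * (1 - \<mu>)) * \<mu> ^ L) \<longlonglongrightarrow> 0" by simp
  qed
qed

lemma level_mean_0_tendsto:
  assumes e: "\<And>k. 0 < \<epsilon> k" and lim: "(\<lambda>k. \<epsilon> k * \<beta> ^ k) \<longlonglongrightarrow> \<sigma>" and \<sigma>: "0 < \<sigma>"
  shows "(\<lambda>k. level_mean 0 (\<epsilon> k)) \<longlonglongrightarrow> 0"
proof -
  have "(\<lambda>k. level_mean 0 (\<epsilon> k) / \<mu> ^ k * \<mu> ^ k) \<longlonglongrightarrow> trap_rate \<sigma> * 0"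
    using mean_pos mean_lt1 by (intro tendsto_mult trap_rate_limit[OF e lim \<sigma>] LIMSEQ_power_zero) auto
  then show ?thesis using mean_pos by simp
qed

text \<open>Reading the sequence \<open>\<sigma> / \<beta> ^ k\<close> one index later replaces
  \<sigma> by \<open>\<sigma> / \<beta>\<close>, while the normalisation by \<open>\<mu> ^ k\<close>
  changes by one factor \<open>\<mu>\<close>.\<close>

lemma trap_rate_scale:
  assumes \<sigma>: "0 < \<sigma>"
  shows "trap_rate (\<sigma> / \<beta>) = \<mu> * trap_rate \<sigma>"
proof (rule LIMSEQ_unique)
  have e: "0 < \<sigma> / \<beta> / \<beta> ^ k" "0 < \<sigma> / \<beta> ^ k" for k using \<sigma> bias_gt1 by simp_all
  show "(\<lambda>k. level_mean 0 (\<sigma> / \<beta> / \<beta> ^ k) / \<mu> ^ k) \<longlonglongrightarrow> trap_rate (\<sigma> / \<beta>)"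
    using bias_gt1 \<sigma> by (intro trap_rate_limit[OF e(1)]) auto
  have "(\<lambda>k. level_mean 0 (\<sigma> / \<beta> ^ k) / \<mu> ^ k) \<longlonglongrightarrow> trap_rate \<sigma>"
    using bias_gt1 by (intro trap_rate_limit[OF e(2) _ \<sigma>]) simp
  then have "(\<lambda>k. \<mu> * (level_mean 0 (\<sigma> / \<beta> ^ Suc k) / \<mu> ^ Suc k)) \<longlonglongrightarrow> \<mu> * trap_rate \<sigma>"
    by (intro tendsto_mult_left) (rule LIMSEQ_Suc)
  then show "(\<lambda>k. level_mean 0 (\<sigma> / \<beta> / \<beta> ^ k) / \<mu> ^ k) \<longlonglongrightarrow> \<mu> * trap_rate \<sigma>"
    using mean_pos by (simp add: mult_ac)
qed

end

subsection \<open>The quenched Laplace transform of a hitting time\<close>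

lemma expectation_bind_bounded:
  fixes f :: "'b \<Rightarrow> real"
  assumes "\<And>y. 0 \<le> f y" "\<And>y. f y \<le> 1"
  shows "measure_pmf.expectation (bind_pmf p N) f = (\<integral>x. measure_pmf.expectation (N x) f \<partial>measure_pmf p)"
proof -
  have i: "integrable (measure_pmf q) f" for q
    by (rule measure_pmf.integrable_const_bound[where B=1]) (use assms in auto)
  have b: "0 \<le> measure_pmf.expectation q f" "measure_pmf.expectation q f \<le> 1" for q
    using assms i by (auto intro!: Bochner_Integration.integral_nonneg measure_pmf.integral_le_const)
  have i2: "integrable (measure_pmf p) (\<lambda>x. measure_pmf.expectation (N x) f)"
    by (rule measure_pmf.integrable_const_bound[where B=1]) (use b in auto)
  have "ennreal (measure_pmf.expectation (bind_pmf p N) f) = (\<integral>\<^sup>+y. f y \<partial>bind_pmf p N)"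
    by (rule nn_integral_eq_integral[symmetric]) (use i assms in auto)
  also have "\<dots> = (\<integral>\<^sup>+x. \<integral>\<^sup>+y. f y \<partial>N x \<partial>p)" by simp
  also have "\<dots> = (\<integral>\<^sup>+x. measure_pmf.expectation (N x) f \<partial>p)"
    by (intro nn_integral_cong nn_integral_eq_integral) (use i assms in auto)
  also have "\<dots> = ennreal (\<integral>x. measure_pmf.expectation (N x) f \<partial>measure_pmf p)"
    by (rule nn_integral_eq_integral) (use i2 b in auto)
  finally show ?thesis using b(1) by (simp add: Bochner_Integration.integral_nonneg)
qed

text \<open>Backward in the starting vertex, with the target absorbing, whereas
  \<open>path_pmf\<close> extends recorded paths forward. Only the backward form satisfies
  first-step equations directly.\<close>

primrec hit :: "real \<Rightarrow> env \<Rightarrow> nat list \<Rightarrow> nat \<Rightarrow> nat list \<Rightarrow> real" where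
  "hit \<beta> \<omega> x 0 = (\<lambda>v. if v = x then 1 else 0)"
| "hit \<beta> \<omega> x (Suc n) = (\<lambda>v. if v = x then 1 else measure_pmf.expectation (step \<beta> \<omega> v) (hit \<beta> \<omega> x n))"

lemma hit_bounds: "0 \<le> hit \<beta> \<omega> x n v" "hit \<beta> \<omega> x n v \<le> 1"
proof -
  have "0 \<le> hit \<beta> \<omega> x n v \<and> hit \<beta> \<omega> x n v \<le> 1"
  proof (induction n arbitrary: v)
    case (Suc n)
    have "integrable (measure_pmf q) (hit \<beta> \<omega> x n)" for q
      by (rule measure_pmf.integrable_const_bound[where B=1]) (use Suc in auto)
    then show ?case using Suc
      by (auto intro!: Bochner_Integration.integral_nonneg measure_pmf.integral_le_const)
  qed simp
  then show "0 \<le> hit \<beta> \<omega> x n v" "hit \<beta> \<omega> x n v \<le> 1" by auto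
qed

lemma hit_target[simp]: "hit \<beta> \<omega> x n x = 1"
  by (cases n) auto

lemma set_path_pmf: "p \<in> set_pmf (path_pmf \<beta> \<omega> n) \<Longrightarrow> p \<noteq> []"
  by (cases n) auto

text \<open>An invariant that trades recorded steps \<open>n\<close> for remaining steps
  \<open>r\<close>. At \<open>n = 0\<close> everything is the backward quantity, at
  \<open>r = 0\<close> everything is read off the recorded path.\<close>

lemma expectation_path_hit:
  "measure_pmf.expectation (path_pmf \<beta> \<omega> n) (\<lambda>p. if x \<in> set p then 1 else hit \<beta> \<omega> x r (hd p))
    = hit \<beta> \<omega> x (n + r) []"
proof (induction n arbitrary: r)
  case (Suc n)
  let ?v = "\<lambda>r p. if x \<in> set p then 1 else hit \<beta> \<omega> x r (hd p)"
  have "measure_pmf.expectation (path_pmf \<beta> \<omega> (Suc n)) (?v r)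
    = (\<integral>p. measure_pmf.expectation (map_pmf (\<lambda>w. w # p) (step \<beta> \<omega> (hd p))) (?v r) \<partial>path_pmf \<beta> \<omega> n)"
    unfolding path_pmf.simps by (rule expectation_bind_bounded) (auto simp: hit_bounds)
  also have "\<dots> = measure_pmf.expectation (path_pmf \<beta> \<omega> n) (?v (Suc r))"
  proof (rule integral_cong_AE)
    show "AE p in path_pmf \<beta> \<omega> n.
      measure_pmf.expectation (map_pmf (\<lambda>w. w # p) (step \<beta> \<omega> (hd p))) (?v r) = ?v (Suc r) p"
    proof (rule AE_pmfI)
      fix p assume "p \<in> set_pmf (path_pmf \<beta> \<omega> n)"
      then have "p \<noteq> []" by (rule set_path_pmf)
      then have "x \<notin> set p \<Longrightarrow> hd p \<noteq> x" by auto
      moreover have "(if w = x then 1 else hit \<beta> \<omega> x r (hd (w # p))) = hit \<beta> \<omega> x r w" for w by simp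
      ultimately show "measure_pmf.expectation (map_pmf (\<lambda>w. w # p) (step \<beta> \<omega> (hd p))) (?v r) = ?v (Suc r) p"
        by (cases "x \<in> set p") (auto simp: eq_commute[of x])
    qed
  qed auto
  also have "\<dots> = hit \<beta> \<omega> x (Suc n + r) []" using Suc[of "Suc r"] by simp
  finally show ?case .
qed simp

lemma quenched_hit_eq: "quenched_hit \<beta> \<omega> m n = hit \<beta> \<omega> (spine \<omega> m) n []"
proof -
  let ?x = "spine \<omega> m"
  have "quenched_hit \<beta> \<omega> m n = measure_pmf.expectation (path_pmf \<beta> \<omega> n) (indicator {p. ?x \<in> set p})"
    by (simp add: quenched_hit_def)
  also have "\<dots> = measure_pmf.expectation (path_pmf \<beta> \<omega> n) (\<lambda>p. if ?x \<in> set p then 1 else hit \<beta> \<omega> ?x 0 (hd p))"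
  proof (rule integral_cong_AE)
    show "AE p in path_pmf \<beta> \<omega> n. indicator {p. ?x \<in> set p} p = (if ?x \<in> set p then 1 else hit \<beta> \<omega> ?x 0 (hd p))"
    proof (rule AE_pmfI)
      fix p assume "p \<in> set_pmf (path_pmf \<beta> \<omega> n)"
      then have "p \<noteq> []" by (rule set_path_pmf)
      then have "hd p \<in> set p" by simp
      then show "indicator {p. ?x \<in> set p} p = (if ?x \<in> set p then 1 else hit \<beta> \<omega> ?x 0 (hd p))"
        by (cases "?x \<in> set p") auto
    qed
  qed auto
  finally show ?thesis unfolding expectation_path_hit by simp
qed

lemma quenched_hit_bounds: "0 \<le> quenched_hit \<beta> \<omega> m n" "quenched_hit \<beta> \<omega> m n \<le> 1"
  by (simp_all add: quenched_hit_def)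

lemma quenched_hit_mono: "quenched_hit \<beta> \<omega> m n \<le> quenched_hit \<beta> \<omega> m (Suc n)"
proof -
  let ?x = "spine \<omega> m"
  have "hit \<beta> \<omega> ?x n v \<le> hit \<beta> \<omega> ?x (Suc n) v" for v
  proof (induction n arbitrary: v)
    case 0
    show ?case using hit_bounds[of \<beta> \<omega> ?x "Suc 0" v] by auto
  next
    case (Suc n)
    have i: "integrable (measure_pmf q) (hit \<beta> \<omega> ?x n)" for q n
      by (rule measure_pmf.integrable_const_bound[where B=1]) (auto simp: hit_bounds)
    have "measure_pmf.expectation (step \<beta> \<omega> v) (hit \<beta> \<omega> ?x n)
      \<le> measure_pmf.expectation (step \<beta> \<omega> v) (hit \<beta> \<omega> ?x (Suc n))"
      by (rule integral_mono[OF i i Suc])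
    then show ?case by (simp del: hit.simps add: hit.simps(2)[of _ _ _ n] hit.simps(2)[of _ _ _ "Suc n"])
  qed
  then show ?thesis by (simp add: quenched_hit_eq del: hit.simps)
qed

text \<open>Transforms truncated after \<open>N\<close> steps are within \<open>q ^ N\<close> of any bounded solution.\<close>

lemma discounted_hit_unique:
  fixes W :: "nat list \<Rightarrow> real"
  assumes q: "0 \<le> q" "q < 1"
    and R: "\<And>v w. v \<in> R \<Longrightarrow> v \<noteq> x \<Longrightarrow> w \<in> set_pmf (step \<beta> \<omega> v) \<Longrightarrow> w \<in> R"
    and W01: "\<And>v. v \<in> R \<Longrightarrow> 0 \<le> W v \<and> W v \<le> 1"
    and Wx: "W x = 1"
    and W: "\<And>v. v \<in> R \<Longrightarrow> v \<noteq> x \<Longrightarrow> W v = q * measure_pmf.expectation (step \<beta> \<omega> v) W"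
    and v: "v \<in> R"
  shows "(1 - q) * (\<Sum>n. hit \<beta> \<omega> x n v * q ^ n) = W v"
proof -
  \<comment> \<open>By Abel summation this is the expectation of q^\<tau> on the event \<tau> \<le>
    N, where \<tau> is the hitting time of \<open>x\<close> from \<open>v\<close>.\<close>
  define T where "T N v = (1 - q) * (\<Sum>n<N. hit \<beta> \<omega> x n v * q ^ n) + q ^ N * hit \<beta> \<omega> x N v" for N v
  have i: "integrable (measure_pmf p) (hit \<beta> \<omega> x n)" for p n
    by (rule measure_pmf.integrable_const_bound[where B=1]) (auto simp: hit_bounds)
  have Ti: "integrable (measure_pmf p) (T N)" for p N
    unfolding T_def[abs_def]
    by (intro Bochner_Integration.integrable_add integrable_mult_right Bochner_Integration.integrable_sum integrable_mult_left i)
  have Tx: "T N x = 1" for N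
    using sum_gp_strict[of q N] q by (simp add: T_def del: hit.simps)
  have Ts: "T (Suc N) v = q * measure_pmf.expectation (step \<beta> \<omega> v) (T N)" if "v \<noteq> x" for N v
  proof -
    have h: "hit \<beta> \<omega> x (Suc n) v = measure_pmf.expectation (step \<beta> \<omega> v) (hit \<beta> \<omega> x n)" for n
      using that by simp
    have "T (Suc N) v = (1 - q) * (\<Sum>n<N. hit \<beta> \<omega> x (Suc n) v * q ^ Suc n) + q ^ Suc N * hit \<beta> \<omega> x (Suc N) v"
      unfolding T_def sum.lessThan_Suc_shift using that by simp
    also have "\<dots> = q * ((1 - q) * (\<Sum>n<N. hit \<beta> \<omega> x (Suc n) v * q ^ n) + q ^ N * hit \<beta> \<omega> x (Suc N) v)"
      by (simp add: algebra_simps sum_distrib_left del: hit.simps)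
    also have "(1 - q) * (\<Sum>n<N. hit \<beta> \<omega> x (Suc n) v * q ^ n) + q ^ N * hit \<beta> \<omega> x (Suc N) v
      = measure_pmf.expectation (step \<beta> \<omega> v) (T N)"
      unfolding T_def[abs_def] h by (simp add: i del: hit.simps)
    finally show ?thesis .
  qed
  have close: "v \<in> R \<Longrightarrow> \<bar>T N v - W v\<bar> \<le> q ^ N" for N v
  proof (induction N arbitrary: v)
    case 0
    then show ?case using W01[of v] Wx by (auto simp: T_def)
  next
    case (Suc N)
    show ?case
    proof (cases "v = x")
      case True
      then show ?thesis using Tx Wx q by simp
    next
      case False
      have wb: "AE w in step \<beta> \<omega> v. norm (W w) \<le> 1"
        using R[OF Suc.prems False] W01 by (intro AE_pmfI) fastforce
      have Wi: "integrable (step \<beta> \<omega> v) W"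
        by (rule measure_pmf.integrable_const_bound[OF wb]) simp
      have "\<bar>measure_pmf.expectation (step \<beta> \<omega> v) (\<lambda>w. T N w - W w)\<bar>
        \<le> measure_pmf.expectation (step \<beta> \<omega> v) (\<lambda>w. \<bar>T N w - W w\<bar>)"
        by (rule integral_abs_bound)
      also have "\<dots> \<le> measure_pmf.expectation (step \<beta> \<omega> v) (\<lambda>w. q ^ N)"
        using Suc.IH R[OF Suc.prems False] Ti Wi by (intro integral_mono_AE) (auto intro!: AE_pmfI)
      also have "\<dots> = q ^ N" by simp
      finally have "q * \<bar>measure_pmf.expectation (step \<beta> \<omega> v) (\<lambda>w. T N w - W w)\<bar> \<le> q * q ^ N"
        using q by (intro mult_left_mono)
      moreover have "T (Suc N) v - W v = q * measure_pmf.expectation (step \<beta> \<omega> v) (\<lambda>w. T N w - W w)"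
        using Ts[OF False] W[OF Suc.prems False] Ti Wi by (simp add: right_diff_distrib)
      ultimately show ?thesis using q by (simp add: abs_mult)
    qed
  qed
  have qN: "(\<lambda>N. q ^ N) \<longlonglongrightarrow> 0" using q by (intro LIMSEQ_power_zero) simp
  have "(\<lambda>N. T N v - W v) \<longlonglongrightarrow> 0"
    using close[OF v] by (intro Lim_null_comparison[OF _ qN]) auto
  then have TW: "(\<lambda>N. T N v) \<longlonglongrightarrow> W v" by (simp add: LIM_zero_iff)
  have sm: "summable (\<lambda>n. hit \<beta> \<omega> x n v * q ^ n)"
  proof (rule summable_comparison_test')
    show "summable (\<lambda>n. q ^ n)" using q by (intro summable_geometric) simp
    show "norm (hit \<beta> \<omega> x n v * q ^ n) \<le> q ^ n" for n
      using hit_bounds[of \<beta> \<omega> x n v] q by (simp add: abs_mult mult_left_le_one_le)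
  qed
  have hN: "(\<lambda>N. q ^ N * hit \<beta> \<omega> x N v) \<longlonglongrightarrow> 0"
    using hit_bounds[of \<beta> \<omega> x _ v] q
    by (intro Lim_null_comparison[OF _ qN]) (auto simp: abs_mult mult_left_le intro!: always_eventually)
  have "(\<lambda>N. T N v) \<longlonglongrightarrow> (1 - q) * (\<Sum>n. hit \<beta> \<omega> x n v * q ^ n) + 0"
    unfolding T_def by (intro tendsto_add tendsto_mult_left summable_LIMSEQ sm hN)
  then show ?thesis using TW LIMSEQ_unique by fastforce
qed

lemma expectation_children:
  fixes f :: "nat list \<Rightarrow> real"
  assumes "0 < deg \<omega> v"
  shows "measure_pmf.expectation (pmf_of_set (children \<omega> v)) f = (\<Sum>j<deg \<omega> v. f (j # v)) / real (deg \<omega> v)"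
proof -
  have inj: "inj_on (\<lambda>j. j # v) {..<deg \<omega> v}" by (auto intro: inj_onI)
  have "children \<omega> v \<noteq> {}" "finite (children \<omega> v)" "card (children \<omega> v) = deg \<omega> v"
    using assms by (auto simp: children_def card_image[OF inj])
  then show ?thesis
    by (simp add: integral_pmf_of_set) (simp add: children_def sum.reindex[OF inj])
qed

lemma expectation_step:
  fixes f :: "nat list \<Rightarrow> real"
  assumes "0 < \<beta>" "v \<noteq> []"
  shows "measure_pmf.expectation (step \<beta> \<omega> v) f
    = (f (tl v) + \<beta> * (\<Sum>j<deg \<omega> v. f (j # v))) / (1 + \<beta> * real (deg \<omega> v))"
proof (cases "deg \<omega> v = 0")
  case True
  then show ?thesis using assms by (simp add: step_def)
next
  case False
  define d where "d = real (deg \<omega> v)"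
  have d: "0 < d" "0 < 1 + \<beta> * d" using False assms by (auto simp: d_def add_pos_pos)
  have p: "0 \<le> 1 / (1 + \<beta> * d)" "1 / (1 + \<beta> * d) \<le> 1" using d assms by auto
  have fin: "finite (children \<omega> v)" "children \<omega> v \<noteq> {}" using False by (auto simp: children_def)
  have "measure_pmf.expectation (step \<beta> \<omega> v) f
    = (\<Sum>b\<in>UNIV. pmf (bernoulli_pmf (1 / (1 + \<beta> * d))) b *\<^sub>R
        measure_pmf.expectation (if b then return_pmf (tl v) else pmf_of_set (children \<omega> v)) f)"
  proof -
    have "step \<beta> \<omega> v = bind_pmf (bernoulli_pmf (1 / (1 + \<beta> * d)))
      (\<lambda>b. if b then return_pmf (tl v) else pmf_of_set (children \<omega> v))"
      using False assms by (simp add: step_def d_def)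
    then show ?thesis using fin by (simp only:) (rule pmf_expectation_bind, auto)
  qed
  also have "\<dots> = 1 / (1 + \<beta> * d) * f (tl v)
      + (1 - 1 / (1 + \<beta> * d)) * ((\<Sum>j<deg \<omega> v. f (j # v)) / d)"
    using False p by (simp add: UNIV_bool expectation_children d_def)
  also have "\<dots> = (f (tl v) + \<beta> * (\<Sum>j<deg \<omega> v. f (j # v))) / (1 + \<beta> * d)"
  proof -
    have "1 - 1 / (1 + \<beta> * d) = \<beta> * d / (1 + \<beta> * d)" using d by (simp add: field_simps)
    then show ?thesis using d by (simp add: add_divide_distrib)
  qed
  finally show ?thesis by (simp add: d_def)
qed

text \<open>At a root without children the step is \<open>pmf_of_set\<close> of the empty set, whose
  value is unspecified; the first assumption excludes this.\<close>

lemma set_pmf_step: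
  assumes "0 < deg \<omega> v \<or> v \<noteq> []" "w \<in> set_pmf (step \<beta> \<omega> v)"
  shows "(v \<noteq> [] \<and> w = tl v) \<or> (\<exists>j. w = j # v)"
proof -
  have "set_pmf (pmf_of_set (children \<omega> v)) = children \<omega> v" if "0 < deg \<omega> v"
    using that by (intro set_pmf_of_set) (auto simp: children_def)
  then show ?thesis using assms
    by (auto simp: step_def children_def split: if_splits)
qed

section \<open>The killed hitting problem solved along the spine\<close>

lemma length_spine[simp]: "length (spine \<omega> i) = i"
  by (induction i) auto

lemma spine_extends: "i \<le> j \<Longrightarrow> \<exists>w. length w = j - i \<and> spine \<omega> j = w @ spine \<omega> i"
proof (induction rule: dec_induct)
  case (step n)
  then obtain w where "length w = n - i" "spine \<omega> n = w @ spine \<omega> i" by auto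
  then show ?case using step.hyps by (intro exI[of _ "snd (fst \<omega> n) # w"]) auto
qed simp

text \<open>Read off the first-step equation at a special vertex divided by \<beta>: killing at a
  vertex with d children contributes \<open>\<epsilon> * (1 + \<beta> * d) / \<beta>\<close>, and
  each normal child contributes its trap value.\<close>

definition bud_weight :: "real \<Rightarrow> real \<Rightarrow> env \<Rightarrow> nat \<Rightarrow> real" where
  "bud_weight \<beta> \<epsilon> \<omega> i = \<epsilon> * (1 / \<beta> + real (fst (fst \<omega> i)))
     + (\<Sum>j\<in>{..<fst (fst \<omega> i)} - {snd (fst \<omega> i)}. trap \<beta> \<epsilon> (snd \<omega>) (j # spine \<omega> i))"

text \<open>The root has no parent, which lowers its weight by \<open>\<epsilon> / \<beta>\<close>.\<close>

definition root_weight :: "real \<Rightarrow> real \<Rightarrow> env \<Rightarrow> nat \<Rightarrow> real" where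
  "root_weight \<beta> \<epsilon> \<omega> i = bud_weight \<beta> \<epsilon> \<omega> i - (if i = 0 then \<epsilon> / \<beta> else 0)"

text \<open>Candidate for the expectation of q^\<tau>, with \<tau> the hitting time of the m-th
  special vertex, from an arbitrary start: a ratio of \<open>perturbed\<close> values on the spine,
  and off the spine one factor for each edge on the way back to it.\<close>

primrec climb :: "real \<Rightarrow> real \<Rightarrow> env \<Rightarrow> nat \<Rightarrow> nat list \<Rightarrow> real" where
  "climb \<beta> \<epsilon> \<omega> m [] = 1 / perturbed \<beta> (root_weight \<beta> \<epsilon> \<omega>) m"
| "climb \<beta> \<epsilon> \<omega> m (j # v) =
    (if j # v = spine \<omega> (Suc (length v))
     then perturbed \<beta> (root_weight \<beta> \<epsilon> \<omega>) (Suc (length v)) / perturbed \<beta> (root_weight \<beta> \<epsilon> \<omega>) m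
     else (1 - trap \<beta> \<epsilon> (snd \<omega>) (j # v)) * climb \<beta> \<epsilon> \<omega> m v)"

context
  fixes \<beta> \<epsilon> :: real and \<omega> :: env
  assumes \<beta>: "1 < \<beta>" and \<epsilon>: "0 < \<epsilon>"
begin

lemma bud_weight_nonneg: "0 \<le> bud_weight \<beta> \<epsilon> \<omega> i"
  unfolding bud_weight_def using \<beta> \<epsilon> trap_bounds[OF \<beta> \<epsilon>]
  by (intro add_nonneg_nonneg mult_nonneg_nonneg sum_nonneg) auto

lemma root_weight_bounds: "0 \<le> root_weight \<beta> \<epsilon> \<omega> i" "root_weight \<beta> \<epsilon> \<omega> i \<le> bud_weight \<beta> \<epsilon> \<omega> i"
proof -
  have "\<epsilon> / \<beta> \<le> bud_weight \<beta> \<epsilon> \<omega> i"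
    unfolding bud_weight_def using \<beta> \<epsilon> trap_bounds[OF \<beta> \<epsilon>]
    by (simp add: distrib_left sum_nonneg add_nonneg_nonneg)
  then show "0 \<le> root_weight \<beta> \<epsilon> \<omega> i" "root_weight \<beta> \<epsilon> \<omega> i \<le> bud_weight \<beta> \<epsilon> \<omega> i"
    unfolding root_weight_def using bud_weight_nonneg[of i] \<beta> \<epsilon> by auto
qed

text \<open>A verification: \<open>climb\<close> solves the discounted first-step equations, and
  bounded solutions are unique by \<open>discounted_hit_unique\<close>. At normal vertices the
  equation is the trap equation, at special ones the recursion of \<open>perturbed\<close>.
  Assumption \<open>good\<close> says that the special child is among the children, which holds
  almost surely.\<close>

lemma quenched_laplace:
  assumes good: "\<And>i. snd (fst \<omega> i) < fst (fst \<omega> i)"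
  shows "(1 - 1 / (1 + \<epsilon>)) * (\<Sum>n. quenched_hit \<beta> \<omega> m n * (1 / (1 + \<epsilon>)) ^ n)
    = 1 / perturbed \<beta> (root_weight \<beta> \<epsilon> \<omega>) m"
proof -
  define P where "P = perturbed \<beta> (root_weight \<beta> \<epsilon> \<omega>)"
  let ?W = "climb \<beta> \<epsilon> \<omega> m" and ?x = "spine \<omega> m" and ?g = "\<lambda>v. 1 - trap \<beta> \<epsilon> (snd \<omega>) v"
  \<comment> \<open>Proper descendants of the target are left out: there \<open>climb\<close> may
    exceed 1, and the walk cannot get there without hitting the target first.\<close>
  define R where "R = {v. \<forall>w. w \<noteq> [] \<longrightarrow> v \<noteq> w @ ?x}"
  have b0: "0 < \<beta>" using \<beta> by simp
  have P1: "1 \<le> P i" and Pinc: "P i \<le> P (Suc i)" for i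
    unfolding P_def using perturbed_ge1[OF \<beta> root_weight_bounds(1)] perturbed_incr[OF \<beta> root_weight_bounds(1)] by auto
  have Pmono: "i \<le> j \<Longrightarrow> P i \<le> P j" for i j
    using Pinc by (rule lift_Suc_mono_le)
  have Wspine: "?W (spine \<omega> i) = P i / P m" for i
    by (cases i) (auto simp: P_def)
  have Wnormal: "?W v = ?g v * ?W (tl v)" if "v \<noteq> spine \<omega> (length v)" for v
    using that by (cases v) auto
  note climb.simps[simp del]
  have spineR: "i \<le> m" if "spine \<omega> i \<in> R" for i
  proof (rule ccontr)
    assume "\<not> i \<le> m"
    then obtain w where "length w = i - m" "spine \<omega> i = w @ ?x" using spine_extends[of m i \<omega>] by auto
    then show False using that \<open>\<not> i \<le> m\<close> unfolding R_def by (cases w) auto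
  qed
  have tlR: "v \<in> R" if "j # v \<in> R" for j v
    unfolding R_def
  proof (intro CollectI allI impI notI)
    fix w assume "v = w @ ?x"
    then have "j # v = (j # w) @ ?x" by simp
    then show False using that unfolding R_def by blast
  qed
  have childR: "j # v \<in> R" if "v \<in> R" "v \<noteq> ?x" for j v
    unfolding R_def
  proof (intro CollectI allI impI notI)
    fix w assume w: "w \<noteq> []" "j # v = w @ ?x"
    then have "v = tl w @ ?x" by (cases w) auto
    then show False using that unfolding R_def by (cases "tl w = []") auto
  qed
  have deg_spine: "deg \<omega> (spine \<omega> i) = fst (fst \<omega> i)" for i by (simp add: deg_def)
  have "(1 - 1 / (1 + \<epsilon>)) * (\<Sum>n. hit \<beta> \<omega> ?x n [] * (1 / (1 + \<epsilon>)) ^ n) = ?W []"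
  proof (rule discounted_hit_unique[where R=R])
    show "0 \<le> 1 / (1 + \<epsilon>)" "1 / (1 + \<epsilon>) < 1" using \<epsilon> by auto
    show "[] \<in> R" by (simp add: R_def)
    show "?W ?x = 1" using P1[of m] by (simp add: Wspine)
    show "w \<in> R" if v: "v \<in> R" "v \<noteq> ?x" and w: "w \<in> set_pmf (step \<beta> \<omega> v)" for v w
    proof -
      have "0 < deg \<omega> v \<or> v \<noteq> []"
        using good[of 0] deg_spine[of 0] by auto
      from set_pmf_step[OF this w] consider "v \<noteq> []" "w = tl v" | j where "w = j # v" by blast
      then show ?thesis
      proof cases
        case 1
        then have "hd v # w \<in> R" using v(1) by simp
        then show ?thesis by (rule tlR)
      next
        case 2
        then show ?thesis using childR[OF v] by simp
      qed
    qed
    show "0 \<le> ?W v \<and> ?W v \<le> 1" if "v \<in> R" for v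
      using that
    proof (induction v)
      case Nil
      then show ?case using P1[of m] by (simp add: P_def climb.simps)
    next
      case (Cons j v)
      show ?case
      proof (cases "j # v = spine \<omega> (Suc (length v))")
        case True
        then have "Suc (length v) \<le> m" using spineR Cons.prems by metis
        then have "P (Suc (length v)) / P m \<le> 1" using Pmono P1[of m] by simp
        moreover have "0 \<le> P (Suc (length v)) / P m"
          using P1[of m] P1[of "Suc (length v)"] by (intro divide_nonneg_nonneg) linarith+
        ultimately show ?thesis unfolding True Wspine by simp
      next
        case False
        then show ?thesis using Cons.IH[OF tlR[OF Cons.prems]] trap_bounds[OF \<beta> \<epsilon>, of "snd \<omega>" "j # v"]
          by (auto simp: climb.simps simp del: spine.simps intro!: mult_le_one)
      qed
    qed
    show "?W v = 1 / (1 + \<epsilon>) * measure_pmf.expectation (step \<beta> \<omega> v) ?W" if v: "v \<in> R" "v \<noteq> ?x" for v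
    proof (cases "v = spine \<omega> (length v)")
      case True
      define i where "i = length v"
      have vi: "v = spine \<omega> i" using True by (simp add: i_def)
      define d where "d = fst (fst \<omega> i)"
      define u where "u = snd (fst \<omega> i)"
      define G where "G = (\<Sum>j\<in>{..<d} - {u}. trap \<beta> \<epsilon> (snd \<omega>) (j # v))"
      have ud: "u < d" using good by (simp add: u_def d_def)
      have bw: "bud_weight \<beta> \<epsilon> \<omega> i = \<epsilon> * (1 / \<beta> + real d) + G"
        by (simp add: bud_weight_def d_def u_def G_def vi)
      have dv: "deg \<omega> v = d" by (simp add: vi deg_spine d_def)
      have Wu: "?W (u # v) = P (Suc i) / P m"
        using Wspine[of "Suc i"] by (simp add: vi u_def)
      have Wj: "?W (j # v) = (1 - trap \<beta> \<epsilon> (snd \<omega>) (j # v)) * (P i / P m)" if "j \<noteq> u" for j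
        using Wnormal[of "j # v"] that Wspine[of i] by (auto simp: vi u_def)
      have sum: "(\<Sum>j<d. ?W (j # v)) = P (Suc i) / P m + (real d - 1 - G) * (P i / P m)"
      proof -
        have "(\<Sum>j<d. ?W (j # v)) = ?W (u # v) + (\<Sum>j\<in>{..<d} - {u}. ?W (j # v))"
          using ud by (subst sum.remove[of _ u]) auto
        also have "(\<Sum>j\<in>{..<d} - {u}. ?W (j # v)) = (\<Sum>j\<in>{..<d} - {u}. (1 - trap \<beta> \<epsilon> (snd \<omega>) (j # v)) * (P i / P m))"
          by (intro sum.cong refl Wj) simp
        also have "\<dots> = (\<Sum>j\<in>{..<d} - {u}. 1 - trap \<beta> \<epsilon> (snd \<omega>) (j # v)) * (P i / P m)"
          by (simp only: sum_distrib_right)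
        also have "(\<Sum>j\<in>{..<d} - {u}. 1 - trap \<beta> \<epsilon> (snd \<omega>) (j # v)) = real d - 1 - G"
          using ud by (simp add: sum_subtractf G_def of_nat_diff)
        finally show ?thesis by (simp only: Wu)
      qed
      have Wv: "?W v = P i / P m" by (simp add: vi Wspine)
      have pm: "P m \<noteq> 0" using P1[of m] by simp
      have nz: "1 + \<epsilon> \<noteq> 0" "\<beta> \<noteq> 0" "0 < d" using \<epsilon> b0 ud by auto
      show ?thesis
      proof (cases i)
        case 0
        have v0: "v = []" using vi 0 by simp
        \<comment> \<open>Without a parent the equation reads
          \<open>(1 + \<epsilon>) * d = P (Suc 0) + (d - 1 - G)\<close>; the lowered root weight is
          what satisfies it.\<close>
        have "P (Suc 0) = 1 + \<epsilon> * real d + G"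
          using bw nz by (simp add: P_def root_weight_def 0 distrib_left)
        moreover have "P 0 = 1" by (simp add: P_def)
        ultimately have "(\<Sum>j<d. ?W (j # v)) = (1 + \<epsilon>) * real d / P m"
          unfolding sum 0 by (simp add: add_divide_distrib[symmetric] algebra_simps)
        moreover have "measure_pmf.expectation (step \<beta> \<omega> v) ?W = (\<Sum>j<d. ?W (j # v)) / real d"
          using expectation_children[of \<omega> v ?W] nz dv v0 by (simp add: step_def)
        ultimately show ?thesis unfolding Wv 0 using nz pm by (simp add: P_def)
      next
        case (Suc k)
        have PS: "P (Suc i) = P i * (1 + (\<epsilon> * (1 / \<beta> + real d) + G)) + (P i - P k) / \<beta>"
          using bw by (simp add: P_def Suc root_weight_def)
        have vne: "v \<noteq> []" and tlv: "tl v = spine \<omega> k" by (simp_all add: vi Suc)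
        have Wt: "?W (tl v) = P k / P m" unfolding tlv by (rule Wspine)
        have E: "measure_pmf.expectation (step \<beta> \<omega> v) ?W
          = (P k / P m + \<beta> * (P (Suc i) / P m + (real d - 1 - G) * (P i / P m))) / (1 + \<beta> * real d)"
          using expectation_step[OF b0 vne, of \<omega> ?W] unfolding dv sum Wt .
        also have "P k / P m + \<beta> * (P (Suc i) / P m + (real d - 1 - G) * (P i / P m))
          = (P k + \<beta> * P (Suc i) + \<beta> * (real d - 1 - G) * P i) / P m"
          by (simp add: add_divide_distrib distrib_left mult.assoc)
        also have "P k + \<beta> * P (Suc i) + \<beta> * (real d - 1 - G) * P i = (1 + \<epsilon>) * (1 + \<beta> * real d) * P i"
          unfolding PS using nz by (simp add: field_simps)
        finally have "measure_pmf.expectation (step \<beta> \<omega> v) ?W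
          = (1 + \<epsilon>) * (1 + \<beta> * real d) * P i / P m / (1 + \<beta> * real d)" .
        moreover have "1 + \<beta> * real d \<noteq> 0" using b0 by (smt (verit) mult_nonneg_nonneg of_nat_0_le_iff)
        ultimately show ?thesis unfolding Wv using nz by simp
      qed
    next
      case False
      then have vne: "v \<noteq> []" by auto
      define d where "d = snd \<omega> v"
      have dv: "deg \<omega> v = d" using False by (simp add: deg_def d_def)
      have "j # v \<noteq> spine \<omega> (length (j # v))" for j using False by auto
      from Wnormal[OF this] have Wj: "?W (j # v) = ?g (j # v) * ?W v" for j by simp
      define S where "S = (\<Sum>j<d. trap \<beta> \<epsilon> (snd \<omega>) (j # v))"
      define w where "w = \<epsilon> * (1 + \<beta> * real d) + \<beta> * S"
      have w0: "0 \<le> w" unfolding w_def S_def d_def by (rule trap_weight_nonneg[OF \<beta> \<epsilon>])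
      have g: "?g v = 1 / (1 + w)"
        using trap_eq[OF \<beta> \<epsilon>, of "snd \<omega>" v] one_minus_satur[of 1 w] w0 by (simp add: w_def S_def d_def)
      have sum: "(\<Sum>j<d. ?W (j # v)) = (real d - S) * ?W v"
        unfolding Wj sum_distrib_right[symmetric] S_def by (simp add: sum_subtractf)
      have Wt: "?W (tl v) = (1 + w) * ?W v" using Wnormal[OF False] g w0 by simp
      have "?W (tl v) + \<beta> * ((real d - S) * ?W v) = (1 + \<epsilon>) * (1 + \<beta> * real d) * ?W v"
        unfolding Wt w_def by (simp add: algebra_simps)
      then have "measure_pmf.expectation (step \<beta> \<omega> v) ?W
          = (1 + \<epsilon>) * (1 + \<beta> * real d) * ?W v / (1 + \<beta> * real d)"
        unfolding expectation_step[OF b0 vne] dv sum by simp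
      moreover have "1 + \<beta> * real d \<noteq> 0" "1 + \<epsilon> \<noteq> 0"
        using b0 \<epsilon> by (smt (verit) mult_nonneg_nonneg of_nat_0_le_iff)+
      ultimately show ?thesis by simp
    qed
  qed
  then show ?thesis by (simp add: quenched_hit_eq climb.simps)
qed

end

subsection \<open>Measurability of the quenched quantities\<close>

lemma tree_measure_eq: "tree_measure \<xi> = iid (spine_pmf \<xi>) \<Otimes>\<^sub>M iid \<xi>"
  by (simp add: tree_measure_def)

lemma prob_space_tree_measure: "prob_space (tree_measure \<xi>)"
proof -
  interpret A: prob_space "iid (spine_pmf \<xi>) :: (nat \<Rightarrow> nat \<times> nat) measure" by (rule prob_space_iid)
  interpret S: prob_space "iid \<xi> :: (nat list \<Rightarrow> nat) measure" by (rule prob_space_iid)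
  interpret pair_prob_space "iid (spine_pmf \<xi>) :: (nat \<Rightarrow> nat \<times> nat) measure" "iid \<xi> :: (nat list \<Rightarrow> nat) measure" ..
  show ?thesis unfolding tree_measure_eq by (rule prob_space_axioms)
qed

lemma measurable_spine_data[measurable]: "(\<lambda>\<omega>. fst \<omega> i) \<in> tree_measure \<xi> \<rightarrow>\<^sub>M count_space UNIV"
  unfolding tree_measure_eq by measurable

lemma measurable_normal_data[measurable]: "(\<lambda>\<omega>. snd \<omega> v) \<in> tree_measure \<xi> \<rightarrow>\<^sub>M count_space UNIV"
  unfolding tree_measure_eq by measurable

lemma measurable_snd_tree[measurable]: "snd \<in> tree_measure \<xi> \<rightarrow>\<^sub>M iid \<xi>"
  unfolding tree_measure_eq by measurable

lemma measurable_spine[measurable]: "(\<lambda>\<omega>. spine \<omega> i) \<in> tree_measure \<xi> \<rightarrow>\<^sub>M count_space UNIV"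
proof (induction i)
  case (Suc i)
  note [measurable] = Suc
  have "(\<lambda>\<omega>. snd x # spine \<omega> i) \<in> tree_measure \<xi> \<rightarrow>\<^sub>M count_space UNIV" for x :: "nat \<times> nat"
    by measurable
  then have "(\<lambda>\<omega>. snd (fst \<omega> i) # spine \<omega> i) \<in> tree_measure \<xi> \<rightarrow>\<^sub>M count_space UNIV"
    by (rule measurable_compose_countable[where g="\<lambda>\<omega>. fst \<omega> i"]) measurable
  then show ?case by simp
qed simp

lemma measurable_deg[measurable]: "(\<lambda>\<omega>. deg \<omega> v) \<in> tree_measure \<xi> \<rightarrow>\<^sub>M count_space UNIV"
proof -
  have [measurable]: "(\<lambda>\<omega>. fst (fst \<omega> i)) \<in> tree_measure \<xi> \<rightarrow>\<^sub>M count_space UNIV" for i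
    by (rule measurable_compose[OF measurable_spine_data]) simp
  have [measurable]: "Measurable.pred (tree_measure \<xi>) (\<lambda>\<omega>. v = spine \<omega> (length v))"
    by (rule measurable_compose[OF measurable_spine, where g="\<lambda>x. v = x"]) simp
  show ?thesis unfolding deg_def by measurable
qed

text \<open>The step law as a function of the degree alone: the environment enters through one
  countable value, which settles measurability.\<close>

definition step_deg :: "real \<Rightarrow> nat list \<Rightarrow> nat \<Rightarrow> nat list pmf" where
  "step_deg \<beta> v d = (let C = (\<lambda>j. j # v) ` {..<d} in
    (if v = [] then pmf_of_set C
     else if d = 0 then return_pmf (tl v)
     else bind_pmf (bernoulli_pmf (1 / (1 + \<beta> * real d)))
            (\<lambda>b. if b then return_pmf (tl v) else pmf_of_set C)))"

lemma step_eq_step_deg: "step \<beta> \<omega> v = step_deg \<beta> v (deg \<omega> v)"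
  unfolding step_def step_deg_def children_def Let_def by (rule refl)

lemma measurable_hit[measurable]: "(\<lambda>\<omega>. hit \<beta> \<omega> x n v) \<in> borel_measurable (tree_measure \<xi>)"
proof (induction n arbitrary: v)
  case (Suc n)
  have "(\<lambda>\<omega>. measure_pmf.expectation (step_deg \<beta> v d) (\<lambda>w. hit \<beta> \<omega> x n w)) \<in> borel_measurable (tree_measure \<xi>)" for d
  proof (rule measure_pmf.borel_measurable_lebesgue_integral)
    have "(\<lambda>z. hit \<beta> (fst z) x n (snd z)) \<in> borel_measurable (tree_measure \<xi> \<Otimes>\<^sub>M step_deg \<beta> v d)"
    proof (rule measurable_compose_countable[where f="\<lambda>w z. hit \<beta> (fst z) x n w" and g=snd])
      show "(\<lambda>z. hit \<beta> (fst z) x n w) \<in> borel_measurable (tree_measure \<xi> \<Otimes>\<^sub>M step_deg \<beta> v d)" for w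
        by (rule measurable_compose[OF measurable_fst Suc])
      have "snd \<in> tree_measure \<xi> \<Otimes>\<^sub>M step_deg \<beta> v d \<rightarrow>\<^sub>M step_deg \<beta> v d" by (rule measurable_snd)
      then show "snd \<in> tree_measure \<xi> \<Otimes>\<^sub>M step_deg \<beta> v d \<rightarrow>\<^sub>M count_space UNIV" by simp
    qed
    then show "(\<lambda>(\<omega>, w). hit \<beta> \<omega> x n w) \<in> borel_measurable (tree_measure \<xi> \<Otimes>\<^sub>M step_deg \<beta> v d)"
      by (simp add: case_prod_beta')
  qed
  then have "(\<lambda>\<omega>. measure_pmf.expectation (step_deg \<beta> v (deg \<omega> v)) (\<lambda>w. hit \<beta> \<omega> x n w)) \<in> borel_measurable (tree_measure \<xi>)"
    by (rule measurable_compose_countable[where g="\<lambda>\<omega>. deg \<omega> v"]) measurable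
  then show ?case by (cases "v = x") (simp_all add: step_eq_step_deg)
qed simp

lemma measurable_quenched_hit[measurable]: "(\<lambda>\<omega>. quenched_hit \<beta> \<omega> m n) \<in> borel_measurable (tree_measure \<xi>)"
  unfolding quenched_hit_eq
  by (rule measurable_compose_countable[where g="\<lambda>\<omega>. spine \<omega> m"]) measurable

text \<open>Offspring data \<open>x\<close> and position \<open>r\<close> of a special vertex become
  parameters, so that the weight is a function of the normal offspring numbers only. This prepares
  conditioning on the spine.\<close>

definition bud_at :: "real \<Rightarrow> real \<Rightarrow> nat \<times> nat \<Rightarrow> nat list \<Rightarrow> (nat list \<Rightarrow> nat) \<Rightarrow> real" where
  "bud_at \<beta> \<epsilon> x r s = \<epsilon> * (1 / \<beta> + real (fst x)) + (\<Sum>j\<in>{..<fst x} - {snd x}. trap \<beta> \<epsilon> s (j # r))"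

lemma bud_weight_eq: "bud_weight \<beta> \<epsilon> \<omega> i = bud_at \<beta> \<epsilon> (fst \<omega> i) (spine \<omega> i) (snd \<omega>)"
  by (simp add: bud_weight_def bud_at_def)

lemma measurable_bud_at[measurable]: "bud_at \<beta> \<epsilon> x r \<in> borel_measurable (iid \<xi>)"
  unfolding bud_at_def[abs_def] by measurable

lemma bud_at_shift: "bud_at \<beta> \<epsilon> x r s = bud_at \<beta> \<epsilon> x [] (\<lambda>w. s (w @ r))"
proof -
  have "trap \<beta> \<epsilon> s (j # r) = trap \<beta> \<epsilon> (\<lambda>w. s (w @ r)) [j]" for j
    using trap_shift[of \<beta> \<epsilon> s "[j]" r] by simp
  then show ?thesis by (simp add: bud_at_def)
qed

lemma measurable_bud_weight[measurable]: "(\<lambda>\<omega>. bud_weight \<beta> \<epsilon> \<omega> i) \<in> borel_measurable (tree_measure \<xi>)"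
proof -
  have "(\<lambda>\<omega>. bud_at \<beta> \<epsilon> x r (snd \<omega>)) \<in> borel_measurable (tree_measure \<xi>)" for x r
    by (rule measurable_compose[OF measurable_snd_tree measurable_bud_at])
  then have "(\<lambda>\<omega>. bud_at \<beta> \<epsilon> x (spine \<omega> i) (snd \<omega>)) \<in> borel_measurable (tree_measure \<xi>)" for x
    by (rule measurable_compose_countable[where g="\<lambda>\<omega>. spine \<omega> i"]) measurable
  then show ?thesis unfolding bud_weight_eq
    by (rule measurable_compose_countable[where g="\<lambda>\<omega>. fst \<omega> i"]) measurable
qed

subsection \<open>The weights along the spine are independent and identically distributed\<close>

lemma spine_fst_cong: "fst \<omega> = fst \<omega>' \<Longrightarrow> spine \<omega> i = spine \<omega>' i"
  by (induction i) auto

text \<open>Subtrees of normal siblings avoid the subtree of the special child. Along the spine,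
  these differences of nested subtrees are pairwise disjoint, which is the source of
  independence.\<close>

lemma depends_on_bud_at:
  "depends_on (bud_at \<beta> \<epsilon> x r) (subtree r - subtree (snd x # r))"
  unfolding depends_on_def bud_at_def
proof (intro allI impI arg_cong2[where f="(+)"] refl sum.cong)
  fix s s' :: "nat list \<Rightarrow> nat" and j
  assume eq: "\<forall>i\<in>subtree r - subtree (snd x # r). s i = s' i" and j: "j \<in> {..<fst x} - {snd x}"
  have "subtree (j # r) \<inter> subtree (snd x # r) = {}"
    by (rule subtree_disjoint) (use j in auto)
  then have "subtree (j # r) \<subseteq> subtree r - subtree (snd x # r)"
    using subtree_Cons[of j r] by blast
  then show "trap \<beta> \<epsilon> s (j # r) = trap \<beta> \<epsilon> s' (j # r)"
    by (intro depends_onD[OF depends_on_trap]) (use eq in blast)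
qed

lemma subtree_spine_antimono: "i \<le> j \<Longrightarrow> subtree (spine \<omega> j) \<subseteq> subtree (spine \<omega> i)"
proof (induction rule: dec_induct)
  case (step n)
  then show ?case using subtree_Cons[of "snd (fst \<omega> n)" "spine \<omega> n"] by simp
qed simp

lemma disjoint_spine_blocks:
  "disjoint_family_on (\<lambda>i. subtree (spine \<omega> i) - subtree (spine \<omega> (Suc i))) I"
proof -
  have "(subtree (spine \<omega> i) - subtree (spine \<omega> (Suc i))) \<inter> (subtree (spine \<omega> j) - subtree (spine \<omega> (Suc j))) = {}"
    if "i < j" for i j
    using subtree_spine_antimono[of "Suc i" j \<omega>] that by auto
  then show ?thesis unfolding disjoint_family_on_def
    by (metis Int_commute linorder_neqE_nat)
qed

text \<open>The values are extended nonnegative reals so that the unbounded identity is covered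
  along with bounded \<open>h\<close>.\<close>

definition bud_nn :: "nat pmf \<Rightarrow> real \<Rightarrow> real \<Rightarrow> (real \<Rightarrow> ennreal) \<Rightarrow> ennreal" where
  "bud_nn \<xi> \<beta> \<epsilon> h = (\<integral>\<^sup>+x. (\<integral>\<^sup>+s. h (bud_at \<beta> \<epsilon> x [] s) \<partial>iid \<xi>) \<partial>spine_pmf \<xi>)"

text \<open>Given the spine, the weights live on disjoint blocks and the product factorises;
  translation to the root then removes the position of each special vertex. What remains of factor i
  depends on coordinate i of the spine data alone, so the product factorises a second time.\<close>

lemma nn_integral_bud_prod:
  assumes I: "finite I" and h[measurable]: "\<And>i. i \<in> I \<Longrightarrow> h i \<in> borel_measurable borel"
  shows "(\<integral>\<^sup>+\<omega>. (\<Prod>i\<in>I. h i (bud_weight \<beta> \<epsilon> \<omega> i)) \<partial>tree_measure \<xi>) = (\<Prod>i\<in>I. bud_nn \<xi> \<beta> \<epsilon> (h i))"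
proof -
  interpret S: prob_space "iid \<xi> :: (nat list \<Rightarrow> nat) measure" by (rule prob_space_iid)
  define G where "G i x = (\<integral>\<^sup>+s. h i (bud_at \<beta> \<epsilon> x [] s) \<partial>iid \<xi>)" for i x
  have inner: "(\<integral>\<^sup>+s. (\<Prod>i\<in>I. h i (bud_weight \<beta> \<epsilon> (a, s) i)) \<partial>iid \<xi>) = (\<Prod>i\<in>I. G i (a i))" for a
  proof -
    \<comment> \<open>The spine is determined by the first component; the zero function merely
      completes the pair.\<close>
    define r where "r i = spine (a, \<lambda>_. 0) i" for i
    have r: "spine (a, s) i = r i" for s i unfolding r_def by (rule spine_fst_cong) simp
    have "(\<integral>\<^sup>+s. (\<Prod>i\<in>I. h i (bud_weight \<beta> \<epsilon> (a, s) i)) \<partial>iid \<xi>)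
      = (\<integral>\<^sup>+s. (\<Prod>i\<in>I. h i (bud_at \<beta> \<epsilon> (a i) (r i) s)) \<partial>iid \<xi>)"
      by (simp add: bud_weight_eq r)
    also have "\<dots> = (\<Prod>i\<in>I. \<integral>\<^sup>+s. h i (bud_at \<beta> \<epsilon> (a i) (r i) s) \<partial>iid \<xi>)"
    proof (rule nn_integral_iid_block[OF I])
      show "(\<lambda>s. h i (bud_at \<beta> \<epsilon> (a i) (r i) s)) \<in> borel_measurable (iid \<xi>)" if "i \<in> I" for i
        by (rule measurable_compose[OF measurable_bud_at h[OF that]])
      show "depends_on (\<lambda>s. h i (bud_at \<beta> \<epsilon> (a i) (r i) s)) (subtree (r i) - subtree (r (Suc i)))" for i
      proof -
        have "r (Suc i) = snd (a i) # r i" by (simp add: r_def)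
        then show ?thesis using depends_on_bud_at[of \<beta> \<epsilon> "a i" "r i"] unfolding depends_on_def by metis
      qed
      show "disjoint_family_on (\<lambda>i. subtree (r i) - subtree (r (Suc i))) I"
        unfolding r_def by (rule disjoint_spine_blocks)
    qed
    also have "\<dots> = (\<Prod>i\<in>I. G i (a i))"
    proof (rule prod.cong[OF refl])
      fix i assume i: "i \<in> I"
      show "(\<integral>\<^sup>+s. h i (bud_at \<beta> \<epsilon> (a i) (r i) s) \<partial>iid \<xi>) = G i (a i)"
        unfolding G_def bud_at_shift[of _ _ _ "r i"]
        by (rule nn_integral_iid_reindex[OF inj_append_right, of "\<lambda>s. h i (bud_at \<beta> \<epsilon> (a i) [] s)"])
          (rule measurable_compose[OF measurable_bud_at h[OF i]])
    qed
    finally show ?thesis .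
  qed
  have m: "(\<lambda>\<omega>. \<Prod>i\<in>I. h i (bud_weight \<beta> \<epsilon> \<omega> i)) \<in> borel_measurable (iid (spine_pmf \<xi>) \<Otimes>\<^sub>M iid \<xi>)"
    unfolding tree_measure_eq[symmetric]
    by (intro borel_measurable_prod_ennreal measurable_compose[OF measurable_bud_weight h])
  have Gm: "(\<lambda>a. G i (a i)) \<in> borel_measurable (iid (spine_pmf \<xi>))" for i
    by (rule measurable_compose[OF measurable_iid_coordinate]) simp
  have "(\<integral>\<^sup>+\<omega>. (\<Prod>i\<in>I. h i (bud_weight \<beta> \<epsilon> \<omega> i)) \<partial>tree_measure \<xi>)
    = (\<integral>\<^sup>+a. (\<Prod>i\<in>I. G i (a i)) \<partial>iid (spine_pmf \<xi>))"
    unfolding tree_measure_eq by (subst S.nn_integral_fst[OF m, symmetric]) (simp add: inner)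
  also have "\<dots> = (\<Prod>i\<in>I. \<integral>\<^sup>+a. G i (a i) \<partial>iid (spine_pmf \<xi>))"
    by (rule nn_integral_iid_block[OF I Gm, where J="\<lambda>i. {i}"])
      (auto simp: depends_on_def disjoint_family_on_def)
  also have "\<dots> = (\<Prod>i\<in>I. bud_nn \<xi> \<beta> \<epsilon> (h i))"
  proof (rule prod.cong[OF refl])
    fix i
    have "(\<integral>\<^sup>+a. G i (a i) \<partial>iid (spine_pmf \<xi>))
      = (\<integral>\<^sup>+x. G i x \<partial>distr (iid (spine_pmf \<xi>)) (count_space UNIV) (\<lambda>a. a i))"
      by (subst nn_integral_distr) auto
    then show "(\<integral>\<^sup>+a. G i (a i) \<partial>iid (spine_pmf \<xi>)) = bud_nn \<xi> \<beta> \<epsilon> (h i)"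
      by (simp only: distr_iid_component bud_nn_def G_def)
  qed
  finally show ?thesis .
qed

lemma has_integral_bud_prod:
  assumes \<beta>: "1 < \<beta>" and \<epsilon>: "0 < \<epsilon>" and I: "finite I"
    and h: "\<And>i. i \<in> I \<Longrightarrow> h i \<in> borel_measurable borel" "\<And>i x. i \<in> I \<Longrightarrow> 0 \<le> x \<Longrightarrow> 0 \<le> h i x"
    and c: "\<And>i. i \<in> I \<Longrightarrow> 0 \<le> c i" "\<And>i. i \<in> I \<Longrightarrow> bud_nn \<xi> \<beta> \<epsilon> (\<lambda>x. ennreal (h i x)) = ennreal (c i)"
  shows "has_bochner_integral (tree_measure \<xi>) (\<lambda>\<omega>. \<Prod>i\<in>I. h i (bud_weight \<beta> \<epsilon> \<omega> i)) (\<Prod>i\<in>I. c i)"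
proof (rule has_bochner_integral_nn_integral)
  show "(\<lambda>\<omega>. \<Prod>i\<in>I. h i (bud_weight \<beta> \<epsilon> \<omega> i)) \<in> borel_measurable (tree_measure \<xi>)"
    by (intro borel_measurable_prod measurable_compose[OF measurable_bud_weight h(1)])
  have nn: "0 \<le> h i (bud_weight \<beta> \<epsilon> \<omega> i)" if "i \<in> I" for i \<omega>
    by (rule h(2)[OF that bud_weight_nonneg[OF \<beta> \<epsilon>]])
  show "AE \<omega> in tree_measure \<xi>. 0 \<le> (\<Prod>i\<in>I. h i (bud_weight \<beta> \<epsilon> \<omega> i))"
    by (intro AE_I2 prod_nonneg nn)
  show "0 \<le> (\<Prod>i\<in>I. c i)" by (intro prod_nonneg c(1))
  have "(\<integral>\<^sup>+\<omega>. ennreal (\<Prod>i\<in>I. h i (bud_weight \<beta> \<epsilon> \<omega> i)) \<partial>tree_measure \<xi>)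
    = (\<integral>\<^sup>+\<omega>. (\<Prod>i\<in>I. ennreal (h i (bud_weight \<beta> \<epsilon> \<omega> i))) \<partial>tree_measure \<xi>)"
    by (intro nn_integral_cong prod_ennreal[symmetric] nn)
  also have "\<dots> = (\<Prod>i\<in>I. bud_nn \<xi> \<beta> \<epsilon> (\<lambda>x. ennreal (h i x)))"
    by (rule nn_integral_bud_prod[OF I, of "\<lambda>i x. ennreal (h i x)"]) (use h(1) in measurable)
  also have "\<dots> = (\<Prod>i\<in>I. ennreal (c i))" by (intro prod.cong refl c(2))
  also have "\<dots> = ennreal (\<Prod>i\<in>I. c i)" by (intro prod_ennreal c(1))
  finally show "(\<integral>\<^sup>+\<omega>. ennreal (\<Prod>i\<in>I. h i (bud_weight \<beta> \<epsilon> \<omega> i)) \<partial>tree_measure \<xi>) = ennreal (\<Prod>i\<in>I. c i)" .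
qed

subsection \<open>Size-biased offspring\<close>

context subcritical_walk
begin

lemma pmf_size_biased: "pmf (size_biased \<xi>) k = real k * pmf \<xi> k / \<mu>"
  unfolding size_biased_def
proof (rule pmf_embed_pmf)
  show "0 \<le> real k * pmf \<xi> k / \<mu>" for k using mean_pos by simp
  have "(\<integral>\<^sup>+k. ennreal (real k * pmf \<xi> k / \<mu>) \<partial>count_space UNIV)
    = (\<integral>\<^sup>+k. ennreal (pmf \<xi> k) * ennreal (real k / \<mu>) \<partial>count_space UNIV)"
    using mean_pos by (intro nn_integral_cong) (simp add: ennreal_mult[symmetric] mult_ac)
  also have "\<dots> = (\<integral>\<^sup>+k. ennreal (real k / \<mu>) \<partial>measure_pmf \<xi>)"
    by (rule nn_integral_measure_pmf[symmetric])
  also have "\<dots> = ennreal (\<integral>k. real k / \<mu> \<partial>measure_pmf \<xi>)"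
    using integrable_offspring mean_pos by (intro nn_integral_eq_integral) auto
  also have "(\<integral>k. real k / \<mu> \<partial>measure_pmf \<xi>) = 1"
    using mean_pos by (simp add: mean_off_def)
  finally show "(\<integral>\<^sup>+k. ennreal (real k * pmf \<xi> k / \<mu>) \<partial>count_space UNIV) = 1" by simp
qed

text \<open>Size-biasing costs one moment: the second moment of \<xi> yields just the mean of this
  law.\<close>

lemma integrable_size_biased: "integrable (measure_pmf (size_biased \<xi>)) real"
proof -
  have "(\<integral>\<^sup>+k. ennreal (real k) \<partial>measure_pmf (size_biased \<xi>))
    = (\<integral>\<^sup>+k. ennreal (pmf \<xi> k) * ennreal ((real k)\<^sup>2 / \<mu>) \<partial>count_space UNIV)"
    unfolding nn_integral_measure_pmf pmf_size_biased using mean_pos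
    by (intro nn_integral_cong) (simp add: ennreal_mult[symmetric] power2_eq_square mult_ac)
  also have "\<dots> = (\<integral>\<^sup>+k. ennreal ((real k)\<^sup>2 / \<mu>) \<partial>measure_pmf \<xi>)"
    by (rule nn_integral_measure_pmf[symmetric])
  also have "\<dots> = ennreal (\<integral>k. (real k)\<^sup>2 / \<mu> \<partial>measure_pmf \<xi>)"
    using second_moment mean_pos by (intro nn_integral_eq_integral) auto
  also have "\<dots> < \<infinity>" by simp
  finally show ?thesis by (intro integrableI_nonneg) auto
qed

lemma set_spine_pmf: "x \<in> set_pmf (spine_pmf \<xi>) \<Longrightarrow> snd x < fst x"
proof -
  assume x: "x \<in> set_pmf (spine_pmf \<xi>)"
  then obtain k where k: "k \<in> set_pmf (size_biased \<xi>)" "x \<in> Pair k ` set_pmf (pmf_of_set {..<k})"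
    by (auto simp: spine_pmf_def)
  have "k \<noteq> 0" using k(1) by (auto simp: set_pmf_iff pmf_size_biased)
  then have "set_pmf (pmf_of_set {..<k}) = {..<k}" by (intro set_pmf_of_set) auto
  then have "x \<in> Pair k ` {..<k}" using k(2) by (simp only:)
  then show ?thesis by (elim imageE) simp
qed

lemma integrable_spine_degree: "integrable (measure_pmf (spine_pmf \<xi>)) (\<lambda>x. real (fst x))"
proof -
  have "map_pmf fst (spine_pmf \<xi>) = size_biased \<xi>"
    by (simp add: spine_pmf_def map_bind_pmf map_pmf_comp bind_return_pmf')
  then show ?thesis using integrable_size_biased integrable_map_pmf_eq[of fst "spine_pmf \<xi>" real] by simp
qed

definition buds where "buds = measure_pmf.expectation (spine_pmf \<xi>) (\<lambda>x. real (fst x) - 1)"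

lemma AE_spine_data: "AE \<omega> in tree_measure \<xi>. \<forall>i. snd (fst \<omega> i) < fst (fst \<omega> i)"
  unfolding AE_all_countable
proof
  fix i :: nat
  interpret A: prob_space "iid (spine_pmf \<xi>) :: (nat \<Rightarrow> nat \<times> nat) measure" by (rule prob_space_iid)
  interpret S: prob_space "iid \<xi> :: (nat list \<Rightarrow> nat) measure" by (rule prob_space_iid)
  interpret pair_prob_space "iid (spine_pmf \<xi>) :: (nat \<Rightarrow> nat \<times> nat) measure" "iid \<xi> :: (nat list \<Rightarrow> nat) measure" ..
  have "AE a in iid (spine_pmf \<xi>). snd (a i) < fst (a i)"
    by (rule AE_PiM_component[where P="\<lambda>x. snd x < fst x"])
      (auto intro: prob_space_measure_pmf AE_pmfI set_spine_pmf)
  moreover have "{\<omega> \<in> space (iid (spine_pmf \<xi>) \<Otimes>\<^sub>M iid \<xi>). snd (fst \<omega> i) < fst (fst \<omega> i)}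
    \<in> sets (iid (spine_pmf \<xi>) \<Otimes>\<^sub>M iid \<xi>)"
  proof -
    have "(\<lambda>\<omega>. fst \<omega> i) \<in> iid (spine_pmf \<xi>) \<Otimes>\<^sub>M iid \<xi> \<rightarrow>\<^sub>M count_space UNIV" by measurable
    then have "Measurable.pred (iid (spine_pmf \<xi>) \<Otimes>\<^sub>M iid \<xi>) (\<lambda>\<omega>. snd (fst \<omega> i) < fst (fst \<omega> i))"
      by (rule measurable_compose[where g="\<lambda>x. snd x < fst x"]) simp
    then show ?thesis by (simp add: pred_def)
  qed
  ultimately show "AE \<omega> in tree_measure \<xi>. snd (fst \<omega> i) < fst (fst \<omega> i)"
    unfolding tree_measure_eq by (intro AE_pair_measure) auto
qed

lemma bud_at_nonneg: "0 < \<epsilon> \<Longrightarrow> 0 \<le> bud_at \<beta> \<epsilon> x r s"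
  unfolding bud_at_def using trap_bounds[OF bias_gt1] bias_gt1
  by (intro add_nonneg_nonneg mult_nonneg_nonneg sum_nonneg) auto

lemma bud_nn_bounded:
  assumes \<epsilon>: "0 < \<epsilon>" and [measurable]: "h \<in> borel_measurable borel"
    and h: "\<And>x. 0 \<le> x \<Longrightarrow> 0 \<le> h x" "\<And>x. 0 \<le> x \<Longrightarrow> h x \<le> 1"
  shows "bud_nn \<xi> \<beta> \<epsilon> (\<lambda>x. ennreal (h x)) = ennreal (\<integral>x. (\<integral>s. h (bud_at \<beta> \<epsilon> x [] s) \<partial>iid \<xi>) \<partial>spine_pmf \<xi>)"
    and "0 \<le> (\<integral>s. h (bud_at \<beta> \<epsilon> x [] s) \<partial>iid \<xi>)" "(\<integral>s. h (bud_at \<beta> \<epsilon> x [] s) \<partial>iid \<xi>) \<le> 1"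
    and "integrable (spine_pmf \<xi>) (\<lambda>x. \<integral>s. h (bud_at \<beta> \<epsilon> x [] s) \<partial>iid \<xi>)"
    and "integrable (iid \<xi>) (\<lambda>s. h (bud_at \<beta> \<epsilon> x [] s))"
proof -
  interpret S: prob_space "iid \<xi> :: (nat list \<Rightarrow> nat) measure" by (rule prob_space_iid)
  note hb = h[OF bud_at_nonneg[OF \<epsilon>]]
  have i: "integrable (iid \<xi>) (\<lambda>s. h (bud_at \<beta> \<epsilon> x [] s))" for x
    by (rule S.integrable_const_bound[where B=1]) (use hb in auto)
  then show "integrable (iid \<xi>) (\<lambda>s. h (bud_at \<beta> \<epsilon> x [] s))" .
  have b: "0 \<le> (\<integral>s. h (bud_at \<beta> \<epsilon> x [] s) \<partial>iid \<xi>)" "(\<integral>s. h (bud_at \<beta> \<epsilon> x [] s) \<partial>iid \<xi>) \<le> 1" for x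
    by (intro Bochner_Integration.integral_nonneg hb) (intro S.integral_le_const i AE_I2 hb)
  then show "0 \<le> (\<integral>s. h (bud_at \<beta> \<epsilon> x [] s) \<partial>iid \<xi>)" "(\<integral>s. h (bud_at \<beta> \<epsilon> x [] s) \<partial>iid \<xi>) \<le> 1" by auto
  show i2: "integrable (spine_pmf \<xi>) (\<lambda>x. \<integral>s. h (bud_at \<beta> \<epsilon> x [] s) \<partial>iid \<xi>)"
    by (rule measure_pmf.integrable_const_bound[where B=1]) (use b in auto)
  have "bud_nn \<xi> \<beta> \<epsilon> (\<lambda>x. ennreal (h x)) = (\<integral>\<^sup>+x. ennreal (\<integral>s. h (bud_at \<beta> \<epsilon> x [] s) \<partial>iid \<xi>) \<partial>spine_pmf \<xi>)"
    unfolding bud_nn_def by (intro nn_integral_cong nn_integral_eq_integral i AE_I2 hb)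
  also have "\<dots> = ennreal (\<integral>x. (\<integral>s. h (bud_at \<beta> \<epsilon> x [] s) \<partial>iid \<xi>) \<partial>spine_pmf \<xi>)"
    by (intro nn_integral_eq_integral i2 AE_I2 b)
  finally show "bud_nn \<xi> \<beta> \<epsilon> (\<lambda>x. ennreal (h x)) = ennreal (\<integral>x. (\<integral>s. h (bud_at \<beta> \<epsilon> x [] s) \<partial>iid \<xi>) \<partial>spine_pmf \<xi>)" .
qed

section \<open>The expected loss per special vertex\<close>

definition slow_rate :: "real \<Rightarrow> real" where
  "slow_rate \<epsilon> = (\<integral>x. (\<integral>s. satur \<kappa> (bud_at \<beta> \<epsilon> x [] s) \<partial>iid \<xi>) \<partial>spine_pmf \<xi>)"

lemma bud_nn_satur:
  assumes \<epsilon>: "0 < \<epsilon>"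
  shows "bud_nn \<xi> \<beta> \<epsilon> (\<lambda>x. ennreal (satur \<kappa> x)) = ennreal (slow_rate \<epsilon>)"
    and "bud_nn \<xi> \<beta> \<epsilon> (\<lambda>x. ennreal (1 / (1 + \<kappa> * x))) = ennreal (1 - slow_rate \<epsilon>)"
    and "0 \<le> slow_rate \<epsilon>" "slow_rate \<epsilon> \<le> 1"
proof -
  interpret S: prob_space "iid \<xi> :: (nat list \<Rightarrow> nat) measure" by (rule prob_space_iid)
  have k: "0 \<le> \<kappa>" using kappa_pos by simp
  note B = bud_nn_bounded[OF \<epsilon> borel_measurable_satur[of \<kappa>] satur_bounds(1,2)[OF k]]
  show "bud_nn \<xi> \<beta> \<epsilon> (\<lambda>x. ennreal (satur \<kappa> x)) = ennreal (slow_rate \<epsilon>)"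
    unfolding slow_rate_def by (rule B(1))
  show "0 \<le> slow_rate \<epsilon>" unfolding slow_rate_def
    by (intro Bochner_Integration.integral_nonneg B(2))
  show "slow_rate \<epsilon> \<le> 1" unfolding slow_rate_def
    by (intro measure_pmf.integral_le_const B(4) AE_I2 B(3))
  have "bud_nn \<xi> \<beta> \<epsilon> (\<lambda>x. ennreal (1 / (1 + \<kappa> * x)))
    = ennreal (\<integral>x. (\<integral>s. 1 / (1 + \<kappa> * bud_at \<beta> \<epsilon> x [] s) \<partial>iid \<xi>) \<partial>spine_pmf \<xi>)"
    using k by (intro bud_nn_bounded(1)[OF \<epsilon>]) (auto simp: divide_le_eq)
  also have "(\<integral>x. (\<integral>s. 1 / (1 + \<kappa> * bud_at \<beta> \<epsilon> x [] s) \<partial>iid \<xi>) \<partial>spine_pmf \<xi>) = 1 - slow_rate \<epsilon>"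
  proof -
    have "1 / (1 + \<kappa> * bud_at \<beta> \<epsilon> x [] s) = 1 - satur \<kappa> (bud_at \<beta> \<epsilon> x [] s)" for x s
      using one_minus_satur[OF k bud_at_nonneg[OF \<epsilon>]] by simp
    then show ?thesis using B(4,5) S.prob_space by (simp add: slow_rate_def)
  qed
  finally show "bud_nn \<xi> \<beta> \<epsilon> (\<lambda>x. ennreal (1 / (1 + \<kappa> * x))) = ennreal (1 - slow_rate \<epsilon>)" .
qed

lemma level_mean_0: "level_mean 0 \<epsilon> = trap_mean \<xi> \<beta> \<epsilon> (\<kappa> * 1) (\<kappa> * 1)"
  by (simp add: level_mean_def)

text \<open>The bounds for sums of traps are averaged over the special degree. The
  \<open>min\<close> survives the averaging on purpose: the square of a size-biased degree need not
  be integrable, while the truncated product is dominated by the degree minus one.\<close>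

lemma slow_rate_bounds:
  assumes \<epsilon>: "0 < \<epsilon>"
  defines "f \<equiv> level_mean 0 \<epsilon>"
  shows "slow_rate \<epsilon> \<le> \<kappa> * \<epsilon> * (1 / \<beta> + buds + 1) + buds * f"
    and "buds * f - f * (\<integral>x. (real (fst x) - 1) * min 1 (real (fst x) * f) \<partial>spine_pmf \<xi>) \<le> slow_rate \<epsilon>"
proof -
  interpret S: prob_space "iid \<xi> :: (nat list \<Rightarrow> nat) measure" by (rule prob_space_iid)
  have k: "0 \<le> \<kappa>" using kappa_pos by simp
  have f0: "0 \<le> f" unfolding f_def by (rule level_mean_bounds[OF \<epsilon>])
  note B = bud_nn_bounded[OF \<epsilon> borel_measurable_satur[of \<kappa>] satur_bounds(1,2)[OF k]]
  define g where "g x = (\<integral>s. satur \<kappa> (bud_at \<beta> \<epsilon> x [] s) \<partial>iid \<xi>)" for x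
  have disj: "subtree [i] \<inter> subtree [j] = {}" if "i \<noteq> j" for i j
    by (rule subtree_disjoint) (use that in auto)
  have e: "0 \<le> \<epsilon> * (1 / \<beta> + real (fst x))" for x :: "nat \<times> nat" using \<epsilon> bias_gt1 by simp
  have ge: "g x = (\<integral>s. lft \<kappa> \<kappa> (\<epsilon> * (1 / \<beta> + real (fst x)) + (\<Sum>j\<in>{..<fst x} - {snd x}. 1 * trap \<beta> \<epsilon> s [j])) \<partial>iid \<xi>)" for x
    by (simp add: g_def bud_at_def satur_eq_lft)
  have card: "real (card ({..<fst x} - {snd x})) = real (fst x) - 1" if "x \<in> set_pmf (spine_pmf \<xi>)" for x
    using set_spine_pmf[OF that] by (simp add: of_nat_diff)
  have U: "g x \<le> \<kappa> * (\<epsilon> * (1 / \<beta> + real (fst x))) + (real (fst x) - 1) * f" if "x \<in> set_pmf (spine_pmf \<xi>)" for x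
    using trap_sum_upper[OF bias_gt1 \<epsilon> kappa_pos kappa_pos zero_less_one e, of "{..<fst x} - {snd x}" "\<lambda>j. [j]" \<xi> x] disj
    unfolding ge[symmetric] card[OF that] f_def level_mean_0 by auto
  have Lo: "(real (fst x) - 1) * f - (real (fst x) - 1) * min 1 (real (fst x) * f) * f \<le> g x" if x: "x \<in> set_pmf (spine_pmf \<xi>)" for x
  proof -
    have d: "0 \<le> real (fst x) - 1" using set_spine_pmf[OF x] by simp
    have "(real (fst x) - 1) * f - (real (fst x) - 1) * f * min 1 (\<kappa> / \<kappa> * (real (fst x) - 1) * f) \<le> g x"
      using trap_sum_lower[OF bias_gt1 \<epsilon> kappa_pos kappa_pos zero_less_one e, of "{..<fst x} - {snd x}" "\<lambda>j. [j]" \<xi> x] disj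
      unfolding ge[symmetric] card[OF x] f_def level_mean_0 by auto
    moreover have "(real (fst x) - 1) * f * min 1 (\<kappa> / \<kappa> * (real (fst x) - 1) * f) \<le> (real (fst x) - 1) * f * min 1 (real (fst x) * f)"
      using d f0 kappa_pos by (intro mult_left_mono min.mono mult_right_mono) auto
    ultimately show ?thesis by (simp add: mult_ac)
  qed
  have gi: "integrable (spine_pmf \<xi>) g" unfolding g_def[abs_def] by (rule B(4))
  have sg: "slow_rate \<epsilon> = (\<integral>x. g x \<partial>spine_pmf \<xi>)" by (simp add: slow_rate_def g_def)
  have D: "(\<integral>x. real (fst x) \<partial>spine_pmf \<xi>) = buds + 1"
    using integrable_spine_degree by (simp add: buds_def)
  have "slow_rate \<epsilon> \<le> (\<integral>x. \<kappa> * (\<epsilon> * (1 / \<beta> + real (fst x))) + (real (fst x) - 1) * f \<partial>spine_pmf \<xi>)"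
    unfolding sg using integrable_spine_degree by (intro integral_mono_AE gi AE_pmfI U) auto
  also have "\<dots> = \<kappa> * \<epsilon> * (1 / \<beta> + buds + 1) + buds * f"
    using integrable_spine_degree D by (simp add: algebra_simps)
  finally show "slow_rate \<epsilon> \<le> \<kappa> * \<epsilon> * (1 / \<beta> + buds + 1) + buds * f" .
  have mi: "integrable (spine_pmf \<xi>) (\<lambda>x. (real (fst x) - 1) * min 1 (real (fst x) * f))"
  proof (rule Bochner_Integration.integrable_bound)
    show "integrable (spine_pmf \<xi>) (\<lambda>x. real (fst x) - 1)" using integrable_spine_degree by simp
    show "AE x in spine_pmf \<xi>. norm ((real (fst x) - 1) * min 1 (real (fst x) * f)) \<le> norm (real (fst x) - 1)"
      using f0 by (intro AE_I2) (auto simp: abs_mult intro!: mult_left_le)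
  qed simp
  have "buds * f - f * (\<integral>x. (real (fst x) - 1) * min 1 (real (fst x) * f) \<partial>spine_pmf \<xi>)
    = (\<integral>x. (real (fst x) - 1) * f - (real (fst x) - 1) * min 1 (real (fst x) * f) * f \<partial>spine_pmf \<xi>)"
    using integrable_spine_degree mi by (simp add: buds_def mult.commute)
  also have "\<dots> \<le> slow_rate \<epsilon>"
    unfolding sg using integrable_spine_degree mi by (intro integral_mono_AE gi AE_pmfI Lo) auto
  finally show "buds * f - f * (\<integral>x. (real (fst x) - 1) * min 1 (real (fst x) * f) \<partial>spine_pmf \<xi>) \<le> slow_rate \<epsilon>" .
qed

lemma buds_nonneg: "0 \<le> buds"
  unfolding buds_def
proof (intro integral_nonneg_AE AE_pmfI)
  show "0 \<le> real (fst x) - 1" if "x \<in> set_pmf (spine_pmf \<xi>)" for x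
    using set_spine_pmf[OF that] by simp
qed

text \<open>Direct killing is of order \<beta>^(-k), the loss caused by traps of order \<mu>^k;
  \<mu>\<beta> > 1 separates the two scales.\<close>

lemma eps_over_mean_tendsto:
  assumes e: "\<And>k. 0 < \<epsilon> k" and lim: "(\<lambda>k. \<epsilon> k * \<beta> ^ k) \<longlonglongrightarrow> \<sigma>"
  shows "(\<lambda>k. \<epsilon> k / \<mu> ^ k) \<longlonglongrightarrow> 0"
proof -
  have "(\<lambda>k. (\<epsilon> k * \<beta> ^ k) * (1 / (\<mu> * \<beta>)) ^ k) \<longlonglongrightarrow> \<sigma> * 0"
    using bias_mean by (intro tendsto_mult lim LIMSEQ_power_zero) simp
  moreover have "(\<epsilon> k * \<beta> ^ k) * (1 / (\<mu> * \<beta>)) ^ k = \<epsilon> k / \<mu> ^ k" for k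
    using bias_gt1 mean_pos by (simp add: power_divide power_mult_distrib)
  ultimately show ?thesis by simp
qed

text \<open>On the scale \<open>\<mu> ^ k\<close> the direct killing vanishes, and so does the
  correction \<open>R\<close>, by dominated convergence as \<open>f\<close> tends to 0. What is left
  is one trap rate for each of the \<open>buds\<close> expected normal children.\<close>

lemma slow_rate_limit:
  assumes e: "\<And>k. 0 < \<epsilon> k" and lim: "(\<lambda>k. \<epsilon> k * \<beta> ^ k) \<longlonglongrightarrow> \<sigma>" and \<sigma>: "0 < \<sigma>"
  shows "(\<lambda>k. slow_rate (\<epsilon> k) / \<mu> ^ k) \<longlonglongrightarrow> buds * trap_rate \<sigma>"
proof (rule tendsto_sandwich)
  define f where "f k = level_mean 0 (\<epsilon> k)" for k
  define R where "R k = (\<integral>x. (real (fst x) - 1) * min 1 (real (fst x) * f k) \<partial>spine_pmf \<xi>)" for k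
  have f: "(\<lambda>k. f k / \<mu> ^ k) \<longlonglongrightarrow> trap_rate \<sigma>" unfolding f_def by (rule trap_rate_limit[OF e lim \<sigma>])
  have f0: "f \<longlonglongrightarrow> 0" unfolding f_def by (rule level_mean_0_tendsto[OF e lim \<sigma>])
  have fnn: "0 \<le> f k" for k unfolding f_def by (rule level_mean_bounds[OF e])
  have "R \<longlonglongrightarrow> (\<integral>x. 0 \<partial>measure_pmf (spine_pmf \<xi>))" unfolding R_def
  proof (rule integral_dominated_convergence[where w="\<lambda>x. \<bar>real (fst x) - 1\<bar>"])
    show "integrable (spine_pmf \<xi>) (\<lambda>x. \<bar>real (fst x) - 1\<bar>)" using integrable_spine_degree by simp
    show "AE x in spine_pmf \<xi>. norm ((real (fst x) - 1) * min 1 (real (fst x) * f k)) \<le> \<bar>real (fst x) - 1\<bar>" for k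
      using fnn by (intro AE_I2) (auto simp: abs_mult intro!: mult_left_le)
    have "(\<lambda>k. (real (fst x) - 1) * min 1 (real (fst x) * f k)) \<longlonglongrightarrow> (real (fst x) - 1) * min 1 (real (fst x) * 0)" for x :: "nat \<times> nat"
      by (intro tendsto_intros f0)
    then show "AE x in spine_pmf \<xi>. (\<lambda>k. (real (fst x) - 1) * min 1 (real (fst x) * f k)) \<longlonglongrightarrow> 0"
      by (intro AE_I2) simp
  qed auto
  then have R0: "R \<longlonglongrightarrow> 0" by simp
  have "(\<lambda>k. buds * (f k / \<mu> ^ k) - f k / \<mu> ^ k * R k) \<longlonglongrightarrow> buds * trap_rate \<sigma> - trap_rate \<sigma> * 0"
    by (intro tendsto_intros f R0)
  then show "(\<lambda>k. buds * (f k / \<mu> ^ k) - f k / \<mu> ^ k * R k) \<longlonglongrightarrow> buds * trap_rate \<sigma>" by simp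
  have "(\<lambda>k. \<kappa> * (\<epsilon> k / \<mu> ^ k) * (1 / \<beta> + buds + 1) + buds * (f k / \<mu> ^ k)) \<longlonglongrightarrow> \<kappa> * 0 * (1 / \<beta> + buds + 1) + buds * trap_rate \<sigma>"
    by (intro tendsto_intros f eps_over_mean_tendsto[OF e lim])
  then show "(\<lambda>k. \<kappa> * (\<epsilon> k / \<mu> ^ k) * (1 / \<beta> + buds + 1) + buds * (f k / \<mu> ^ k)) \<longlonglongrightarrow> buds * trap_rate \<sigma>" by simp
  have pk: "0 < \<mu> ^ k" for k using mean_pos by simp
  show "\<forall>\<^sub>F k in sequentially. slow_rate (\<epsilon> k) / \<mu> ^ k \<le> \<kappa> * (\<epsilon> k / \<mu> ^ k) * (1 / \<beta> + buds + 1) + buds * (f k / \<mu> ^ k)"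
  proof (intro always_eventually allI)
    fix k
    show "slow_rate (\<epsilon> k) / \<mu> ^ k \<le> \<kappa> * (\<epsilon> k / \<mu> ^ k) * (1 / \<beta> + buds + 1) + buds * (f k / \<mu> ^ k)"
      using divide_right_mono[OF slow_rate_bounds(1)[OF e[of k]] less_imp_le[OF pk[of k]]]
      by (simp add: f_def add_divide_distrib)
  qed
  show "\<forall>\<^sub>F k in sequentially. buds * (f k / \<mu> ^ k) - f k / \<mu> ^ k * R k \<le> slow_rate (\<epsilon> k) / \<mu> ^ k"
  proof (intro always_eventually allI)
    fix k
    show "buds * (f k / \<mu> ^ k) - f k / \<mu> ^ k * R k \<le> slow_rate (\<epsilon> k) / \<mu> ^ k"
      using divide_right_mono[OF slow_rate_bounds(2)[OF e[of k]] less_imp_le[OF pk[of k]]]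
      by (simp add: f_def R_def diff_divide_distrib)
  qed
qed

lemma slow_rate_tendsto_0:
  assumes e: "\<And>k. 0 < \<epsilon> k" and lim: "(\<lambda>k. \<epsilon> k * \<beta> ^ k) \<longlonglongrightarrow> \<sigma>" and \<sigma>: "0 < \<sigma>"
  shows "(\<lambda>k. slow_rate (\<epsilon> k)) \<longlonglongrightarrow> 0"
proof -
  have "(\<lambda>k. slow_rate (\<epsilon> k) / \<mu> ^ k * \<mu> ^ k) \<longlonglongrightarrow> buds * trap_rate \<sigma> * 0"
    using mean_pos mean_lt1 by (intro tendsto_mult slow_rate_limit[OF e lim \<sigma>] LIMSEQ_power_zero) auto
  then show ?thesis using mean_pos by simp
qed

text \<open>The mean of a weight without saturation. It occurs only in error terms, as a factor in
  front of bounded quantities, so it suffices that it tends to 0 at any speed.\<close>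

definition weight_mean :: "real \<Rightarrow> real" where
  "weight_mean \<epsilon> = \<epsilon> * (1 / \<beta> + buds + 1) + buds * (\<integral>s. trap \<beta> \<epsilon> s [] \<partial>iid \<xi>)"

lemma weight_mean_nonneg: "0 < \<epsilon> \<Longrightarrow> 0 \<le> weight_mean \<epsilon>"
  unfolding weight_mean_def using buds_nonneg bias_gt1 trap_bounds[OF bias_gt1]
  by (intro add_nonneg_nonneg mult_nonneg_nonneg Bochner_Integration.integral_nonneg) auto

lemma bud_nn_id:
  assumes \<epsilon>: "0 < \<epsilon>"
  shows "bud_nn \<xi> \<beta> \<epsilon> (\<lambda>x. ennreal x) = ennreal (weight_mean \<epsilon>)"
proof -
  interpret S: prob_space "iid \<xi> :: (nat list \<Rightarrow> nat) measure" by (rule prob_space_iid)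
  define p where "p = (\<integral>s. trap \<beta> \<epsilon> s [] \<partial>iid \<xi>)"
  note tb = trap_bounds[OF bias_gt1 \<epsilon>]
  have ti: "integrable (iid \<xi>) (\<lambda>s. trap \<beta> \<epsilon> s v)" for v
    by (rule S.integrable_const_bound[where B=1]) (use tb in auto)
  have tm: "(\<integral>s. trap \<beta> \<epsilon> s v \<partial>iid \<xi>) = p" for v
    unfolding p_def by (rule integral_trap_shift) simp
  have bi: "integrable (iid \<xi>) (bud_at \<beta> \<epsilon> x [])" for x
    unfolding bud_at_def[abs_def] by (intro Bochner_Integration.integrable_add Bochner_Integration.integrable_sum ti) simp
  have bm: "(\<integral>s. bud_at \<beta> \<epsilon> x [] s \<partial>iid \<xi>) = \<epsilon> * (1 / \<beta> + real (fst x)) + real (card ({..<fst x} - {snd x})) * p" for x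
    unfolding bud_at_def using S.prob_space
    by (subst Bochner_Integration.integral_add) (auto intro!: Bochner_Integration.integrable_sum ti simp: ti tm)
  have card: "real (card ({..<fst x} - {snd x})) = real (fst x) - 1" if "x \<in> set_pmf (spine_pmf \<xi>)" for x
    using set_spine_pmf[OF that] by (simp add: of_nat_diff)
  have p0: "0 \<le> p" unfolding p_def using tb by (intro Bochner_Integration.integral_nonneg) auto
  have "bud_nn \<xi> \<beta> \<epsilon> (\<lambda>x. ennreal x) = (\<integral>\<^sup>+x. ennreal (\<integral>s. bud_at \<beta> \<epsilon> x [] s \<partial>iid \<xi>) \<partial>spine_pmf \<xi>)"
    unfolding bud_nn_def by (intro nn_integral_cong nn_integral_eq_integral bi AE_I2 bud_at_nonneg \<epsilon>)
  also have "\<dots> = (\<integral>\<^sup>+x. ennreal (\<epsilon> * (1 / \<beta> + real (fst x)) + (real (fst x) - 1) * p) \<partial>spine_pmf \<xi>)"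
    by (intro nn_integral_cong_AE AE_pmfI) (simp add: bm card)
  also have "\<dots> = ennreal (\<integral>x. \<epsilon> * (1 / \<beta> + real (fst x)) + (real (fst x) - 1) * p \<partial>spine_pmf \<xi>)"
  proof (rule nn_integral_eq_integral)
    show "integrable (spine_pmf \<xi>) (\<lambda>x. \<epsilon> * (1 / \<beta> + real (fst x)) + (real (fst x) - 1) * p)"
      using integrable_spine_degree by simp
    show "AE x in spine_pmf \<xi>. 0 \<le> \<epsilon> * (1 / \<beta> + real (fst x)) + (real (fst x) - 1) * p"
    proof (rule AE_pmfI)
      fix x assume "x \<in> set_pmf (spine_pmf \<xi>)"
      then show "0 \<le> \<epsilon> * (1 / \<beta> + real (fst x)) + (real (fst x) - 1) * p"
        using set_spine_pmf[of x] \<epsilon> bias_gt1 p0 by (intro add_nonneg_nonneg mult_nonneg_nonneg) auto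
    qed
  qed
  also have "(\<integral>x. \<epsilon> * (1 / \<beta> + real (fst x)) + (real (fst x) - 1) * p \<partial>spine_pmf \<xi>) = weight_mean \<epsilon>"
    using integrable_spine_degree by (simp add: weight_mean_def buds_def p_def algebra_simps)
  finally show ?thesis .
qed

lemma weight_mean_tendsto_0:
  assumes e: "\<And>k. 0 < \<epsilon> k" and lim: "(\<lambda>k. \<epsilon> k * \<beta> ^ k) \<longlonglongrightarrow> \<sigma>" and \<sigma>: "0 < \<sigma>"
  shows "(\<lambda>k. weight_mean (\<epsilon> k)) \<longlonglongrightarrow> 0"
proof (rule tendsto_sandwich)
  interpret S: prob_space "iid \<xi> :: (nat list \<Rightarrow> nat) measure" by (rule prob_space_iid)
  show "(\<lambda>k. 0 :: real) \<longlonglongrightarrow> 0" by simp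
  show "\<forall>\<^sub>F k in sequentially. 0 \<le> weight_mean (\<epsilon> k)"
    using weight_mean_nonneg[OF e] by simp
  have "(\<lambda>k. \<epsilon> k / \<mu> ^ k * \<mu> ^ k) \<longlonglongrightarrow> 0 * 0"
    using mean_pos mean_lt1 by (intro tendsto_mult eps_over_mean_tendsto[OF e lim] LIMSEQ_power_zero) auto
  then have e0: "\<epsilon> \<longlonglongrightarrow> 0" using mean_pos by simp
  have "(\<lambda>k. \<epsilon> k * (1 / \<beta> + buds + 1) + buds * ((1 + \<kappa>) / \<kappa> * level_mean 0 (\<epsilon> k))) \<longlonglongrightarrow> 0 * (1 / \<beta> + buds + 1) + buds * ((1 + \<kappa>) / \<kappa> * 0)"
    by (intro tendsto_add tendsto_mult tendsto_const e0 level_mean_0_tendsto[OF e lim \<sigma>])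
  then show "(\<lambda>k. \<epsilon> k * (1 / \<beta> + buds + 1) + buds * ((1 + \<kappa>) / \<kappa> * level_mean 0 (\<epsilon> k))) \<longlonglongrightarrow> 0" by simp
  have "(\<integral>s. trap \<beta> (\<epsilon> k) s [] \<partial>iid \<xi>) \<le> (1 + \<kappa>) / \<kappa> * level_mean 0 (\<epsilon> k)" for k
  proof -
    note tb = trap_bounds[OF bias_gt1 e[of k]]
    \<comment> \<open>On the unit interval \<open>lft \<kappa> \<kappa>\<close> is bounded below by
      a multiple of the identity, so mean trap values inherit the decay of
      \<open>level_mean 0\<close>.\<close>
    have "trap \<beta> (\<epsilon> k) s [] \<le> (1 + \<kappa>) / \<kappa> * lft \<kappa> \<kappa> (trap \<beta> (\<epsilon> k) s [])" for s
    proof -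
      define p where "p = trap \<beta> (\<epsilon> k) s []"
      have p: "0 \<le> p" "p \<le> 1" unfolding p_def by (rule tb)+
      have kp: "\<kappa> * p \<le> \<kappa>" "0 \<le> \<kappa> * p" using p kappa_pos by auto
      have "p * (1 + \<kappa> * p) \<le> p * (1 + \<kappa>)" using p kp by (intro mult_left_mono) auto
      then have "p \<le> p * (1 + \<kappa>) / (1 + \<kappa> * p)" using kp by (subst pos_le_divide_eq) auto
      also have "\<dots> = (1 + \<kappa>) / \<kappa> * lft \<kappa> \<kappa> p" using kappa_pos by (simp add: lft_def)
      finally show ?thesis by (simp add: p_def)
    qed
    moreover have "integrable (iid \<xi>) (\<lambda>s. trap \<beta> (\<epsilon> k) s [])"
      by (rule S.integrable_const_bound[where B=1]) (use tb in auto)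
    moreover have li: "integrable (iid \<xi>) (\<lambda>s. lft \<kappa> \<kappa> (trap \<beta> (\<epsilon> k) s []))"
      using lft_nonneg[OF kappa_pos kappa_pos tb(1)] lft_le[OF kappa_pos kappa_pos tb(1)]
      by (intro S.integrable_const_bound[where B="\<kappa> / \<kappa>"]) auto
    ultimately have "(\<integral>s. trap \<beta> (\<epsilon> k) s [] \<partial>iid \<xi>) \<le> (\<integral>s. (1 + \<kappa>) / \<kappa> * lft \<kappa> \<kappa> (trap \<beta> (\<epsilon> k) s []) \<partial>iid \<xi>)"
      by (intro integral_mono integrable_mult_right)
    also have "\<dots> = (1 + \<kappa>) / \<kappa> * level_mean 0 (\<epsilon> k)"
      by (simp add: level_mean_0 trap_mean_def)
    finally show ?thesis .
  qed
  then show "\<forall>\<^sub>F k in sequentially. weight_mean (\<epsilon> k) \<le> \<epsilon> k * (1 / \<beta> + buds + 1) + buds * ((1 + \<kappa>) / \<kappa> * level_mean 0 (\<epsilon> k))"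
    unfolding weight_mean_def using buds_nonneg by (intro always_eventually allI add_left_mono mult_left_mono)
qed

end

lemma exp_minus_one_bounds:
  fixes y :: real
  assumes "0 \<le> y"
  shows "y \<le> exp y - 1" "exp y - 1 \<le> y * exp y"
proof -
  show "y \<le> exp y - 1" using exp_ge_add_one_self[of y] by linarith
  have "exp y * (1 - y) \<le> exp y * exp (- y)"
    using exp_ge_add_one_self[of "- y"] by (intro mult_left_mono) auto
  then show "exp y - 1 \<le> y * exp y" by (simp add: exp_minus algebra_simps)
qed

lemma sum_reversed_geometric_le:
  fixes r :: real
  assumes "0 \<le> r" "r < 1"
  shows "(\<Sum>j<i. r ^ (i - 1 - j)) \<le> 1 / (1 - r)"
proof -
  have "(\<Sum>j<i. r ^ (i - 1 - j)) = (\<Sum>j<i. r ^ (i - Suc j))" by simp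
  also have "\<dots> = (\<Sum>j<i. r ^ j)" by (rule sum.nat_diff_reindex)
  also have "\<dots> = (1 - r ^ i) / (1 - r)" using assms sum_gp_strict[of r i] by simp
  also have "\<dots> \<le> 1 / (1 - r)" using assms by (intro divide_right_mono) auto
  finally show ?thesis .
qed

context subcritical_walk
begin

subsection \<open>The annealed Laplace transform\<close>

definition annealed_hit :: "nat \<Rightarrow> nat \<Rightarrow> real" where
  "annealed_hit m n = (\<integral>\<omega>. quenched_hit \<beta> \<omega> m n \<partial>tree_measure \<xi>)"

definition annealed_laplace :: "nat \<Rightarrow> real \<Rightarrow> real" where
  "annealed_laplace m \<epsilon> = (1 - 1 / (1 + \<epsilon>)) * (\<Sum>n. annealed_hit m n * (1 / (1 + \<epsilon>)) ^ n)"

interpretation T: prob_space "tree_measure \<xi>" by (rule prob_space_tree_measure)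

lemma integrable_quenched_hit: "integrable (tree_measure \<xi>) (\<lambda>\<omega>. quenched_hit \<beta> \<omega> m n)"
  by (rule T.integrable_const_bound[where B=1]) (use quenched_hit_bounds in auto)

lemma annealed_hit_bounds: "0 \<le> annealed_hit m n" "annealed_hit m n \<le> 1"
  unfolding annealed_hit_def
  by (intro Bochner_Integration.integral_nonneg quenched_hit_bounds)
    (intro T.integral_le_const integrable_quenched_hit AE_I2 quenched_hit_bounds)

lemma annealed_hit_mono: "mono (annealed_hit m)"
  unfolding incseq_Suc_iff annealed_hit_def
  by (intro allI integral_mono integrable_quenched_hit quenched_hit_mono)

lemma annealed_laplace_integral:
  assumes \<epsilon>: "0 < \<epsilon>"
  defines "q \<equiv> 1 / (1 + \<epsilon>)"
  shows "has_bochner_integral (tree_measure \<xi>)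
    (\<lambda>\<omega>. (1 - q) * (\<Sum>n. quenched_hit \<beta> \<omega> m n * q ^ n)) (annealed_laplace m \<epsilon>)"
proof -
  have q: "0 < q" "q < 1" using \<epsilon> by (auto simp: q_def)
  note qb = quenched_hit_bounds[of \<beta> _ m]
  have i: "integrable (tree_measure \<xi>) (\<lambda>\<omega>. quenched_hit \<beta> \<omega> m n * q ^ n)" for n
    using integrable_quenched_hit by simp
  have s: "summable (\<lambda>n. quenched_hit \<beta> \<omega> m n * q ^ n)" for \<omega>
    by (rule sums_by_parts_geometric(1)[OF qb q])
  have n: "norm (quenched_hit \<beta> \<omega> m n * q ^ n) = quenched_hit \<beta> \<omega> m n * q ^ n" for \<omega> n
    using qb q by (simp add: abs_mult)
  have e: "(\<integral>\<omega>. quenched_hit \<beta> \<omega> m n * q ^ n \<partial>tree_measure \<xi>) = annealed_hit m n * q ^ n" for n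
    by (simp add: annealed_hit_def)
  have s2: "summable (\<lambda>n. \<integral>\<omega>. norm (quenched_hit \<beta> \<omega> m n * q ^ n) \<partial>tree_measure \<xi>)"
    unfolding n e by (rule sums_by_parts_geometric(1)[OF annealed_hit_bounds q])
  have AE: "AE \<omega> in tree_measure \<xi>. summable (\<lambda>n. norm (quenched_hit \<beta> \<omega> m n * q ^ n))"
    unfolding n using s by simp
  have "integrable (tree_measure \<xi>) (\<lambda>\<omega>. \<Sum>n. quenched_hit \<beta> \<omega> m n * q ^ n)"
    by (rule integrable_suminf[OF i AE s2])
  moreover have "(\<integral>\<omega>. (\<Sum>n. quenched_hit \<beta> \<omega> m n * q ^ n) \<partial>tree_measure \<xi>) = (\<Sum>n. annealed_hit m n * q ^ n)"
    unfolding integral_suminf[OF i AE s2] e ..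
  ultimately show ?thesis
    by (simp add: has_bochner_integral_iff annealed_laplace_def q_def)
qed

lemma quenched_laplace_lower:
  assumes \<epsilon>: "0 < \<epsilon>"
  shows "(\<Prod>i<m. 1 / (1 + \<kappa> * bud_weight \<beta> \<epsilon> \<omega> i)) \<le> 1 / perturbed \<beta> (root_weight \<beta> \<epsilon> \<omega>) m"
proof -
  note rw = root_weight_bounds[OF bias_gt1 \<epsilon>, of \<omega>]
  have "(\<Prod>i<m. 1 / (1 + \<kappa> * bud_weight \<beta> \<epsilon> \<omega> i)) \<le> (\<Prod>i<m. 1 / (1 + \<kappa> * root_weight \<beta> \<epsilon> \<omega> i))"
  proof (intro prod_mono conjI)
    fix i
    have b: "0 \<le> \<kappa> * bud_weight \<beta> \<epsilon> \<omega> i" "0 \<le> \<kappa> * root_weight \<beta> \<epsilon> \<omega> i"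
      using kappa_pos bud_weight_nonneg[OF bias_gt1 \<epsilon>] rw by auto
    then show "0 \<le> 1 / (1 + \<kappa> * bud_weight \<beta> \<epsilon> \<omega> i)" by simp
    have "\<kappa> * root_weight \<beta> \<epsilon> \<omega> i \<le> \<kappa> * bud_weight \<beta> \<epsilon> \<omega> i"
      using kappa_pos rw(2) by (intro mult_left_mono) auto
    then show "1 / (1 + \<kappa> * bud_weight \<beta> \<epsilon> \<omega> i) \<le> 1 / (1 + \<kappa> * root_weight \<beta> \<epsilon> \<omega> i)"
      using b by (intro divide_left_mono mult_pos_pos) auto
  qed
  also have "\<dots> \<le> 1 / perturbed \<beta> (root_weight \<beta> \<epsilon> \<omega>) m"
    using inverse_perturbed_ge[OF bias_gt1 rw(1)] by (simp add: \<kappa>_def)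
  finally show ?thesis .
qed

text \<open>The root weight lies below the bud weight, which is the wrong direction for the product;
  the root factor is therefore bounded by 1 and the product starts at index 1. Expanding the memory
  pairs each weight with the saturation at a strictly later index, ready for independence.\<close>

lemma quenched_laplace_upper:
  assumes \<epsilon>: "0 < \<epsilon>"
  defines "A \<equiv> bud_weight \<beta> \<epsilon>"
  shows "1 / perturbed \<beta> (root_weight \<beta> \<epsilon> \<omega>) m \<le> (\<Prod>i\<in>{1..<m}. 1 / (1 + \<kappa> * A \<omega> i))
    + (\<Sum>i<m. \<Sum>j<i. A \<omega> j * satur \<kappa> (A \<omega> i) * ((1 / \<beta>) ^ (i - 1 - j) / (\<beta> - 1)))
    + (\<Sum>j<m. A \<omega> j * ((1 / \<beta>) ^ (m - 1 - j) / (\<beta> - 1)))"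
proof -
  let ?A' = "root_weight \<beta> \<epsilon> \<omega>"
  note rw = root_weight_bounds[OF bias_gt1 \<epsilon>, of \<omega>]
  have A0: "0 \<le> A \<omega> i" for i unfolding A_def by (rule bud_weight_nonneg[OF bias_gt1 \<epsilon>])
  have k: "0 \<le> \<kappa>" using kappa_pos by simp
  have mem: "memory \<beta> ?A' i \<le> (\<Sum>j<i. A \<omega> j * ((1 / \<beta>) ^ (i - 1 - j) / (\<beta> - 1)))" for i
  proof -
    have "memory \<beta> ?A' i \<le> memory \<beta> (A \<omega>) i"
      unfolding A_def by (rule memory_mono[OF bias_gt1 rw(2)])
    then show ?thesis by (simp only: memory_eq_sum sum_divide_distrib times_divide_eq_right)
  qed
  have mem0: "0 \<le> memory \<beta> ?A' i" for i by (rule memory_nonneg[OF bias_gt1 rw(1)])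
  have "1 / perturbed \<beta> ?A' m \<le> (\<Prod>i<m. 1 / (1 + \<kappa> * ?A' i))
     + (\<Sum>i<m. memory \<beta> ?A' i * satur \<kappa> (?A' i)) + memory \<beta> ?A' m"
    using inverse_perturbed_le[OF bias_gt1 rw(1)] by (simp add: \<kappa>_def)
  also have "\<dots> \<le> (\<Prod>i\<in>{1..<m}. 1 / (1 + \<kappa> * A \<omega> i))
    + (\<Sum>i<m. \<Sum>j<i. A \<omega> j * satur \<kappa> (A \<omega> i) * ((1 / \<beta>) ^ (i - 1 - j) / (\<beta> - 1)))
    + (\<Sum>j<m. A \<omega> j * ((1 / \<beta>) ^ (m - 1 - j) / (\<beta> - 1)))"
  proof (intro add_mono sum_mono mem)
    have r: "?A' i = A \<omega> i" if "i \<noteq> 0" for i using that by (simp add: root_weight_def A_def)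
    have nn: "0 \<le> 1 / (1 + \<kappa> * ?A' i)" "1 / (1 + \<kappa> * ?A' i) \<le> 1" for i
      using k rw(1) by (auto simp: divide_le_eq)
    have "(\<Prod>i<m. 1 / (1 + \<kappa> * ?A' i)) \<le> (\<Prod>i\<in>{1..<m}. 1 / (1 + \<kappa> * ?A' i))"
    proof (cases m)
      case (Suc l)
      have "{..<m} = insert 0 {1..<m}" unfolding Suc by auto
      then have "(\<Prod>i<m. 1 / (1 + \<kappa> * ?A' i)) = 1 / (1 + \<kappa> * ?A' 0) * (\<Prod>i\<in>{1..<m}. 1 / (1 + \<kappa> * ?A' i))"
        by simp
      also have "\<dots> \<le> 1 * (\<Prod>i\<in>{1..<m}. 1 / (1 + \<kappa> * ?A' i))"
        by (intro mult_right_mono nn prod_nonneg)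
      finally show ?thesis by simp
    qed simp
    also have "\<dots> = (\<Prod>i\<in>{1..<m}. 1 / (1 + \<kappa> * A \<omega> i))" by (intro prod.cong) (auto simp: r)
    finally show "(\<Prod>i<m. 1 / (1 + \<kappa> * ?A' i)) \<le> (\<Prod>i\<in>{1..<m}. 1 / (1 + \<kappa> * A \<omega> i))" .
    fix i
    have "memory \<beta> ?A' i * satur \<kappa> (?A' i)
      \<le> (\<Sum>j<i. A \<omega> j * ((1 / \<beta>) ^ (i - 1 - j) / (\<beta> - 1))) * satur \<kappa> (A \<omega> i)"
    proof (rule mult_mono[OF mem _ order_trans[OF mem0 mem] satur_bounds(1)[OF k rw(1)]])
      show "satur \<kappa> (?A' i) \<le> satur \<kappa> (A \<omega> i)"
        unfolding A_def by (rule satur_mono[OF k rw])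
    qed
    also have "\<dots> = (\<Sum>j<i. A \<omega> j * satur \<kappa> (A \<omega> i) * ((1 / \<beta>) ^ (i - 1 - j) / (\<beta> - 1)))"
      unfolding sum_distrib_right by (intro sum.cong refl) (simp only: mult_ac)
    finally show "memory \<beta> ?A' i * satur \<kappa> (?A' i)
      \<le> (\<Sum>j<i. A \<omega> j * satur \<kappa> (A \<omega> i) * ((1 / \<beta>) ^ (i - 1 - j) / (\<beta> - 1)))" .
  qed
  finally show ?thesis .
qed

lemma bud_integrals:
  assumes \<epsilon>: "0 < \<epsilon>"
  shows "finite I \<Longrightarrow> has_bochner_integral (tree_measure \<xi>) (\<lambda>\<omega>. \<Prod>i\<in>I. 1 / (1 + \<kappa> * bud_weight \<beta> \<epsilon> \<omega> i))
      ((1 - slow_rate \<epsilon>) ^ card I)"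
    and "has_bochner_integral (tree_measure \<xi>) (\<lambda>\<omega>. bud_weight \<beta> \<epsilon> \<omega> j) (weight_mean \<epsilon>)"
    and "i \<noteq> j \<Longrightarrow> has_bochner_integral (tree_measure \<xi>)
      (\<lambda>\<omega>. bud_weight \<beta> \<epsilon> \<omega> j * satur \<kappa> (bud_weight \<beta> \<epsilon> \<omega> i)) (weight_mean \<epsilon> * slow_rate \<epsilon>)"
proof -
  have k: "0 \<le> \<kappa>" using kappa_pos by simp
  note S = bud_nn_satur[OF \<epsilon>]
  show "has_bochner_integral (tree_measure \<xi>) (\<lambda>\<omega>. \<Prod>i\<in>I. 1 / (1 + \<kappa> * bud_weight \<beta> \<epsilon> \<omega> i))
      ((1 - slow_rate \<epsilon>) ^ card I)" if I: "finite I"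
    using has_integral_bud_prod[OF bias_gt1 \<epsilon> I, of "\<lambda>_ x. 1 / (1 + \<kappa> * x)" "\<lambda>_. 1 - slow_rate \<epsilon>" \<xi>] S k
    by simp
  show "has_bochner_integral (tree_measure \<xi>) (\<lambda>\<omega>. bud_weight \<beta> \<epsilon> \<omega> j) (weight_mean \<epsilon>)"
    using has_integral_bud_prod[OF bias_gt1 \<epsilon>, of "{j}" "\<lambda>_ x. x" "\<lambda>_. weight_mean \<epsilon>" \<xi>]
      bud_nn_id[OF \<epsilon>] weight_mean_nonneg[OF \<epsilon>] by simp
  assume ij: "i \<noteq> j"
  have "has_bochner_integral (tree_measure \<xi>)
    (\<lambda>\<omega>. \<Prod>l\<in>{i, j}. (if l = j then bud_weight \<beta> \<epsilon> \<omega> l else satur \<kappa> (bud_weight \<beta> \<epsilon> \<omega> l)))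
    (\<Prod>l\<in>{i, j}. if l = j then weight_mean \<epsilon> else slow_rate \<epsilon>)"
    by (rule has_integral_bud_prod[OF bias_gt1 \<epsilon>, where h="\<lambda>l x. if l = j then x else satur \<kappa> x"])
      (use ij S bud_nn_id[OF \<epsilon>] weight_mean_nonneg[OF \<epsilon>] satur_bounds(1)[OF k] in auto)
  then show "has_bochner_integral (tree_measure \<xi>)
      (\<lambda>\<omega>. bud_weight \<beta> \<epsilon> \<omega> j * satur \<kappa> (bud_weight \<beta> \<epsilon> \<omega> i)) (weight_mean \<epsilon> * slow_rate \<epsilon>)"
    using ij by (simp add: mult.commute)
qed

text \<open>In the error terms indices \<open>j < i\<close> differ, so expectations factorise into
  \<open>weight_mean\<close> times \<open>slow_rate\<close>. The geometric discounts sum to at most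
  \<open>\<kappa> / (\<beta> - 1)\<close> for each i, and the final summand 1 stems from the memory
  at the end point \<open>m\<close>.\<close>

lemma annealed_laplace_bounds:
  assumes \<epsilon>: "0 < \<epsilon>"
  shows "(1 - slow_rate \<epsilon>) ^ m \<le> annealed_laplace m \<epsilon>"
    and "annealed_laplace m \<epsilon> \<le> (1 - slow_rate \<epsilon>) ^ (m - 1)
      + \<kappa> / (\<beta> - 1) * weight_mean \<epsilon> * (real m * slow_rate \<epsilon> + 1)"
proof -
  define L where "L \<omega> = (1 - 1 / (1 + \<epsilon>)) * (\<Sum>n. quenched_hit \<beta> \<omega> m n * (1 / (1 + \<epsilon>)) ^ n)" for \<omega>
  define A where "A = bud_weight \<beta> \<epsilon>"
  have L: "has_bochner_integral (tree_measure \<xi>) L (annealed_laplace m \<epsilon>)"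
    unfolding L_def by (rule annealed_laplace_integral[OF \<epsilon>])
  have LP: "AE \<omega> in tree_measure \<xi>. L \<omega> = 1 / perturbed \<beta> (root_weight \<beta> \<epsilon> \<omega>) m"
    using AE_spine_data by eventually_elim (simp add: L_def quenched_laplace[OF bias_gt1 \<epsilon>])
  note I = bud_integrals[OF \<epsilon>, folded A_def]
  have low: "AE \<omega> in tree_measure \<xi>. (\<Prod>i<m. 1 / (1 + \<kappa> * A \<omega> i)) \<le> L \<omega>"
    using LP by eventually_elim (simp add: A_def quenched_laplace_lower[OF \<epsilon>])
  have I1: "has_bochner_integral (tree_measure \<xi>) (\<lambda>\<omega>. \<Prod>i<m. 1 / (1 + \<kappa> * A \<omega> i)) ((1 - slow_rate \<epsilon>) ^ m)"
    using I(1)[of "{..<m}"] by simp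
  show "(1 - slow_rate \<epsilon>) ^ m \<le> annealed_laplace m \<epsilon>"
    using integral_mono_AE[OF _ _ low] I1 L by (simp add: has_bochner_integral_iff)
  define c where "c i j = (1 / \<beta>) ^ (i - 1 - j) / (\<beta> - 1)" for i j :: nat
  have c: "(\<Sum>j<i. c i j) \<le> \<kappa> / (\<beta> - 1)" for i
  proof -
    have "(\<Sum>j<i. (1 / \<beta>) ^ (i - 1 - j)) \<le> 1 / (1 - 1 / \<beta>)"
      using bias_gt1 by (intro sum_reversed_geometric_le) auto
    also have "\<dots> = \<kappa>" using bias_gt1 by (simp add: \<kappa>_def field_simps)
    finally show ?thesis unfolding c_def sum_divide_distrib[symmetric]
      using bias_gt1 by (intro divide_right_mono) auto
  qed
  let ?U = "\<lambda>\<omega>. (\<Prod>i\<in>{1..<m}. 1 / (1 + \<kappa> * A \<omega> i))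
    + (\<Sum>i<m. \<Sum>j<i. A \<omega> j * satur \<kappa> (A \<omega> i) * c i j) + (\<Sum>j<m. A \<omega> j * c m j)"
  have up: "AE \<omega> in tree_measure \<xi>. L \<omega> \<le> ?U \<omega>"
    using LP
  proof eventually_elim
    case (elim \<omega>)
    then show ?case unfolding A_def c_def using quenched_laplace_upper[OF \<epsilon>, of \<omega> m] by simp
  qed
  have U: "has_bochner_integral (tree_measure \<xi>) ?U ((1 - slow_rate \<epsilon>) ^ card {1..<m}
      + (\<Sum>i<m. \<Sum>j<i. weight_mean \<epsilon> * slow_rate \<epsilon> * c i j) + (\<Sum>j<m. weight_mean \<epsilon> * c m j))"
    by (intro has_bochner_integral_add has_bochner_integral_sum has_bochner_integral_mult_left I) auto
  have "annealed_laplace m \<epsilon> \<le> (1 - slow_rate \<epsilon>) ^ (m - 1)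
      + (\<Sum>i<m. \<Sum>j<i. weight_mean \<epsilon> * slow_rate \<epsilon> * c i j) + (\<Sum>j<m. weight_mean \<epsilon> * c m j)"
    using integral_mono_AE[OF _ _ up] U L by (simp add: has_bochner_integral_iff)
  also have "\<dots> \<le> (1 - slow_rate \<epsilon>) ^ (m - 1)
      + (\<Sum>i<m. weight_mean \<epsilon> * slow_rate \<epsilon> * (\<kappa> / (\<beta> - 1))) + weight_mean \<epsilon> * (\<kappa> / (\<beta> - 1))"
  proof -
    have "(\<Sum>j<i. w * c i j) \<le> w * (\<kappa> / (\<beta> - 1))" if "0 \<le> w" for w i
      unfolding sum_distrib_left[symmetric] by (rule mult_left_mono[OF c that])
    then show ?thesis
      using weight_mean_nonneg[OF \<epsilon>] bud_nn_satur(3)[OF \<epsilon>]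
      by (intro add_mono order_refl sum_mono) auto
  qed
  also have "\<dots> = (1 - slow_rate \<epsilon>) ^ (m - 1) + \<kappa> / (\<beta> - 1) * weight_mean \<epsilon> * (real m * slow_rate \<epsilon> + 1)"
    by (simp add: algebra_simps add_divide_distrib)
  finally show "annealed_laplace m \<epsilon> \<le> (1 - slow_rate \<epsilon>) ^ (m - 1)
      + \<kappa> / (\<beta> - 1) * weight_mean \<epsilon> * (real m * slow_rate \<epsilon> + 1)" .
qed

lemma annealed_laplace_limit:
  assumes e: "\<And>k. 0 < \<epsilon> k" and lim: "(\<lambda>k. \<epsilon> k * \<beta> ^ k) \<longlonglongrightarrow> \<sigma>" and \<sigma>: "0 < \<sigma>"
    and n: "(\<lambda>k. real (n k) * \<mu> ^ k) \<longlonglongrightarrow> t"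
  shows "(\<lambda>k. annealed_laplace (n k) (\<epsilon> k)) \<longlonglongrightarrow> exp (- (t * (buds * trap_rate \<sigma>)))"
proof -
  define a where "a k = slow_rate (\<epsilon> k)" for k
  have a0: "0 \<le> a k" for k unfolding a_def by (rule bud_nn_satur(3)[OF e])
  have alim: "a \<longlonglongrightarrow> 0" unfolding a_def by (rule slow_rate_tendsto_0[OF e lim \<sigma>])
  have "(\<lambda>k. (real (n k) * \<mu> ^ k) * (a k / \<mu> ^ k)) \<longlonglongrightarrow> t * (buds * trap_rate \<sigma>)"
    unfolding a_def by (intro tendsto_mult n slow_rate_limit[OF e lim \<sigma>])
  then have na: "(\<lambda>k. real (n k) * a k) \<longlonglongrightarrow> t * (buds * trap_rate \<sigma>)"
    using mean_pos by simp
  \<comment> \<open>The exponent lost with the root factor is harmless because \<open>a k\<close>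
    tends to 0.\<close>
  have na1: "(\<lambda>k. real (n k - 1) * a k) \<longlonglongrightarrow> t * (buds * trap_rate \<sigma>)"
  proof (rule tendsto_sandwich)
    show "\<forall>\<^sub>F k in sequentially. real (n k) * a k - a k \<le> real (n k - 1) * a k"
    proof (intro always_eventually allI)
      fix k
      have "(real (n k) - 1) * a k \<le> real (n k - 1) * a k" by (intro mult_right_mono a0) linarith
      then show "real (n k) * a k - a k \<le> real (n k - 1) * a k" by (simp add: left_diff_distrib)
    qed
    show "\<forall>\<^sub>F k in sequentially. real (n k - 1) * a k \<le> real (n k) * a k"
      by (intro always_eventually allI mult_right_mono a0) simp
    show "(\<lambda>k. real (n k) * a k - a k) \<longlonglongrightarrow> t * (buds * trap_rate \<sigma>)"
      using tendsto_diff[OF na alim] by simp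
  qed (rule na)
  show ?thesis
  proof (rule tendsto_sandwich)
    show "\<forall>\<^sub>F k in sequentially. (1 - a k) ^ n k \<le> annealed_laplace (n k) (\<epsilon> k)"
      unfolding a_def using annealed_laplace_bounds(1)[OF e] by (intro always_eventually allI)
    show "\<forall>\<^sub>F k in sequentially. annealed_laplace (n k) (\<epsilon> k) \<le> (1 - a k) ^ (n k - 1)
      + \<kappa> / (\<beta> - 1) * weight_mean (\<epsilon> k) * (real (n k) * a k + 1)"
      unfolding a_def using annealed_laplace_bounds(2)[OF e] by (intro always_eventually allI)
    show "(\<lambda>k. (1 - a k) ^ n k) \<longlonglongrightarrow> exp (- (t * (buds * trap_rate \<sigma>)))"
      by (rule tendsto_power_exp[OF a0 alim na])
    have "(\<lambda>k. (1 - a k) ^ (n k - 1) + \<kappa> / (\<beta> - 1) * weight_mean (\<epsilon> k) * (real (n k) * a k + 1))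
      \<longlonglongrightarrow> exp (- (t * (buds * trap_rate \<sigma>))) + \<kappa> / (\<beta> - 1) * 0 * (t * (buds * trap_rate \<sigma>) + 1)"
      by (intro tendsto_add tendsto_mult tendsto_const na weight_mean_tendsto_0[OF e lim \<sigma>]
          tendsto_power_exp[OF a0 alim na1])
    then show "(\<lambda>k. (1 - a k) ^ (n k - 1) + \<kappa> / (\<beta> - 1) * weight_mean (\<epsilon> k) * (real (n k) * a k + 1))
      \<longlonglongrightarrow> exp (- (t * (buds * trap_rate \<sigma>)))" by simp
  qed
qed

text \<open>Almost sure finiteness of the hitting time: the transform never exceeds the limit
  \<open>l\<close> of the hitting probabilities, while its lower bound tends to 1 as the killing
  disappears.\<close>

lemma annealed_hit_tendsto_1: "annealed_hit m \<longlonglongrightarrow> 1"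
proof -
  obtain l where l: "annealed_hit m \<longlonglongrightarrow> l" "\<And>n. annealed_hit m n \<le> l"
    using incseq_convergent[OF annealed_hit_mono, of m 1] annealed_hit_bounds(2) by blast
  have l1: "l \<le> 1" by (rule LIMSEQ_le_const2[OF l(1)]) (use annealed_hit_bounds in auto)
  define \<epsilon> where "\<epsilon> k = 1 / \<beta> ^ k" for k
  have e: "0 < \<epsilon> k" for k using bias_gt1 by (simp add: \<epsilon>_def)
  have lim: "(\<lambda>k. \<epsilon> k * \<beta> ^ k) \<longlonglongrightarrow> 1" using bias_gt1 by (simp add: \<epsilon>_def)
  have "annealed_laplace m (\<epsilon> k) \<le> l" for k
  proof -
    define q where "q = 1 / (1 + \<epsilon> k)"
    have q: "0 < q" "q < 1" using e[of k] by (auto simp: q_def)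
    have "(\<Sum>n. annealed_hit m n * q ^ n) \<le> (\<Sum>n. l * q ^ n)"
      using q l(2) by (intro suminf_le sums_by_parts_geometric(1)[OF annealed_hit_bounds q] summable_mult summable_geometric mult_right_mono) auto
    also have "\<dots> = l / (1 - q)"
      using q by (simp add: suminf_mult summable_geometric suminf_geometric)
    finally have "(1 - q) * (\<Sum>n. annealed_hit m n * q ^ n) \<le> (1 - q) * (l / (1 - q))"
      using q by (intro mult_left_mono) auto
    then show ?thesis using q by (simp add: annealed_laplace_def q_def)
  qed
  then have "(1 - slow_rate (\<epsilon> k)) ^ m \<le> l" for k
    using annealed_laplace_bounds(1)[OF e[of k], of m] order_trans by blast
  moreover have "(\<lambda>k. (1 - slow_rate (\<epsilon> k)) ^ m) \<longlonglongrightarrow> (1 - 0) ^ m"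
    by (intro tendsto_intros slow_rate_tendsto_0[OF e lim]) simp
  ultimately have "1 \<le> l" by (auto intro: LIMSEQ_le_const2)
  then show ?thesis using l(1) l1 by simp
qed

subsection \<open>Convergence in distribution\<close>

lemma annealed_cdf_eq:
  "0 < c \<Longrightarrow> annealed_cdf \<xi> \<beta> m (x * c) = (if x < 0 then 0 else annealed_hit m (nat \<lfloor>x * c\<rfloor>))"
  by (simp add: annealed_cdf_def annealed_hit_def mult_less_0_iff)

text \<open>The indices \<open>n\<close> and the normalisation \<open>b\<close> are independent
  parameters, so that \<open>t\<close> can be changed while the time scale is kept; infinite
  divisibility depends on this freedom.\<close>

lemma scaled_hitting_time_converges:
  assumes t: "0 < t" and c: "0 < c" and n: "(\<lambda>k. real (n k) * \<mu> ^ k) \<longlonglongrightarrow> t"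
    and b: "\<And>k. 0 < b k" and blim: "(\<lambda>k. b k / \<beta> ^ k) \<longlonglongrightarrow> c"
  obtains \<nu> where "real_distribution \<nu>" "AE x in \<nu>. 0 \<le> x"
    "\<And>\<theta>. 0 < \<theta> \<Longrightarrow> (\<integral>x. exp (- \<theta> * x) \<partial>\<nu>) = exp (- (t * (buds * trap_rate (\<theta> / c))))"
    "weak_conv (\<lambda>k x. annealed_cdf \<xi> \<beta> (n k) (x * b k)) (cdf \<nu>)"
proof -
  define Q where "Q k M \<longleftrightarrow> real_distribution M \<and> (AE x in M. 0 \<le> x) \<and>
      (\<forall>x. cdf M x = annealed_cdf \<xi> \<beta> (n k) (x * b k)) \<and>
      (\<forall>\<theta>>0. (\<integral>x. exp (- \<theta> * x) \<partial>M)
        = (1 - exp (- \<theta> / b k)) * (\<Sum>j. annealed_hit (n k) j * exp (- \<theta> / b k) ^ j))" for k M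
  have "\<exists>M. Q k M" for k
  proof -
    show ?thesis
    proof (rule lattice_distribution[OF annealed_hit_mono[of "n k"] annealed_hit_bounds(1) annealed_hit_tendsto_1 b[of k]])
      fix M
      assume "real_distribution M" "AE x in M. 0 \<le> x"
        "\<And>x. cdf M x = (if x < 0 then 0 else annealed_hit (n k) (nat \<lfloor>x * b k\<rfloor>))"
        "\<And>\<theta>. 0 < \<theta> \<Longrightarrow> (\<integral>x. exp (- \<theta> * x) \<partial>M)
          = (1 - exp (- \<theta> / b k)) * (\<Sum>j. annealed_hit (n k) j * exp (- \<theta> / b k) ^ j)"
      then have "Q k M" unfolding Q_def annealed_cdf_eq[OF b] by blast
      then show "\<exists>M. Q k M" ..
    qed
  qed
  then have "\<exists>M. \<forall>k. Q k (M k)" by (intro choice allI)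
  then obtain M where Q: "\<And>k. Q k (M k)" by blast
  have M: "\<And>k. real_distribution (M k)" "\<And>k. AE x in M k. 0 \<le> x"
    "\<And>k x. cdf (M k) x = annealed_cdf \<xi> \<beta> (n k) (x * b k)"
    "\<And>k \<theta>. 0 < \<theta> \<Longrightarrow> (\<integral>x. exp (- \<theta> * x) \<partial>M k)
        = (1 - exp (- \<theta> / b k)) * (\<Sum>j. annealed_hit (n k) j * exp (- \<theta> / b k) ^ j)"
    using Q unfolding Q_def by blast+
  have inv: "(\<lambda>k. \<beta> ^ k / b k) \<longlonglongrightarrow> 1 / c"
    using tendsto_divide[OF tendsto_const blim, of 1] c bias_gt1 by simp
  have "(\<lambda>k. \<beta> ^ k / b k * (1 / \<beta>) ^ k) \<longlonglongrightarrow> 1 / c * 0"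
    using bias_gt1 by (intro tendsto_mult inv LIMSEQ_power_zero) simp
  then have binv: "(\<lambda>k. 1 / b k) \<longlonglongrightarrow> 0" using bias_gt1 by (simp add: power_divide)
  have conv: "(\<lambda>k. \<integral>x. exp (- \<theta> * x) \<partial>M k) \<longlonglongrightarrow> exp (- (t * (buds * trap_rate (\<theta> / c))))" if \<theta>: "0 < \<theta>" for \<theta>
  proof -
    define y where "y k = \<theta> / b k" for k
    \<comment> \<open>Chosen so that \<open>1 / (1 + \<epsilon> k)\<close> equals
      \<open>exp (- \<theta> / b k)\<close>.\<close>
    define \<epsilon> where "\<epsilon> k = exp (y k) - 1" for k
    have y: "0 < y k" for k using \<theta> b by (simp add: y_def)
    have e: "0 < \<epsilon> k" for k using y by (simp add: \<epsilon>_def)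
    have yb: "(\<lambda>k. y k * \<beta> ^ k) \<longlonglongrightarrow> \<theta> / c"
      using tendsto_mult_left[OF inv, of \<theta>] by (simp add: y_def)
    have y0: "y \<longlonglongrightarrow> 0" using tendsto_mult_left[OF binv, of \<theta>] by (simp add: y_def[abs_def])
    have lim: "(\<lambda>k. \<epsilon> k * \<beta> ^ k) \<longlonglongrightarrow> \<theta> / c"
    proof (rule tendsto_sandwich[OF _ _ yb])
      have pk: "0 \<le> \<beta> ^ k" for k using bias_gt1 by simp
      show "\<forall>\<^sub>F k in sequentially. y k * \<beta> ^ k \<le> \<epsilon> k * \<beta> ^ k"
        unfolding \<epsilon>_def using exp_minus_one_bounds(1)[OF less_imp_le[OF y]] pk
        by (intro always_eventually allI mult_right_mono)
      show "\<forall>\<^sub>F k in sequentially. \<epsilon> k * \<beta> ^ k \<le> y k * exp (y k) * \<beta> ^ k"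
        unfolding \<epsilon>_def using exp_minus_one_bounds(2)[OF less_imp_le[OF y]] pk
        by (intro always_eventually allI mult_right_mono)
      have "(\<lambda>k. y k * \<beta> ^ k * exp (y k)) \<longlonglongrightarrow> \<theta> / c * exp 0" by (intro tendsto_intros yb y0)
      then show "(\<lambda>k. y k * exp (y k) * \<beta> ^ k) \<longlonglongrightarrow> \<theta> / c" by (simp add: mult_ac)
    qed
    have "(\<integral>x. exp (- \<theta> * x) \<partial>M k) = annealed_laplace (n k) (\<epsilon> k)" for k
    proof -
      have "1 / (1 + \<epsilon> k) = exp (- \<theta> / b k)" by (simp add: \<epsilon>_def y_def exp_minus divide_inverse)
      then show ?thesis using M(4)[OF \<theta>, of k] by (simp add: annealed_laplace_def)
    qed
    moreover have "(\<lambda>k. annealed_laplace (n k) (\<epsilon> k)) \<longlonglongrightarrow> exp (- (t * (buds * trap_rate (\<theta> / c))))"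
      using \<theta> c by (intro annealed_laplace_limit[OF e lim _ n]) simp
    ultimately show ?thesis by simp
  qed
  \<comment> \<open>Small values of the exponent are found along \<sigma> = \<beta>^(-j), where
    \<open>trap_rate_scale\<close> yields the explicit factor \<open>\<mu> ^ j\<close>.\<close>
  have zero: "\<exists>\<theta>>0. exp (- (t * (buds * trap_rate (\<theta> / c)))) > 1 - \<delta>" if "0 < \<delta>" for \<delta> :: real
  proof -
    have r: "trap_rate (1 / \<beta> ^ j) = \<mu> ^ j * trap_rate 1" for j
    proof (induction j)
      case (Suc j)
      have "trap_rate (1 / \<beta> ^ j / \<beta>) = \<mu> * trap_rate (1 / \<beta> ^ j)"
        using bias_gt1 by (intro trap_rate_scale) simp
      then show ?case using Suc by (simp add: mult_ac)
    qed simp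
    have "(\<lambda>j. exp (- (t * (buds * (\<mu> ^ j * trap_rate 1))))) \<longlonglongrightarrow> exp (- (t * (buds * (0 * trap_rate 1))))"
      using mean_pos mean_lt1 by (intro tendsto_intros LIMSEQ_power_zero) simp
    then have "(\<lambda>j. exp (- (t * (buds * trap_rate (1 / \<beta> ^ j))))) \<longlonglongrightarrow> 1" by (simp add: r)
    from order_tendstoD(1)[OF this, of "1 - \<delta>"] that
    obtain j where j: "exp (- (t * (buds * trap_rate (1 / \<beta> ^ j)))) > 1 - \<delta>"
      by (auto simp: eventually_sequentially)
    show ?thesis using j c bias_gt1 by (intro exI[of _ "c / \<beta> ^ j"]) simp
  qed
  obtain \<nu> where \<nu>: "real_distribution \<nu>" "AE x in \<nu>. 0 \<le> x"
    "\<And>\<theta>. 0 < \<theta> \<Longrightarrow> (\<integral>x. exp (- \<theta> * x) \<partial>\<nu>) = exp (- (t * (buds * trap_rate (\<theta> / c))))"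
    "weak_conv_m M \<nu>"
    using laplace_continuity[OF M(1,2) conv zero] by blast
  have "(\<lambda>k. cdf (M k)) = (\<lambda>k x. annealed_cdf \<xi> \<beta> (n k) (x * b k))"
    by (intro ext M(3))
  then have "weak_conv (\<lambda>k x. annealed_cdf \<xi> \<beta> (n k) (x * b k)) (cdf \<nu>)"
    using \<nu>(4) by (simp add: weak_conv_m_def)
  then show ?thesis using that \<nu>(1-3) by blast
qed

section \<open>Normalisation and infinite divisibility\<close>

lemma floor_power_limit:
  assumes "0 < t"
  shows "(\<lambda>k. real (nat \<lfloor>t * (1 / \<mu>) ^ k\<rfloor>) * \<mu> ^ k) \<longlonglongrightarrow> t"
proof (rule tendsto_sandwich)
  have f: "t * (1 / \<mu>) ^ k - 1 \<le> real (nat \<lfloor>t * (1 / \<mu>) ^ k\<rfloor>)" "real (nat \<lfloor>t * (1 / \<mu>) ^ k\<rfloor>) \<le> t * (1 / \<mu>) ^ k" for k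
  proof -
    have "0 \<le> t * (1 / \<mu>) ^ k" using assms mean_pos by simp
    then show "t * (1 / \<mu>) ^ k - 1 \<le> real (nat \<lfloor>t * (1 / \<mu>) ^ k\<rfloor>)" "real (nat \<lfloor>t * (1 / \<mu>) ^ k\<rfloor>) \<le> t * (1 / \<mu>) ^ k"
      by linarith+
  qed
  have p: "0 < \<mu> ^ k" for k using mean_pos by simp
  have c: "t * (1 / \<mu>) ^ k * \<mu> ^ k = t" for k using mean_pos by (simp add: power_divide)
  show "\<forall>\<^sub>F k in sequentially. t - \<mu> ^ k \<le> real (nat \<lfloor>t * (1 / \<mu>) ^ k\<rfloor>) * \<mu> ^ k"
  proof (intro always_eventually allI)
    fix k
    show "t - \<mu> ^ k \<le> real (nat \<lfloor>t * (1 / \<mu>) ^ k\<rfloor>) * \<mu> ^ k"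
      using mult_right_mono[OF f(1)[of k] less_imp_le[OF p[of k]]] c[of k] by (simp add: left_diff_distrib)
  qed
  show "\<forall>\<^sub>F k in sequentially. real (nat \<lfloor>t * (1 / \<mu>) ^ k\<rfloor>) * \<mu> ^ k \<le> t"
  proof (intro always_eventually allI)
    fix k
    show "real (nat \<lfloor>t * (1 / \<mu>) ^ k\<rfloor>) * \<mu> ^ k \<le> t"
      using mult_right_mono[OF f(2)[of k] less_imp_le[OF p[of k]]] c[of k] by simp
  qed
  have "(\<lambda>k. t - \<mu> ^ k) \<longlonglongrightarrow> t - 0"
    using mean_pos mean_lt1 by (intro tendsto_intros LIMSEQ_power_zero) simp
  then show "(\<lambda>k. t - \<mu> ^ k) \<longlonglongrightarrow> t" by simp
qed simp

text \<open>The n-th convolution root is itself a limit law: the one for \<open>t / n\<close> on the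
  time scale \<open>c * \<beta> ^ k\<close> that belongs to \<open>t\<close>. With the common
  \<open>c\<close>, the two exponents are multiples of the same function of \<open>\<theta>\<close>,
  and the n-th power of one transform is the other.\<close>

lemma limit_inf_divisible:
  assumes t: "0 < t" and c: "0 < c" and \<nu>: "real_distribution \<nu>" "AE x in \<nu>. 0 \<le> x"
    "\<And>\<theta>. 0 < \<theta> \<Longrightarrow> (\<integral>x. exp (- \<theta> * x) \<partial>\<nu>) = exp (- (t * (buds * trap_rate (\<theta> / c))))"
  shows "inf_divisible \<nu>"
  unfolding inf_divisible_def
proof (intro conjI allI impI)
  fix n :: nat assume n: "1 \<le> n"
  have tn: "0 < t / real n" using t n by simp
  have b: "0 < c * \<beta> ^ k" for k using c bias_gt1 by simp
  have blim: "(\<lambda>k. c * \<beta> ^ k / \<beta> ^ k) \<longlonglongrightarrow> c" using bias_gt1 by simp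
  obtain \<eta> where \<eta>: "real_distribution \<eta>" "AE x in \<eta>. 0 \<le> x"
    "\<And>\<theta>. 0 < \<theta> \<Longrightarrow> (\<integral>x. exp (- \<theta> * x) \<partial>\<eta>) = exp (- (t / real n * (buds * trap_rate (\<theta> / c))))"
    using scaled_hitting_time_converges[OF tn c floor_power_limit[OF tn] b blim] by blast
  note C = conv_pow_nonneg_laplace[OF \<eta>(1,2), of n]
  have "\<nu> = conv_pow \<eta> n"
  proof (rule laplace_unique[OF \<nu>(1) _ \<nu>(2)])
    show "real_distribution (conv_pow \<eta> n)" using C by blast
    show "AE x in conv_pow \<eta> n. 0 \<le> x" using C by blast
    fix \<theta> :: real assume \<theta>: "0 < \<theta>"
    have "(\<integral>x. exp (- \<theta> * x) \<partial>conv_pow \<eta> n) = exp (- (t / real n * (buds * trap_rate (\<theta> / c)))) ^ n"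
      using C \<theta> \<eta>(3)[OF \<theta>] by simp
    also have "\<dots> = exp (- (t * (buds * trap_rate (\<theta> / c))))"
      using n by (simp add: exp_of_nat_mult[symmetric])
    finally show "(\<integral>x. exp (- \<theta> * x) \<partial>\<nu>) = (\<integral>x. exp (- \<theta> * x) \<partial>conv_pow \<eta> n)"
      using \<nu>(3)[OF \<theta>] by simp
  qed
  then show "\<exists>\<eta>. real_distribution \<eta> \<and> \<nu> = conv_pow \<eta> n" using \<eta>(1) by blast
qed (rule \<nu>(1))

text \<open>The exponent 1/\<gamma> is the one for which \<mu>^k turns into \<beta>^(-k), so the
  normalisation follows the time scale of the traps.\<close>

lemma normalisation_limit:
  fixes n :: "nat \<Rightarrow> nat"
  assumes t: "0 < t" and n: "(\<lambda>k. real (n k) * \<mu> ^ k) \<longlonglongrightarrow> t"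
  defines "a \<equiv> 1 / (ln (1 / \<mu>) / ln \<beta>)"
  shows "(\<lambda>k. real (n k) powr a / \<beta> ^ k) \<longlonglongrightarrow> t powr a"
proof -
  have ln: "ln \<mu> < 0" "0 < ln \<beta>" using mean_pos mean_lt1 bias_gt1 by auto
  have a: "a = - (ln \<beta> / ln \<mu>)"
    using mean_pos by (simp add: a_def ln_div)
  have pow: "(\<mu> ^ k) powr a = 1 / \<beta> ^ k" for k
  proof -
    have "(\<mu> ^ k) powr a = exp (a * (real k * ln \<mu>))"
      using mean_pos by (simp add: powr_def ln_realpow)
    also have "a * (real k * ln \<mu>) = - (real k * ln \<beta>)" using ln by (simp add: a)
    also have "exp (- (real k * ln \<beta>)) = 1 / \<beta> ^ k"
      using bias_gt1 by (simp add: exp_minus exp_of_nat_mult inverse_eq_divide)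
    finally show ?thesis .
  qed
  have "(\<lambda>k. (real (n k) * \<mu> ^ k) powr a) \<longlonglongrightarrow> t powr a"
    using t by (intro tendsto_intros n) simp
  then show ?thesis using mean_pos by (simp add: powr_mult pow)
qed

lemma hitting_time_limit:
  assumes t: "0 < t"
  shows "\<exists>\<nu>. real_distribution \<nu> \<and> inf_divisible \<nu> \<and>
    weak_conv (\<lambda>k x. annealed_cdf \<xi> \<beta> (nat \<lfloor>t * (1 / \<mu>) ^ k\<rfloor>)
      (x * real (nat \<lfloor>t * (1 / \<mu>) ^ k\<rfloor>) powr (1 / (ln (1 / \<mu>) / ln \<beta>)))) (cdf \<nu>)"
proof -
  define n where "n k = nat \<lfloor>t * (1 / \<mu>) ^ k\<rfloor>" for k
  define a where "a = 1 / (ln (1 / \<mu>) / ln \<beta>)"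
  define c where "c = t powr a"
  \<comment> \<open>For small \<open>k\<close> the index may be 0, where \<open>powr\<close> gives
    0; the value 1 restores positivity and affects finitely many \<open>k\<close> only.\<close>
  define b where "b k = (if n k = 0 then 1 else real (n k) powr a)" for k
  have c: "0 < c" using t by (simp add: c_def)
  have nl: "(\<lambda>k. real (n k) * \<mu> ^ k) \<longlonglongrightarrow> t" unfolding n_def by (rule floor_power_limit[OF t])
  have b: "0 < b k" for k by (simp add: b_def)
  have npos: "\<forall>\<^sub>F k in sequentially. n k \<noteq> 0"
    using order_tendstoD(1)[OF nl t]
  proof eventually_elim
    case (elim k)
    then show ?case by (cases "n k = 0") auto
  qed
  have bn: "\<forall>\<^sub>F k in sequentially. real (n k) powr a = b k"
    using npos by eventually_elim (simp add: b_def)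
  have "(\<lambda>k. real (n k) powr a / \<beta> ^ k) \<longlonglongrightarrow> c"
    unfolding a_def c_def by (rule normalisation_limit[OF t nl])
  then have blim: "(\<lambda>k. b k / \<beta> ^ k) \<longlonglongrightarrow> c"
    by (rule Lim_transform_eventually) (use bn in \<open>eventually_elim, simp\<close>)
  obtain \<nu> where \<nu>: "real_distribution \<nu>" "AE x in \<nu>. 0 \<le> x"
    "\<And>\<theta>. 0 < \<theta> \<Longrightarrow> (\<integral>x. exp (- \<theta> * x) \<partial>\<nu>) = exp (- (t * (buds * trap_rate (\<theta> / c))))"
    "weak_conv (\<lambda>k x. annealed_cdf \<xi> \<beta> (n k) (x * b k)) (cdf \<nu>)"
    using scaled_hitting_time_converges[OF t c nl b blim] by blast
  have "weak_conv (\<lambda>k x. annealed_cdf \<xi> \<beta> (n k) (x * real (n k) powr a)) (cdf \<nu>)"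
    unfolding weak_conv_def
  proof (intro allI impI)
    fix x assume "isCont (cdf \<nu>) x"
    then have "(\<lambda>k. annealed_cdf \<xi> \<beta> (n k) (x * b k)) \<longlonglongrightarrow> cdf \<nu> x"
      using \<nu>(4) by (simp add: weak_conv_def)
    then show "(\<lambda>k. annealed_cdf \<xi> \<beta> (n k) (x * real (n k) powr a)) \<longlonglongrightarrow> cdf \<nu> x"
      by (rule Lim_transform_eventually) (use bn in \<open>eventually_elim, simp\<close>)
  qed
  then show ?thesis
    using \<nu>(1) limit_inf_divisible[OF t c \<nu>(1-3)] unfolding n_def a_def by blast
qed

end

theorem theorem2:
  fixes \<xi> :: "nat pmf" and \<beta> :: real
  assumes "0 < mean_off \<xi>" and "mean_off \<xi> < 1"
    and "integrable (measure_pmf \<xi>) (\<lambda>k. (real k)\<^sup>2)"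
    and "1 < 1 / mean_off \<xi>" and "1 / mean_off \<xi> < \<beta>"
  shows "\<forall>t>0. \<exists>\<nu>. real_distribution \<nu> \<and> inf_divisible \<nu> \<and>
           weak_conv
             (\<lambda>k. let n = nat \<lfloor>t * (1 / mean_off \<xi>) ^ k\<rfloor>;
                      \<gamma> = ln (1 / mean_off \<xi>) / ln \<beta>
                  in (\<lambda>x. annealed_cdf \<xi> \<beta> n (x * real n powr (1 / \<gamma>))))
             (cdf \<nu>)"
proof -
  interpret subcritical_walk \<xi> \<beta>
    using assms by unfold_locales
  show ?thesis using hitting_time_limit by (simp only: Let_def) blast
qed

end
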